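(* For any $s>1/2$ and $1\le p<\infty$, the problem of $L_p$-approximation is polynomially tractable on $F^{s,d}_{\rm mix}$. More precisely, for $p\ge 2$ (and $p<\infty$), there is a constant $C>0$, depending only on $s$ and $p$, such that for all $d\ge 2$ and $\varepsilon\in(0,1/2)$, \[ n(\varepsilon,F^{s,d}_{\rm mix},L_p)\,\le\, C\,d^2\log(d)\,\varepsilon^{-p}\log^4(\varepsilon^{-1}). \]
   Context: For $f\in C([0,1]^d)$ (continuous, complex-valued) and $k\in\mathbb{Z}^d$, let $\hat f(k)=\int_{[0,1]^d} f(x)e^{-2\pi i\langle k,x\rangle}\,dx$. For $s>1/2$ define \[ H^{s,d}_{\rm mix}:=\Big\{f\in C([0,1]^d)\ \Big|\ \sum_{k\in\mathbb{Z}^d}|\hat f(k)|^2\prod_{i=1}^d\max\{1,|k_i|^{2s}\}\le 1\Big\}, \] \[ F^{s,d}_{\rm mix}:=\Big\{f\in H^{s,d}_{\rm mix}\ \Big|\ \sum_{k\in\mathbb{Z}^d}|\hat f(k)|\le 1\Big\}. \] For a class $F_d$ of functions on $[0,1]^d$, the (information) complexity $n(\varepsilon,F_d,L_p)$ is the minimal $n\in\mathbb{N}=\{0,1,2,\dots\}$ for which there are sampling points $x_1,\dots,x_n\in[0,1]^d$ and a (possibly non-linear) recovery map $\phi\colon\mathbb{C}^n\to L_p([0,1]^d)$ such that $A_n(f)=\phi(f(x_1),\dots,f(x_n))$ satisfies $\sup_{f\in F_d}\|f-A_n(f)\|_p\le\varepsilon$ (for $n=0$, $A_n$ is a constant map),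 where $\|\cdot\|_p$ is the norm of $L_p([0,1]^d)$ with Lebesgue measure. The problem of $L_p$-approximation (sampling recovery in $L_p$) on $F_d$ is polynomially tractable if there exist $C,q,r\ge 0$ such that $n(\varepsilon,F_d,L_p)\le C d^q\varepsilon^{-r}$ for all integers $d\ge 1$ and all $\varepsilon>0$. *)

theory Defs
  imports "HOL-Analysis.Analysis"
begin

text \<open>
  The dimension \<open>d\<close> is quantified inside the statements, so \<open>[0,1]\<^sup>d\<close>, \<open>\<int>\<^sup>d\<close> and \<open>\<complex>\<^sup>n\<close> are
  sets of extensional functions on the initial segments of \<^typ>\<open>nat\<close>.
  Functions on \<open>[0,1]\<^sup>d\<close> are total HOL functions; their values outside
  the cube never matter.
\<close>

definition cube :: "nat \<Rightarrow> (nat \<Rightarrow> real) set" where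
  "cube d = {..<d} \<rightarrow>\<^sub>E {0..1}"

definition cube_measure :: "nat \<Rightarrow> (nat \<Rightarrow> real) measure" where
  "cube_measure d = Pi\<^sub>M {..<d} (\<lambda>_. restrict_space lborel {0..1})"

definition fourier_coeff :: "nat \<Rightarrow> ((nat \<Rightarrow> real) \<Rightarrow> complex) \<Rightarrow> (nat \<Rightarrow> int) \<Rightarrow> complex" where
  "fourier_coeff d f k =
     (LINT x|cube_measure d.
        f x * exp (- (2 * complex_of_real pi * \<i> * complex_of_real (\<Sum>i<d. real_of_int (k i) * x i))))"

definition H_mix :: "real \<Rightarrow> nat \<Rightarrow> ((nat \<Rightarrow> real) \<Rightarrow> complex) set" where
  "H_mix s d =
     {f. continuous_on (cube d) f \<and>
         (let a = (\<lambda>k. (cmod (fourier_coeff d f k))\<^sup>2 *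
                       (\<Prod>i<d. max 1 (real_of_int \<bar>k i\<bar> powr (2 * s))))
          in a summable_on ({..<d} \<rightarrow>\<^sub>E UNIV) \<and> infsum a ({..<d} \<rightarrow>\<^sub>E UNIV) \<le> 1)}"

definition F_mix :: "real \<Rightarrow> nat \<Rightarrow> ((nat \<Rightarrow> real) \<Rightarrow> complex) set" where
  "F_mix s d =
     {f \<in> H_mix s d.
         (let a = (\<lambda>k. cmod (fourier_coeff d f k))
          in a summable_on ({..<d} \<rightarrow>\<^sub>E UNIV) \<and> infsum a ({..<d} \<rightarrow>\<^sub>E UNIV) \<le> 1)}"

definition Lp_space :: "real \<Rightarrow> nat \<Rightarrow> ((nat \<Rightarrow> real) \<Rightarrow> complex) set" where
  "Lp_space p d =
     {g \<in> borel_measurable (cube_measure d). integrable (cube_measure d) (\<lambda>x. cmod (g x) powr p)}"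

text \<open>The value \<open>\<infinity>\<close> outside \<open>L\<^sub>p\<close> is needed because the Bochner integral of a
  non-integrable function is \<open>0\<close>.\<close>

definition Lp_norm :: "real \<Rightarrow> nat \<Rightarrow> ((nat \<Rightarrow> real) \<Rightarrow> complex) \<Rightarrow> ereal" where
  "Lp_norm p d g =
     (if g \<in> Lp_space p d
      then ereal ((LINT x|cube_measure d. cmod (g x) powr p) powr (1 / p))
      else \<infinity>)"

definition recoverable ::
  "nat \<Rightarrow> real \<Rightarrow> nat \<Rightarrow> ((nat \<Rightarrow> real) \<Rightarrow> complex) set \<Rightarrow> real \<Rightarrow> bool" where
  "recoverable n \<epsilon> d F p \<longleftrightarrow>
     (\<exists>x \<in> {..<n} \<rightarrow> cube d. \<exists>\<phi> \<in> ({..<n} \<rightarrow>\<^sub>E (UNIV :: complex set)) \<rightarrow> Lp_space p d.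
        (SUP f\<in>F. Lp_norm p d (\<lambda>t. f t - \<phi> (\<lambda>j\<in>{..<n}. f (x j)) t)) \<le> ereal \<epsilon>)"

text \<open>The infimum is \<open>\<infinity>\<close> if no number of samples suffices, and a minimum otherwise.\<close>

definition complexity ::
  "real \<Rightarrow> nat \<Rightarrow> ((nat \<Rightarrow> real) \<Rightarrow> complex) set \<Rightarrow> real \<Rightarrow> enat" where
  "complexity \<epsilon> d F p = (INF n\<in>{n. recoverable n \<epsilon> d F p}. enat n)"

definition polynomially_tractable ::
  "(nat \<Rightarrow> ((nat \<Rightarrow> real) \<Rightarrow> complex) set) \<Rightarrow> real \<Rightarrow> bool" where
  "polynomially_tractable F p \<longleftrightarrow>
     (\<exists>C q r. 0 \<le> C \<and> 0 \<le> q \<and> 0 \<le> r \<and>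
        (\<forall>d\<ge>1. \<forall>\<epsilon>>0. ereal_of_enat (complexity \<epsilon> d (F d) p)
                       \<le> ereal (C * real d powr q * \<epsilon> powr (- r))))"

end

theory Submission
  imports Defs "HOL-Probability.Infinite_Product_Measure"
begin

text \<open>
  A recovery map is only asked to be consistent: it may return any member of the class with the
  observed data.  Its error is then at most the largest distance between two members that agree at
  the sampling points, so the task is to choose points such that the difference \<open>h\<close> of two members
  is small in \<open>L\<^sub>p\<close> whenever it vanishes at all of them (\<open>recoverable_F_mixI\<close>).

  Up to a small uniform error, \<open>h\<close> is a trigonometric polynomial \<open>\<Sum>\<^sub>k c\<^sub>k e\<^sub>k\<close> with \<open>\<Sum>\<^sub>k |c\<^sub>k| \<le> 2\<close> and with
  frequencies in a box \<open>J\<close>: a continuous function on the cube is bounded by the sum of the moduli of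
  its Fourier coefficients (\<open>continuous_le_wiener_norm\<close>), and by the Cauchy-Schwarz inequality the
  mixed smoothness makes that sum small outside a box of side length \<open>e\<^bsup>O(d + ln(1/\<epsilon>))\<^esup>\<close>
  (\<open>H_mix_tail_le\<close>).  Hence \<open>ln |J|\<close> is \<open>O(d\<^sup>2 ln(1/\<epsilon>))\<close>.

  Let \<open>p \<ge> 2\<close> and suppose that the \<open>L\<^sub>p\<close> norm of \<open>h\<close> exceeds \<open>\<epsilon>\<close>.  Among \<open>O(ln(1/\<epsilon>))\<close> dyadic levels there
  is a level \<open>t\<close> such that \<open>{|h| \<ge> t}\<close> has measure at least \<open>q\<close>, where \<open>q\<close> is of the order of
  \<open>\<epsilon>\<^sup>p t\<^bsup>-p\<^esup> / ln(1/\<epsilon>)\<close>.  Maurey's empirical method replaces \<open>h\<close> by an average of \<open>m\<close> signed real or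
  imaginary parts of characters, \<open>m\<close> of the order of \<open>t\<^bsup>-2\<^esup> ln n\<close>, which differs from \<open>h\<close> by less than
  a fraction of \<open>t\<close> at every sampling point and outside a set of measure \<open>1/(4n)\<close>
  (\<open>exists_average_close\<close>).  There are only
  \<open>|J|\<^bsup>O(m)\<^esup>\<close> such averages, so \<open>n\<close> points can hit all of their level sets of measure at least \<open>q/2\<close>
  as soon as \<open>n q\<close> dominates \<open>m ln |J|\<close> (\<open>exists_hitting_points\<close>), that is, as soon as \<open>n\<close> dominates
  \<open>\<epsilon>\<^bsup>-p\<^esup> t\<^bsup>p-2\<^esup> ln(1/\<epsilon>) ln n ln |J|\<close>, where \<open>t\<^bsup>p-2\<^esup>\<close> is bounded.  A hit is a sampling point at which the
  average is large while \<open>h\<close> is zero, a contradiction (\<open>exists_points_Lp_small\<close>).  Since \<open>ln n\<close> is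
  \<open>O(ln d ln(1/\<epsilon>))\<close>, this gives the bound for \<open>p \<ge> 2\<close>.  For \<open>p < 2\<close> the exponent \<open>2\<close> is used instead,
  which costs only powers of \<open>1/\<epsilon>\<close>.

  Both probabilistic choices, of the points and of the averages, are made one element at a time:
  a nonnegative potential does not grow too much on average, hence not for some choice either.
\<close>

section \<open>Finite sets of points that hit many large events\<close>

text \<open>
  Derandomised union bound.  The hypothesis says that \<open>n\<close> independent random points leave fewer than
  one of the events unhit in expectation; the first point is chosen such that the expectation over
  the remaining ones does not increase.
\<close>

lemma (in prob_space) exists_hitting_points:
  fixes A :: "'i \<Rightarrow> 'a set"
  assumes "finite \<Gamma>" and "\<And>\<gamma>. \<gamma> \<in> \<Gamma> \<Longrightarrow> A \<gamma> \<in> events"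
    and "(\<Sum>\<gamma>\<in>\<Gamma>. (1 - prob (A \<gamma>)) ^ n) < 1"
  shows "\<exists>x. (\<forall>j<n. x j \<in> space M) \<and> (\<forall>\<gamma>\<in>\<Gamma>. \<exists>j<n. x j \<in> A \<gamma>)"
  using assms
proof (induction n arbitrary: \<Gamma>)
  case 0
  then have "\<Gamma> = {}"
    by simp
  then show ?case by auto
next
  case (Suc n)
  define F where "F x = (\<Sum>\<gamma>\<in>\<Gamma>. indicator (space M - A \<gamma>) x * (1 - prob (A \<gamma>)) ^ n)" for x
  have ev: "space M - A \<gamma> \<in> events" if "\<gamma> \<in> \<Gamma>" for \<gamma>
    using Suc.prems(2)[OF that] by auto
  have int1: "integrable M (\<lambda>x. indicator (space M - A \<gamma>) x * (1 - prob (A \<gamma>)) ^ n)"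
    if "\<gamma> \<in> \<Gamma>" for \<gamma>
    using ev[OF that] by (auto intro!: integrable_real_indicator simp: emeasure_eq_measure)
  have int: "integrable M F"
    unfolding F_def using int1 by auto
  have "expectation F = (\<Sum>\<gamma>\<in>\<Gamma>. prob (space M - A \<gamma>) * (1 - prob (A \<gamma>)) ^ n)"
    unfolding F_def using int1 ev by (subst Bochner_Integration.integral_sum) auto
  also have "\<dots> = (\<Sum>\<gamma>\<in>\<Gamma>. (1 - prob (A \<gamma>)) ^ Suc n)"
    using Suc.prems(2) by (intro sum.cong) (auto simp: prob_compl)
  finally have lt: "expectation F < 1"
    using Suc.prems(3) by simp
  have "\<exists>x\<in>space M. F x < 1"
  proof (rule ccontr)
    assume "\<not> (\<exists>x\<in>space M. F x < 1)"
    then have "expectation (\<lambda>_. 1) \<le> expectation F"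
      using int by (intro integral_mono) (auto simp: not_less)
    then show False
      using lt by (simp add: prob_space)
  qed
  then obtain x0 where x0: "x0 \<in> space M" "F x0 < 1" by blast
  define \<Gamma>' where "\<Gamma>' = {\<gamma>\<in>\<Gamma>. x0 \<notin> A \<gamma>}"
  have "(\<Sum>\<gamma>\<in>\<Gamma>'. (1 - prob (A \<gamma>)) ^ n) = F x0"
    unfolding F_def \<Gamma>'_def using x0 \<open>finite \<Gamma>\<close>
    by (intro sum.mono_neutral_cong_left) (auto simp: indicator_def)
  then obtain x where x: "\<forall>j<n. x j \<in> space M" "\<forall>\<gamma>\<in>\<Gamma>'. \<exists>j<n. x j \<in> A \<gamma>"
    using Suc.IH[of \<Gamma>'] Suc.prems(1,2) x0(2) unfolding \<Gamma>'_def by auto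
  define x' where "x' j = (case j of 0 \<Rightarrow> x0 | Suc j \<Rightarrow> x j)" for j
  have "\<exists>j<Suc n. x' j \<in> A \<gamma>" if \<gamma>: "\<gamma> \<in> \<Gamma>" for \<gamma>
  proof (cases "x0 \<in> A \<gamma>")
    case True
    then show ?thesis by (intro exI[of _ 0]) (auto simp: x'_def)
  next
    case False
    then obtain j where "j < n" "x j \<in> A \<gamma>"
      using x(2) \<gamma> False by (auto simp: \<Gamma>'_def)
    then show ?thesis by (intro exI[of _ "Suc j"]) (auto simp: x'_def)
  qed
  then show ?case
    using x(1) x0(1) by (intro exI[of _ x']) (auto simp: x'_def split: nat.splits)
qed

section \<open>Averages that approximate a convex combination\<close>

lemma exp_le_quadratic:
  fixes x :: real
  assumes "\<bar>x\<bar> \<le> 1"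
  shows "exp x \<le> 1 + x + x\<^sup>2"
proof (cases "x \<ge> 0")
  case True
  then show ?thesis using exp_bound[of x] assms by simp
next
  case False
  define y where "y = - x"
  have y: "0 \<le> y" using False by (simp add: y_def)
  have "1 + y + y\<^sup>2 / 2 \<le> exp y"
    by (rule exp_lower_Taylor_quadratic[OF y])
  moreover have "0 \<le> 1 - y + y\<^sup>2"
    using assms by (simp add: y_def)
  ultimately have "(1 - y + y\<^sup>2) * (1 + y + y\<^sup>2 / 2) \<le> (1 - y + y\<^sup>2) * exp y"
    by (intro mult_left_mono)
  moreover have "1 \<le> (1 - y + y\<^sup>2) * (1 + y + y\<^sup>2 / 2)"
  proof -
    have "(1 - y + y\<^sup>2) * (1 + y + y\<^sup>2 / 2) = 1 + y\<^sup>2 / 2 + y ^ 3 / 2 + y ^ 4 / 2"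
      by (simp add: field_simps power2_eq_square power3_eq_cube power4_eq_xxxx)
    then show ?thesis using y by simp
  qed
  ultimately have "1 \<le> (1 - y + y\<^sup>2) * exp y" by linarith
  then have "exp (- y) \<le> 1 - y + y\<^sup>2"
    by (simp add: exp_minus field_simps)
  then show ?thesis by (simp add: y_def)
qed

text \<open>
  Hoeffding's bound on the exponential moment of a centred random variable with finitely many
  values.
\<close>

lemma convex_exp_moment:
  fixes w v :: "'k \<Rightarrow> real"
  assumes K: "\<And>k. k \<in> K \<Longrightarrow> 0 \<le> w k" "sum w K = 1"
    and v: "\<And>k. k \<in> K \<Longrightarrow> \<bar>v k\<bar> \<le> 2" "(\<Sum>k\<in>K. w k * v k) = 0" and s: "\<bar>s\<bar> \<le> 1 / 2"
  shows "(\<Sum>k\<in>K. w k * exp (s * v k)) \<le> 1 + 4 * s\<^sup>2"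
proof -
  have "(\<Sum>k\<in>K. w k * exp (s * v k)) \<le> (\<Sum>k\<in>K. w k * (1 + s * v k + 4 * s\<^sup>2))"
  proof (intro sum_mono mult_left_mono)
    fix k assume k: "k \<in> K"
    have "\<bar>s * v k\<bar> \<le> 1/2 * 2"
      unfolding abs_mult using v(1)[OF k] s by (intro mult_mono) auto
    then have "exp (s * v k) \<le> 1 + s * v k + (s * v k)\<^sup>2"
      by (intro exp_le_quadratic) simp
    also have "(s * v k)\<^sup>2 \<le> s\<^sup>2 * 2\<^sup>2"
      unfolding power_mult_distrib using v(1)[OF k]
      by (intro mult_left_mono) (use abs_le_square_iff[of "v k" 2] in auto)
    finally show "exp (s * v k) \<le> 1 + s * v k + 4 * s\<^sup>2" by simp
  qed (use K in auto)
  also have "\<dots> = (\<Sum>k\<in>K. (1 + 4 * s\<^sup>2) * w k + s * (w k * v k))"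
    by (intro sum.cong) (auto simp: algebra_simps)
  also have "\<dots> = (1 + 4 * s\<^sup>2) * (\<Sum>k\<in>K. w k) + s * (\<Sum>k\<in>K. w k * v k)"
    by (simp add: sum.distrib sum_distrib_left)
  finally show ?thesis using K v by simp
qed

lemma exists_le_convex_combination:
  fixes w F :: "'k \<Rightarrow> real"
  assumes "finite K" "\<And>k. k \<in> K \<Longrightarrow> 0 \<le> w k" "sum w K = 1" "(\<Sum>k\<in>K. w k * F k) \<le> B"
  shows "\<exists>k\<in>K. F k \<le> B"
proof (rule ccontr)
  assume "\<not> ?thesis"
  then have gt: "B < F k" if "k \<in> K" for k using that by auto
  obtain k0 where k0: "k0 \<in> K" "w k0 \<noteq> 0"
    using assms(3) by (metis sum.neutral zero_neq_one)
  have "(\<Sum>k\<in>K. w k * B) < (\<Sum>k\<in>K. w k * F k)"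
  proof (rule sum_strict_mono_ex1)
    show "\<forall>k\<in>K. w k * B \<le> w k * F k"
      using assms(2) gt by (simp add: mult_left_mono less_imp_le)
    show "\<exists>k\<in>K. w k * B < w k * F k"
      using k0 assms(2)[OF k0(1)] gt[OF k0(1)] by (intro bexI[of _ k0]) auto
  qed fact
  moreover have "(\<Sum>k\<in>K. w k * B) = B"
    using assms(3) by (simp add: sum_distrib_right[symmetric])
  ultimately show False using assms(4) by linarith
qed

lemma abs_convex_combination_le:
  fixes w y :: "'k \<Rightarrow> real"
  assumes "\<And>k. k \<in> K \<Longrightarrow> 0 \<le> w k" "sum w K = 1" "\<And>k. k \<in> K \<Longrightarrow> \<bar>y k\<bar> \<le> 1"
  shows "\<bar>\<Sum>k\<in>K. w k * y k\<bar> \<le> 1"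
proof -
  have "\<bar>\<Sum>k\<in>K. w k * y k\<bar> \<le> (\<Sum>k\<in>K. w k * \<bar>y k\<bar>)"
    using assms(1) by (intro order_trans[OF sum_abs] sum_mono) (auto simp: abs_mult)
  also have "\<dots> \<le> (\<Sum>k\<in>K. w k * 1)"
    using assms(1,3) by (intro sum_mono mult_left_mono) auto
  finally show ?thesis using assms(2) by simp
qed

context prob_space
begin

text \<open>
  The empirical method has to control the deviation \<open>S\<close> simultaneously under the probability measure
  and at each of the points \<open>x\<^sub>0, \<dots>, x\<^bsub>n-1\<^esub>\<close>; a sum of two-sided exponential moments serves for all of these.
\<close>

definition exp_potential :: "nat \<Rightarrow> (nat \<Rightarrow> 'a) \<Rightarrow> real \<Rightarrow> ('a \<Rightarrow> real) \<Rightarrow> real" where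
  "exp_potential n x s S =
     expectation (\<lambda>t. exp (s * S t) + exp (- (s * S t))) +
     (\<Sum>j<n. exp (s * S (x j)) + exp (- (s * S (x j))))"

lemma integrable_exp_bounded:
  fixes S :: "'a \<Rightarrow> real" and b s :: real
  assumes "S \<in> borel_measurable M" "\<And>t. t \<in> space M \<Longrightarrow> \<bar>S t\<bar> \<le> b"
  shows "integrable M (\<lambda>t. exp (s * S t))"
proof (rule integrable_const_bound[where B = "exp (\<bar>s\<bar> * b)"])
  have "s * S t \<le> \<bar>s\<bar> * b" if "t \<in> space M" for t
  proof -
    have "s * S t \<le> \<bar>s\<bar> * \<bar>S t\<bar>" by (metis abs_mult abs_ge_self)
    also have "\<dots> \<le> \<bar>s\<bar> * b" using assms(2)[OF that] by (intro mult_left_mono) auto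
    finally show ?thesis .
  qed
  then show "AE t in M. norm (exp (s * S t)) \<le> exp (\<bar>s\<bar> * b)" by auto
qed (use assms in measurable)

text \<open>
  Averaged over \<open>k\<close> with the weights \<open>w\<close>, the potential grows at most by the factor \<open>1 + 4s\<^sup>2\<close>, because
  the increments have mean zero at every point.
\<close>

lemma exp_potential_step:
  fixes \<zeta> :: "'k \<Rightarrow> 'a \<Rightarrow> real"
  assumes K: "finite K" "\<And>k. k \<in> K \<Longrightarrow> 0 \<le> w k" "sum w K = 1"
    and \<zeta>: "\<And>k. k \<in> K \<Longrightarrow> \<zeta> k \<in> borel_measurable M"
      "\<And>k t. k \<in> K \<Longrightarrow> t \<in> space M \<Longrightarrow> \<bar>\<zeta> k t\<bar> \<le> 1"
    and x: "\<And>j. j < n \<Longrightarrow> x j \<in> space M" and s: "\<bar>s\<bar> \<le> 1 / 2"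
    and S: "S \<in> borel_measurable M" "\<And>t. t \<in> space M \<Longrightarrow> \<bar>S t\<bar> \<le> b"
  shows "\<exists>k\<in>K. exp_potential n x s (\<lambda>t. S t + (\<zeta> k t - (\<Sum>l\<in>K. w l * \<zeta> l t)))
           \<le> (1 + 4 * s\<^sup>2) * exp_potential n x s S"
proof (rule exists_le_convex_combination[OF K])
  define v where "v k t = \<zeta> k t - (\<Sum>l\<in>K. w l * \<zeta> l t)" for k t
  have v_meas: "v k \<in> borel_measurable M" if "k \<in> K" for k
    unfolding v_def using \<zeta>(1) that by measurable
  have g: "\<bar>\<Sum>l\<in>K. w l * \<zeta> l t\<bar> \<le> 1" if "t \<in> space M" for t
    using K(2,3) \<zeta>(2) that by (intro abs_convex_combination_le) auto
  have v_bound: "\<bar>v k t\<bar> \<le> 2" if "k \<in> K" "t \<in> space M" for k t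
    using \<zeta>(2)[OF that] g[OF that(2)] unfolding v_def by linarith
  have v_mean: "(\<Sum>k\<in>K. w k * v k t) = 0" for t
    unfolding v_def using K(3)
    by (simp add: algebra_simps sum_subtractf sum_distrib_right[symmetric] sum_distrib_left[symmetric])
  define \<Psi> where "\<Psi> r = exp (s * r) + exp (- (s * r))" for r :: real
  have pointwise: "(\<Sum>k\<in>K. w k * \<Psi> (S t + v k t)) \<le> (1 + 4 * s\<^sup>2) * \<Psi> (S t)" if t: "t \<in> space M" for t
  proof -
    have "(\<Sum>k\<in>K. w k * \<Psi> (S t + v k t)) =
      exp (s * S t) * (\<Sum>k\<in>K. w k * exp (s * v k t)) +
      exp (- (s * S t)) * (\<Sum>k\<in>K. w k * exp ((- s) * v k t))"
      unfolding \<Psi>_def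
      by (simp add: sum_distrib_left sum.distrib[symmetric] exp_add[symmetric] algebra_simps
               flip: exp_add)
    also have "\<dots> \<le> exp (s * S t) * (1 + 4 * s\<^sup>2) + exp (- (s * S t)) * (1 + 4 * (- s)\<^sup>2)"
      using K v_bound[OF _ t] v_mean[of t] s
      by (intro add_mono mult_left_mono convex_exp_moment) auto
    finally show ?thesis unfolding \<Psi>_def by (simp add: algebra_simps)
  qed
  have int: "integrable M (\<lambda>t. \<Psi> (T t))"
    if "T \<in> borel_measurable M" "\<And>t. t \<in> space M \<Longrightarrow> \<bar>T t\<bar> \<le> c" for T c
    unfolding \<Psi>_def
    using integrable_exp_bounded[OF that, of s] integrable_exp_bounded[OF that, of "- s"] by simp
  have int_v: "integrable M (\<lambda>t. \<Psi> (S t + v k t))" if "k \<in> K" for k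
  proof (rule int)
    show "\<bar>S t + v k t\<bar> \<le> b + 2" if "t \<in> space M" for t
      using S(2)[OF that] v_bound[OF \<open>k \<in> K\<close> that] by linarith
  qed (use S(1) v_meas[OF that] in measurable)
  have int_S: "integrable M (\<lambda>t. \<Psi> (S t))"
    by (rule int[OF S])
  have pot: "exp_potential n x s T = expectation (\<lambda>t. \<Psi> (T t)) + (\<Sum>j<n. \<Psi> (T (x j)))" for T
    by (simp add: exp_potential_def \<Psi>_def)
  have "(\<Sum>k\<in>K. w k * exp_potential n x s (\<lambda>t. S t + v k t)) =
    expectation (\<lambda>t. \<Sum>k\<in>K. w k * \<Psi> (S t + v k t)) +
    (\<Sum>j<n. \<Sum>k\<in>K. w k * \<Psi> (S (x j) + v k (x j)))"
    unfolding pot using int_v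
    by (subst sum.swap)
       (simp add: distrib_left sum.distrib sum_distrib_left Bochner_Integration.integral_sum)
  also have "\<dots> \<le> expectation (\<lambda>t. (1 + 4 * s\<^sup>2) * \<Psi> (S t)) + (\<Sum>j<n. (1 + 4 * s\<^sup>2) * \<Psi> (S (x j)))"
    using int_v int_S pointwise x by (intro add_mono sum_mono integral_mono) auto
  also have "\<dots> = (1 + 4 * s\<^sup>2) * exp_potential n x s S"
    unfolding pot using int_S by (simp add: sum_distrib_left distrib_left)
  finally show "(\<Sum>k\<in>K. w k * exp_potential n x s (\<lambda>t. S t + (\<zeta> k t - (\<Sum>l\<in>K. w l * \<zeta> l t))))
    \<le> (1 + 4 * s\<^sup>2) * exp_potential n x s S"
    unfolding v_def .
qed

lemma exists_small_exp_potential: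
  fixes \<zeta> :: "'k \<Rightarrow> 'a \<Rightarrow> real"
  assumes K: "finite K" "\<And>k. k \<in> K \<Longrightarrow> 0 \<le> w k" "sum w K = 1"
    and \<zeta>: "\<And>k. k \<in> K \<Longrightarrow> \<zeta> k \<in> borel_measurable M"
      "\<And>k t. k \<in> K \<Longrightarrow> t \<in> space M \<Longrightarrow> \<bar>\<zeta> k t\<bar> \<le> 1"
    and x: "\<And>j. j < n \<Longrightarrow> x j \<in> space M" and s: "\<bar>s\<bar> \<le> 1 / 2"
  shows "\<exists>z\<in>{..<m} \<rightarrow>\<^sub>E K.
    exp_potential n x s (\<lambda>t. (\<Sum>l<m. \<zeta> (z l) t) - real m * (\<Sum>k\<in>K. w k * \<zeta> k t))
      \<le> (1 + 4 * s\<^sup>2) ^ m * (2 * (real n + 1))"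
proof (induction m)
  case 0
  show ?case by (auto simp: exp_potential_def prob_space)
next
  case (Suc m)
  define g where "g t = (\<Sum>k\<in>K. w k * \<zeta> k t)" for t
  obtain z where z: "z \<in> {..<m} \<rightarrow>\<^sub>E K"
    "exp_potential n x s (\<lambda>t. (\<Sum>l<m. \<zeta> (z l) t) - real m * g t)
      \<le> (1 + 4 * s\<^sup>2) ^ m * (2 * (real n + 1))"
    using Suc.IH unfolding g_def by blast
  have zK: "z l \<in> K" if "l < m" for l using z(1) that by auto
  have "\<bar>g t\<bar> \<le> 1" if "t \<in> space M" for t
    unfolding g_def using K(2,3) \<zeta>(2) that by (intro abs_convex_combination_le) auto
  then have bound: "\<bar>(\<Sum>l<m. \<zeta> (z l) t) - real m * g t\<bar> \<le> real m + real m" if "t \<in> space M" for t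
  proof -
    have "\<bar>\<Sum>l<m. \<zeta> (z l) t\<bar> \<le> (\<Sum>l<m. 1)"
      using \<zeta>(2)[OF zK that] by (intro order_trans[OF sum_abs] sum_mono) auto
    moreover have "\<bar>real m * g t\<bar> \<le> real m * 1"
      unfolding abs_mult using \<open>t \<in> space M \<Longrightarrow> \<bar>g t\<bar> \<le> 1\<close>[OF that] by (intro mult_mono) auto
    ultimately show ?thesis by simp
  qed
  have meas: "(\<lambda>t. (\<Sum>l<m. \<zeta> (z l) t) - real m * g t) \<in> borel_measurable M"
    unfolding g_def using \<zeta>(1) zK by measurable
  have "\<exists>k\<in>K. exp_potential n x s (\<lambda>t. ((\<Sum>l<m. \<zeta> (z l) t) - real m * g t) + (\<zeta> k t - g t))
      \<le> (1 + 4 * s\<^sup>2) * exp_potential n x s (\<lambda>t. (\<Sum>l<m. \<zeta> (z l) t) - real m * g t)"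
    unfolding g_def by (rule exp_potential_step[OF K \<zeta> x s meas[unfolded g_def] bound[unfolded g_def]])
  then obtain k where k: "k \<in> K"
    "exp_potential n x s (\<lambda>t. ((\<Sum>l<m. \<zeta> (z l) t) - real m * g t) + (\<zeta> k t - g t))
      \<le> (1 + 4 * s\<^sup>2) * exp_potential n x s (\<lambda>t. (\<Sum>l<m. \<zeta> (z l) t) - real m * g t)"
    by blast
  define z' where "z' = z(m := k)"
  have z': "z' \<in> {..<Suc m} \<rightarrow>\<^sub>E K"
    unfolding z'_def lessThan_Suc using z(1) k(1) by (rule PiE_fun_upd[rotated])
  have "(\<Sum>l<Suc m. \<zeta> (z' l) t) - real (Suc m) * g t
      = ((\<Sum>l<m. \<zeta> (z l) t) - real m * g t) + (\<zeta> k t - g t)" for t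
    by (simp add: z'_def algebra_simps)
  then have "exp_potential n x s (\<lambda>t. (\<Sum>l<Suc m. \<zeta> (z' l) t) - real (Suc m) * g t)
     \<le> (1 + 4 * s\<^sup>2) * exp_potential n x s (\<lambda>t. (\<Sum>l<m. \<zeta> (z l) t) - real m * g t)"
    using k(2) by simp
  also have "\<dots> \<le> (1 + 4 * s\<^sup>2) * ((1 + 4 * s\<^sup>2) ^ m * (2 * (real n + 1)))"
    using z(2) by (intro mult_left_mono) auto
  finally show ?case
    using z' unfolding g_def by (intro bexI[of _ z']) (auto simp: mult.assoc)
qed

text \<open>
  Maurey's empirical method in the uniform norm on finitely many points.  By Markov's inequality
  the potential of \<open>exists_small_exp_potential\<close> bounds the part of the space, and excludes every point
  \<open>x\<^sub>j\<close>, where the deviation reaches \<open>\<tau>\<close>.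
\<close>

lemma exists_average_close:
  fixes \<zeta> :: "'k \<Rightarrow> 'a \<Rightarrow> real"
  assumes K: "finite K" "\<And>k. k \<in> K \<Longrightarrow> 0 \<le> w k" "sum w K = 1"
    and \<zeta>: "\<And>k. k \<in> K \<Longrightarrow> \<zeta> k \<in> borel_measurable M"
      "\<And>k t. k \<in> K \<Longrightarrow> t \<in> space M \<Longrightarrow> \<bar>\<zeta> k t\<bar> \<le> 1"
    and x: "\<And>j. j < n \<Longrightarrow> x j \<in> space M" and n: "1 \<le> n"
    and \<tau>: "0 < \<tau>" "\<tau> \<le> 1"
    and m: "16 / \<tau>\<^sup>2 * ln (8 * real n * (real n + 1)) \<le> real m"
  shows "\<exists>z\<in>{..<m} \<rightarrow>\<^sub>E K.
    (\<forall>j<n. \<bar>(\<Sum>l<m. \<zeta> (z l) (x j)) / real m - (\<Sum>k\<in>K. w k * \<zeta> k (x j))\<bar> < \<tau>) \<and>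
    prob {t\<in>space M. \<tau> \<le> \<bar>(\<Sum>l<m. \<zeta> (z l) t) / real m - (\<Sum>k\<in>K. w k * \<zeta> k t)\<bar>}
      \<le> 1 / (4 * real n)"
proof -
  define s where "s = \<tau> / 8"
  define g where "g t = (\<Sum>k\<in>K. w k * \<zeta> k t)" for t
  have s: "\<bar>s\<bar> \<le> 1 / 2" "0 < s" using \<tau> by (auto simp: s_def)
  have "\<exists>z\<in>{..<m} \<rightarrow>\<^sub>E K. exp_potential n x s (\<lambda>t. (\<Sum>l<m. \<zeta> (z l) t) - real m * g t)
      \<le> (1 + 4 * s\<^sup>2) ^ m * (2 * (real n + 1))"
    unfolding g_def by (rule exists_small_exp_potential[OF K \<zeta> x s(1)])
  then obtain z where z: "z \<in> {..<m} \<rightarrow>\<^sub>E K"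
    "exp_potential n x s (\<lambda>t. (\<Sum>l<m. \<zeta> (z l) t) - real m * g t)
      \<le> (1 + 4 * s\<^sup>2) ^ m * (2 * (real n + 1))"
    by blast
  define S where "S t = (\<Sum>l<m. \<zeta> (z l) t) - real m * g t" for t
  have zK: "z l \<in> K" if "l < m" for l using z(1) that by auto
  have meas [measurable]: "S \<in> borel_measurable M"
    unfolding S_def g_def using \<zeta>(1) zK by measurable
  have n8: "8 * real n * (real n + 1) \<ge> 16"
  proof -
    have "8 * real n * (real n + 1) \<ge> 8 * 1 * (1 + 1)"
      using n by (intro mult_mono) auto
    then show ?thesis by simp
  qed
  have ln_pos: "0 < ln (8 * real n * (real n + 1))" using n8 by (intro ln_gt_zero) linarith
  have m0: "0 < real m"
  proof -
    have "0 < 16 / \<tau>\<^sup>2 * ln (8 * real n * (real n + 1))"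
      using ln_pos \<tau> by simp
    then show ?thesis using m by linarith
  qed
  \<comment> \<open>The choice \<open>s = \<tau> / 8\<close> minimises the exponent \<open>4 s\<^sup>2 m - s \<tau> m\<close>; its value is \<open>- m \<tau>\<^sup>2 / 16\<close>.\<close>
  have pot: "exp_potential n x s S \<le> exp (s * (real m * \<tau>)) / (4 * real n)"
  proof -
    have "ln (8 * real n * (real n + 1)) \<le> real m * \<tau>\<^sup>2 / 16"
      using m \<tau> by (simp add: field_simps)
    then have "8 * real n * (real n + 1) \<le> exp (real m * \<tau>\<^sup>2 / 16)"
      using n8 by (subst ln_le_cancel_iff[symmetric]) auto
    then have "2 * (real n + 1) \<le> exp (real m * \<tau>\<^sup>2 / 16) / (4 * real n)"
      using n by (simp add: field_simps)
    moreover have "(1 + 4 * s\<^sup>2) ^ m \<le> exp (4 * s\<^sup>2) ^ m"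
      by (intro power_mono) auto
    ultimately have "(1 + 4 * s\<^sup>2) ^ m * (2 * (real n + 1))
      \<le> exp (4 * s\<^sup>2) ^ m * (exp (real m * \<tau>\<^sup>2 / 16) / (4 * real n))"
      by (intro mult_mono) auto
    also have "\<dots> = exp (s * (real m * \<tau>)) / (4 * real n)"
      by (simp add: s_def exp_of_nat_mult[symmetric] exp_add[symmetric] field_simps power2_eq_square)
    finally show ?thesis using z(2) unfolding S_def by linarith
  qed
  have exp_abs: "exp (s * \<bar>r\<bar>) \<le> exp (s * r) + exp (- (s * r))" for r
    by (cases "r \<ge> 0") auto
  have gbound: "\<bar>g t\<bar> \<le> 1" if "t \<in> space M" for t
    unfolding g_def using K(2,3) \<zeta>(2) that by (intro abs_convex_combination_le) auto
  have bound: "\<bar>S t\<bar> \<le> real m + real m" if "t \<in> space M" for t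
  proof -
    have "\<bar>\<Sum>l<m. \<zeta> (z l) t\<bar> \<le> (\<Sum>l<m. 1)"
      using \<zeta>(2)[OF zK that] by (intro order_trans[OF sum_abs] sum_mono) auto
    moreover have "\<bar>real m * g t\<bar> \<le> real m * 1"
      unfolding abs_mult using gbound[OF that] by (intro mult_mono) auto
    ultimately show ?thesis unfolding S_def by simp
  qed
  have int: "integrable M (\<lambda>t. exp (s * S t) + exp (- (s * S t)))"
    using integrable_exp_bounded[OF meas bound, of s] integrable_exp_bounded[OF meas bound, of "- s"]
    by simp
  have close_pt: "\<bar>S (x j)\<bar> < real m * \<tau>" if j: "j < n" for j
  proof (rule ccontr)
    assume "\<not> ?thesis"
    then have "exp (s * (real m * \<tau>)) \<le> exp (s * \<bar>S (x j)\<bar>)"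
      using s by simp
    also have "\<dots> \<le> exp (s * S (x j)) + exp (- (s * S (x j)))"
      by (rule exp_abs)
    also have "\<dots> \<le> (\<Sum>j<n. exp (s * S (x j)) + exp (- (s * S (x j))))"
      using j by (intro member_le_sum) auto
    also have "\<dots> \<le> exp_potential n x s S"
      unfolding exp_potential_def by (simp add: Bochner_Integration.integral_nonneg)
    also note pot
    also have "exp (s * (real m * \<tau>)) / (4 * real n) < exp (s * (real m * \<tau>))"
      using n by (simp add: field_simps)
    finally show False by simp
  qed
  have close_meas: "prob {t\<in>space M. real m * \<tau> \<le> \<bar>S t\<bar>} \<le> 1 / (4 * real n)"
  proof -
    have "prob {t\<in>space M. real m * \<tau> \<le> \<bar>S t\<bar>}
      \<le> prob {t\<in>space M. exp (s * (real m * \<tau>)) \<le> exp (s * S t) + exp (- (s * S t))}"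
    proof (intro finite_measure_mono subsetI)
      fix t assume t: "t \<in> {t\<in>space M. real m * \<tau> \<le> \<bar>S t\<bar>}"
      then have "exp (s * (real m * \<tau>)) \<le> exp (s * \<bar>S t\<bar>)" using s by simp
      also note exp_abs
      finally show "t \<in> {t\<in>space M. exp (s * (real m * \<tau>)) \<le> exp (s * S t) + exp (- (s * S t))}"
        using t by auto
    qed measurable
    also have "\<dots> \<le> expectation (\<lambda>t. exp (s * S t) + exp (- (s * S t))) / exp (s * (real m * \<tau>))"
      by (rule integral_Markov_inequality_measure[OF int, where A = "{}"]) auto
    also have "\<dots> \<le> exp_potential n x s S / exp (s * (real m * \<tau>))"
      unfolding exp_potential_def by (intro divide_right_mono) (auto intro!: sum_nonneg)
    also have "\<dots> \<le> 1 / (4 * real n)"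
      using pot by (simp add: pos_divide_le_eq)
    finally show ?thesis .
  qed
  have S_avg: "\<bar>(\<Sum>l<m. \<zeta> (z l) t) / real m - g t\<bar> = \<bar>S t\<bar> / real m" for t
  proof -
    have "(\<Sum>l<m. \<zeta> (z l) t) / real m - g t = S t / real m"
      unfolding S_def using m0 by (simp add: diff_divide_distrib)
    then show ?thesis by simp
  qed
  have lt_iff: "\<bar>r\<bar> / real m < \<tau> \<longleftrightarrow> \<bar>r\<bar> < real m * \<tau>"
    and le_iff: "\<tau> \<le> \<bar>r\<bar> / real m \<longleftrightarrow> real m * \<tau> \<le> \<bar>r\<bar>" for r
    using m0 by (simp_all add: pos_divide_less_eq pos_le_divide_eq mult.commute)
  show ?thesis
    unfolding g_def[symmetric]
  proof (rule bexI[OF _ z(1)], intro conjI allI impI)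
    show "\<bar>(\<Sum>l<m. \<zeta> (z l) (x j)) / real m - g (x j)\<bar> < \<tau>" if "j < n" for j
      unfolding S_avg lt_iff using that by (rule close_pt)
    show "prob {t\<in>space M. \<tau> \<le> \<bar>(\<Sum>l<m. \<zeta> (z l) t) / real m - g t\<bar>} \<le> 1 / (4 * real n)"
      unfolding S_avg le_iff by (rule close_meas)
  qed
qed

end

section \<open>Points that control all convex combinations\<close>

context prob_space
begin

text \<open>
  The points hit every level set \<open>{|avg| \<ge> 3t/4}\<close> of measure at least \<open>r/2\<close> among the finitely many
  averages.  If a convex combination \<open>g\<close> had \<open>|g| \<ge> t\<close> on a set of measure greater than \<open>r\<close>, then the
  level set of an average close to \<open>g\<close> would be hit, and \<open>|g| > t/2\<close> at the point that hits it.
  Infinitely many functions are thus controlled by a union bound over finitely many.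
\<close>

lemma exists_points_controlling_convex_combinations:
  fixes \<zeta> :: "'k \<Rightarrow> 'a \<Rightarrow> real" and t r :: "'i \<Rightarrow> real" and m :: "'i \<Rightarrow> nat"
  assumes K: "finite K"
    and \<zeta>: "\<And>k. k \<in> K \<Longrightarrow> \<zeta> k \<in> borel_measurable M"
      "\<And>k u. k \<in> K \<Longrightarrow> u \<in> space M \<Longrightarrow> \<bar>\<zeta> k u\<bar> \<le> 1"
    and n: "1 \<le> n" and \<Lambda>: "finite \<Lambda>"
    and t: "\<And>i. i \<in> \<Lambda> \<Longrightarrow> 0 < t i" "\<And>i. i \<in> \<Lambda> \<Longrightarrow> t i \<le> 1"
    and m: "\<And>i. i \<in> \<Lambda> \<Longrightarrow> 256 / (t i)\<^sup>2 * ln (8 * real n * (real n + 1)) \<le> real (m i)"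
    and r: "\<And>i. i \<in> \<Lambda> \<Longrightarrow> 1 / 2 \<le> real n * r i"
    and small: "(\<Sum>i\<in>\<Lambda>. real (card K) ^ m i * exp (- (real n * r i / 2))) < 1"
  shows "\<exists>x. (\<forall>j<n. x j \<in> space M) \<and>
    (\<forall>i\<in>\<Lambda>. \<forall>w. (\<forall>k\<in>K. 0 \<le> w k) \<longrightarrow> sum w K = 1 \<longrightarrow>
       (\<forall>j<n. \<bar>\<Sum>k\<in>K. w k * \<zeta> k (x j)\<bar> \<le> t i / 2) \<longrightarrow>
       prob {u\<in>space M. t i \<le> \<bar>\<Sum>k\<in>K. w k * \<zeta> k u\<bar>} \<le> r i)"
proof -
  define avg where "avg i z u = (\<Sum>l<m i. \<zeta> (z l) u) / real (m i)" for i and z :: "nat \<Rightarrow> 'k" and u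
  define A where "A = (\<lambda>(i, z). {u\<in>space M. 3 / 4 * t i \<le> \<bar>avg i z u\<bar>})"
  define Z where "Z i = {z \<in> {..<m i} \<rightarrow>\<^sub>E K. r i / 2 \<le> prob (A (i, z))}" for i
  have finZ: "finite (Z i)" for i
  proof (rule finite_subset)
    show "finite ({..<m i} \<rightarrow>\<^sub>E K)" using K by (intro finite_PiE) auto
  qed (auto simp: Z_def)
  have card_Z: "real (card (Z i)) \<le> real (card K) ^ m i" for i
  proof -
    have "card (Z i) \<le> card ({..<m i} \<rightarrow>\<^sub>E K)"
      unfolding Z_def using K by (intro card_mono finite_PiE) auto
    also have "\<dots> = card K ^ m i"
      by (simp add: card_PiE)
    finally show ?thesis by (metis of_nat_le_iff of_nat_power)
  qed
  have avg_meas: "avg i z \<in> borel_measurable M" if "z \<in> {..<m i} \<rightarrow>\<^sub>E K" for i z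
  proof -
    have "\<zeta> (z l) \<in> borel_measurable M" if "l < m i" for l
      using \<open>z \<in> _\<close> that by (intro \<zeta>) auto
    then show ?thesis unfolding avg_def by measurable
  qed
  have A_ev: "A (i, z) \<in> events" if "z \<in> {..<m i} \<rightarrow>\<^sub>E K" for i z
    unfolding A_def using avg_meas[OF that] by simp
  have "(\<Sum>\<gamma>\<in>Sigma \<Lambda> Z. (1 - prob (A \<gamma>)) ^ n) = (\<Sum>i\<in>\<Lambda>. \<Sum>z\<in>Z i. (1 - prob (A (i, z))) ^ n)"
    using \<Lambda> finZ by (subst sum.Sigma) auto
  also have "\<dots> \<le> (\<Sum>i\<in>\<Lambda>. \<Sum>z\<in>Z i. exp (- (real n * r i / 2)))"
  proof (intro sum_mono)
    fix i z assume z: "z \<in> Z i"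
    have "1 - prob (A (i, z)) \<le> 1 + (- (r i / 2))"
      using z unfolding Z_def by auto
    also have "\<dots> \<le> exp (- (r i / 2))" by (rule exp_ge_add_one_self)
    finally have "(1 - prob (A (i, z))) ^ n \<le> exp (- (r i / 2)) ^ n"
      using prob_le_1 by (intro power_mono) auto
    also have "\<dots> = exp (- (real n * r i / 2))"
      by (simp add: exp_of_nat_mult[symmetric])
    finally show "(1 - prob (A (i, z))) ^ n \<le> exp (- (real n * r i / 2))" .
  qed
  also have "\<dots> \<le> (\<Sum>i\<in>\<Lambda>. real (card K) ^ m i * exp (- (real n * r i / 2)))"
    using card_Z by (intro sum_mono) (auto intro!: mult_right_mono)
  also note small
  finally have "\<exists>x. (\<forall>j<n. x j \<in> space M) \<and> (\<forall>\<gamma>\<in>Sigma \<Lambda> Z. \<exists>j<n. x j \<in> A \<gamma>)"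
    using \<Lambda> finZ A_ev by (intro exists_hitting_points) (auto simp: Z_def)
  then obtain x where "(\<forall>j<n. x j \<in> space M) \<and> (\<forall>\<gamma>\<in>Sigma \<Lambda> Z. \<exists>j<n. x j \<in> A \<gamma>)" ..
  then have x: "\<And>j. j < n \<Longrightarrow> x j \<in> space M"
    and hit: "\<And>i z. i \<in> \<Lambda> \<Longrightarrow> z \<in> Z i \<Longrightarrow> \<exists>j<n. x j \<in> A (i, z)"
    by auto
  have "prob {u\<in>space M. t i \<le> \<bar>\<Sum>k\<in>K. w k * \<zeta> k u\<bar>} \<le> r i"
    if i: "i \<in> \<Lambda>" and w: "\<forall>k\<in>K. 0 \<le> w k" "sum w K = 1"
      and small_at: "\<forall>j<n. \<bar>\<Sum>k\<in>K. w k * \<zeta> k (x j)\<bar> \<le> t i / 2" for i w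
  proof (rule ccontr)
    assume large: "\<not> ?thesis"
    define g where "g u = (\<Sum>k\<in>K. w k * \<zeta> k u)" for u
    have [measurable]: "g \<in> borel_measurable M"
      unfolding g_def using \<zeta> by measurable
    have "\<exists>z\<in>{..<m i} \<rightarrow>\<^sub>E K.
      (\<forall>j<n. \<bar>(\<Sum>l<m i. \<zeta> (z l) (x j)) / real (m i) - (\<Sum>k\<in>K. w k * \<zeta> k (x j))\<bar> < t i / 4) \<and>
      prob {u\<in>space M. t i / 4 \<le> \<bar>(\<Sum>l<m i. \<zeta> (z l) u) / real (m i) - (\<Sum>k\<in>K. w k * \<zeta> k u)\<bar>}
        \<le> 1 / (4 * real n)"
    proof (rule exists_average_close)
      show "16 / (t i / 4)\<^sup>2 * ln (8 * real n * (real n + 1)) \<le> real (m i)"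
        using m[OF i] by (simp add: power_divide)
    qed (use K w \<zeta> x n t[OF i] in auto)
    then obtain z where z: "z \<in> {..<m i} \<rightarrow>\<^sub>E K"
      and close: "\<And>j. j < n \<Longrightarrow> \<bar>avg i z (x j) - g (x j)\<bar> < t i / 4"
      and far: "prob {u\<in>space M. t i / 4 \<le> \<bar>avg i z u - g u\<bar>} \<le> 1 / (4 * real n)"
      unfolding avg_def g_def by auto
    note [measurable] = avg_meas[OF z]
    have "prob {u\<in>space M. t i \<le> \<bar>g u\<bar>}
      \<le> prob (A (i, z) \<union> {u\<in>space M. t i / 4 \<le> \<bar>avg i z u - g u\<bar>})"
    proof (intro finite_measure_mono subsetI)
      fix u assume "u \<in> {u\<in>space M. t i \<le> \<bar>g u\<bar>}"
      then have u: "u \<in> space M" "t i \<le> \<bar>g u\<bar>" by simp_all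
      then have "3 / 4 * t i \<le> \<bar>avg i z u\<bar> \<or> t i / 4 \<le> \<bar>avg i z u - g u\<bar>"
        by linarith
      with u(1) show "u \<in> A (i, z) \<union> {u\<in>space M. t i / 4 \<le> \<bar>avg i z u - g u\<bar>}"
        unfolding A_def by blast
    qed (use A_ev[OF z] in measurable)
    also have "\<dots> \<le> prob (A (i, z)) + prob {u\<in>space M. t i / 4 \<le> \<bar>avg i z u - g u\<bar>}"
      using A_ev[OF z] by (intro measure_Un_le) auto
    also have "\<dots> \<le> prob (A (i, z)) + 1 / (4 * real n)"
      using far by simp
    also have "1 / (4 * real n) \<le> r i / 2"
      using r[OF i] n by (simp add: field_simps)
    finally have "r i < prob (A (i, z)) + r i / 2"
      using large unfolding g_def by simp
    then have "z \<in> Z i"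
      using z unfolding Z_def by simp
    then obtain j where j: "j < n" "x j \<in> A (i, z)"
      using hit[OF i] by blast
    then have "3 / 4 * t i \<le> \<bar>avg i z (x j)\<bar>"
      by (simp add: A_def)
    moreover have "\<bar>g (x j)\<bar> \<le> t i / 2"
      using small_at j(1) unfolding g_def by simp
    ultimately show False
      using close[OF j(1)] by linarith
  qed
  with x show ?thesis
    by (intro exI[of _ x] conjI allI ballI impI) simp_all
qed

text \<open>
  An absolutely convex combination of the \<open>y k\<close> is a convex combination of the \<open>y k\<close>, their negatives
  and the zero function, which takes up the missing weight.
\<close>

lemma exists_points_controlling_absolutely_convex_combinations:
  fixes y :: "'k \<Rightarrow> 'a \<Rightarrow> real" and t r :: "'i \<Rightarrow> real" and m :: "'i \<Rightarrow> nat"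
  assumes I: "finite I"
    and y: "\<And>k. k \<in> I \<Longrightarrow> y k \<in> borel_measurable M"
      "\<And>k u. k \<in> I \<Longrightarrow> u \<in> space M \<Longrightarrow> \<bar>y k u\<bar> \<le> 1"
    and n: "1 \<le> n" and \<Lambda>: "finite \<Lambda>"
    and t: "\<And>i. i \<in> \<Lambda> \<Longrightarrow> 0 < t i" "\<And>i. i \<in> \<Lambda> \<Longrightarrow> t i \<le> 1"
    and m: "\<And>i. i \<in> \<Lambda> \<Longrightarrow> 256 / (t i)\<^sup>2 * ln (8 * real n * (real n + 1)) \<le> real (m i)"
    and r: "\<And>i. i \<in> \<Lambda> \<Longrightarrow> 1 / 2 \<le> real n * r i"
    and small: "(\<Sum>i\<in>\<Lambda>. (2 * real (card I) + 1) ^ m i * exp (- (real n * r i / 2))) < 1"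
  shows "\<exists>x. (\<forall>j<n. x j \<in> space M) \<and>
    (\<forall>i\<in>\<Lambda>. \<forall>a. (\<Sum>k\<in>I. \<bar>a k\<bar>) \<le> 1 \<longrightarrow>
       (\<forall>j<n. \<bar>\<Sum>k\<in>I. a k * y k (x j)\<bar> \<le> t i / 2) \<longrightarrow>
       prob {u\<in>space M. t i \<le> \<bar>\<Sum>k\<in>I. a k * y k u\<bar>} \<le> r i)"
proof -
  define K :: "('k \<times> bool) option set" where "K = insert None (Some ` (I \<times> UNIV))"
  define \<zeta> where "\<zeta> k u = (case k of None \<Rightarrow> 0 | Some (k, b) \<Rightarrow> if b then y k u else - y k u)" for k u
  have finK: "finite K" using I by (simp add: K_def)
  have sum_K: "(\<Sum>k\<in>K. F k) = F None + (\<Sum>k\<in>I. F (Some (k, True)) + F (Some (k, False)))"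
    for F :: "('k \<times> bool) option \<Rightarrow> real"
  proof -
    have "(\<Sum>p\<in>I \<times> UNIV. F (Some p)) = (\<Sum>k\<in>I. \<Sum>b\<in>UNIV. F (Some (k, b)))"
      by (simp add: sum.cartesian_product)
    then show ?thesis
      unfolding K_def using I by (simp add: sum.reindex UNIV_bool add.commute)
  qed
  have card_K: "real (card K) = 2 * real (card I) + 1"
    using sum_K[of "\<lambda>_. 1"] by simp
  have \<zeta>_meas: "\<zeta> k \<in> borel_measurable M" if "k \<in> K" for k
    using that y(1) unfolding \<zeta>_def[abs_def] K_def by auto
  have \<zeta>_bound: "\<bar>\<zeta> k u\<bar> \<le> 1" if "k \<in> K" "u \<in> space M" for k u
    using that y(2) unfolding \<zeta>_def K_def by auto
  have "\<exists>x. (\<forall>j<n. x j \<in> space M) \<and>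
    (\<forall>i\<in>\<Lambda>. \<forall>w. (\<forall>k\<in>K. 0 \<le> w k) \<longrightarrow> sum w K = 1 \<longrightarrow>
       (\<forall>j<n. \<bar>\<Sum>k\<in>K. w k * \<zeta> k (x j)\<bar> \<le> t i / 2) \<longrightarrow>
       prob {u\<in>space M. t i \<le> \<bar>\<Sum>k\<in>K. w k * \<zeta> k u\<bar>} \<le> r i)"
    using small unfolding card_K[symmetric]
    by (intro exists_points_controlling_convex_combinations[where m = m]
          finK \<zeta>_meas \<zeta>_bound n \<Lambda> t m r) auto
  then obtain x where "(\<forall>j<n. x j \<in> space M) \<and>
    (\<forall>i\<in>\<Lambda>. \<forall>w. (\<forall>k\<in>K. 0 \<le> w k) \<longrightarrow> sum w K = 1 \<longrightarrow>
       (\<forall>j<n. \<bar>\<Sum>k\<in>K. w k * \<zeta> k (x j)\<bar> \<le> t i / 2) \<longrightarrow>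
       prob {u\<in>space M. t i \<le> \<bar>\<Sum>k\<in>K. w k * \<zeta> k u\<bar>} \<le> r i)" ..
  then have x: "\<And>j. j < n \<Longrightarrow> x j \<in> space M"
    and conv: "\<And>i w. i \<in> \<Lambda> \<Longrightarrow> \<forall>k\<in>K. 0 \<le> w k \<Longrightarrow> sum w K = 1 \<Longrightarrow>
       \<forall>j<n. \<bar>\<Sum>k\<in>K. w k * \<zeta> k (x j)\<bar> \<le> t i / 2 \<Longrightarrow>
       prob {u\<in>space M. t i \<le> \<bar>\<Sum>k\<in>K. w k * \<zeta> k u\<bar>} \<le> r i"
    by simp_all
  have "prob {u\<in>space M. t i \<le> \<bar>\<Sum>k\<in>I. a k * y k u\<bar>} \<le> r i"
    if i: "i \<in> \<Lambda>" and a: "(\<Sum>k\<in>I. \<bar>a k\<bar>) \<le> 1"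
      and at: "\<forall>j<n. \<bar>\<Sum>k\<in>I. a k * y k (x j)\<bar> \<le> t i / 2" for i a
  proof -
    define w where "w k = (case k of None \<Rightarrow> 1 - (\<Sum>k\<in>I. \<bar>a k\<bar>)
      | Some (k, b) \<Rightarrow> if b then max (a k) 0 else max (- a k) 0)" for k
    have eq: "(\<Sum>k\<in>K. w k * \<zeta> k u) = (\<Sum>k\<in>I. a k * y k u)" for u
      unfolding sum_K by (auto simp: w_def \<zeta>_def max_def intro!: sum.cong)
    have "sum w K = 1 - (\<Sum>k\<in>I. \<bar>a k\<bar>) + (\<Sum>k\<in>I. \<bar>a k\<bar>)"
      unfolding sum_K by (auto simp: w_def intro!: sum.cong)
    then have "sum w K = 1" by simp
    moreover have "\<forall>k\<in>K. 0 \<le> w k" using a by (auto simp: w_def K_def)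
    ultimately show ?thesis
      using conv[OF i, of w] at unfolding eq by simp
  qed
  with x show ?thesis
    by (intro exI[of _ x] conjI allI ballI impI) simp_all
qed

end

section \<open>Functions that vanish at the points have a small \<open>L\<^sub>p\<close> norm\<close>

lemma dyadic_level_exists:
  fixes W :: real
  assumes "(1 / 2) ^ L \<le> W" "W \<le> 1" "1 \<le> L"
  shows "\<exists>i<L. (1 / 2) ^ Suc i \<le> W \<and> W \<le> (1 / 2) ^ i"
proof -
  define i where "i = (LEAST i. (1 / 2) ^ Suc i \<le> W)"
  have ex: "(1 / 2) ^ Suc (L - 1) \<le> W" using assms by simp
  have i1: "(1 / 2) ^ Suc i \<le> W" unfolding i_def by (rule LeastI, rule ex)
  have i2: "i \<le> L - 1" unfolding i_def by (rule Least_le, rule ex)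
  have i3: "W \<le> (1 / 2) ^ i"
  proof (cases i)
    case 0
    then show ?thesis using assms by simp
  next
    case (Suc i')
    then have "\<not> (1 / 2) ^ Suc i' \<le> W" unfolding i_def by (intro not_less_Least) simp
    then show ?thesis using Suc by simp
  qed
  show ?thesis using i1 i2 i3 assms by (intro exI[of _ i]) auto
qed

context prob_space
begin

text \<open>
  The values \<open>r i\<close> give each of the \<open>L\<close> levels an equal share of one half of \<open>\<epsilon> powr p\<close>; the other half
  is for the region where \<open>h\<close> is below the last level.  The sizes of the averages
  grow like \<open>4\<^sup>i\<close> and \<open>r i\<close> grows like \<open>2\<^bsup>ip\<^esup>\<close>, so for \<open>p \<ge> 2\<close> one condition on \<open>n\<close> is enough for all levels.
  The dictionary consists of the real and the imaginary parts of the \<open>e k\<close>.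
\<close>

lemma exists_points_Lp_small:
  fixes e :: "'k \<Rightarrow> 'a \<Rightarrow> complex" and p \<epsilon> :: real and L n :: nat
  assumes J: "finite J"
    and e: "\<And>k. k \<in> J \<Longrightarrow> e k \<in> borel_measurable M"
      "\<And>k u. k \<in> J \<Longrightarrow> u \<in> space M \<Longrightarrow> cmod (e k u) \<le> 1"
    and p: "2 \<le> p" and \<epsilon>: "0 < \<epsilon>" and L: "1 \<le> L" "18 * (1 / 2) ^ L \<le> \<epsilon>" and n: "1 \<le> n"
    and large: "(1024 * ln (8 * real n * (real n + 1)) + 1) * ln (4 * real (card J) + 1) + ln (2 * real L)
      \<le> real n * \<epsilon> powr p / (8 * 9 powr p * real L)"
  shows "\<exists>x. (\<forall>j<n. x j \<in> space M) \<and>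
    (\<forall>c h. h \<in> borel_measurable M \<longrightarrow> (\<Sum>k\<in>J. cmod (c k)) \<le> 2 \<longrightarrow>
       (\<forall>u\<in>space M. cmod (h u - (\<Sum>k\<in>J. c k * e k u)) \<le> (1 / 2) ^ L) \<longrightarrow>
       (\<forall>j<n. h (x j) = 0) \<longrightarrow>
       expectation (\<lambda>u. cmod (h u) powr p) \<le> \<epsilon> powr p)"
proof -
  define I :: "('k \<times> bool) set" where "I = J \<times> UNIV"
  define y where "y = (\<lambda>(k, b) u. if b then Re (e k u) else Im (e k u))"
  define \<beta> where "\<beta> = (2::real) powr p"
  define t :: "nat \<Rightarrow> real" where "t i = (1 / 2) ^ Suc i" for i
  define \<eta> where "\<eta> = ln (8 * real n * (real n + 1))"
  define m where "m i = nat \<lceil>1024 * 4 ^ i * \<eta>\<rceil>" for i :: nat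
  define r where "r i = \<epsilon> powr p * \<beta> ^ i / (4 * 9 powr p * real L)" for i :: nat
  define Q where "Q = (1024 * \<eta> + 1) * ln (4 * real (card J) + 1) + ln (2 * real L)"
  have \<beta>: "4 \<le> \<beta>"
  proof -
    have "(2::real) powr 2 \<le> 2 powr p" using p by (intro powr_mono) auto
    then show ?thesis by (simp add: \<beta>_def)
  qed
  have \<eta>: "0 \<le> \<eta>"
  proof -
    have "1 * 1 \<le> 8 * real n * (real n + 1)" using n by (intro mult_mono) auto
    then show ?thesis unfolding \<eta>_def by (intro ln_ge_zero) simp
  qed
  have lnL: "ln 2 \<le> ln (2 * real L)" using L by (subst ln_le_cancel_iff) auto
  have ln2: "1 / 2 \<le> ln (2::real)" using ln2_ge_two_thirds by simp
  have lnJ: "0 \<le> ln (4 * real (card J) + 1)" by simp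
  have Q_ge: "1 / 2 \<le> Q"
  proof -
    have "0 \<le> (1024 * \<eta> + 1) * ln (4 * real (card J) + 1)"
      using \<eta> lnJ by (intro mult_nonneg_nonneg) auto
    then show ?thesis unfolding Q_def using lnL ln2 by linarith
  qed
  have nr: "\<beta> ^ i * Q \<le> real n * r i / 2" for i
  proof -
    have "\<beta> ^ i * Q \<le> \<beta> ^ i * (real n * \<epsilon> powr p / (8 * 9 powr p * real L))"
      using large \<beta> unfolding Q_def \<eta>_def by (intro mult_left_mono) auto
    also have "\<dots> = real n * r i / 2"
      by (simp add: r_def field_simps)
    finally show ?thesis .
  qed
  have pow_ge: "4 ^ i * Q \<le> \<beta> ^ i * Q" for i
    using \<beta> Q_ge by (intro mult_right_mono power_mono) auto
  have "\<exists>x. (\<forall>j<n. x j \<in> space M) \<and>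
    (\<forall>i\<in>{..<L}. \<forall>a. (\<Sum>k\<in>I. \<bar>a k\<bar>) \<le> 1 \<longrightarrow>
       (\<forall>j<n. \<bar>\<Sum>k\<in>I. a k * y k (x j)\<bar> \<le> t i / 2) \<longrightarrow>
       prob {u\<in>space M. t i \<le> \<bar>\<Sum>k\<in>I. a k * y k u\<bar>} \<le> r i)"
  proof (rule exists_points_controlling_absolutely_convex_combinations[where m = m])
    show "finite I" using J by (simp add: I_def)
    show "y k \<in> borel_measurable M" if "k \<in> I" for k
      using that e(1) by (cases k; cases "snd k") (auto simp: I_def y_def)
    show "\<bar>y k u\<bar> \<le> 1" if "k \<in> I" "u \<in> space M" for k u
      using that e(2)
      by (cases k; cases "snd k")
         (auto simp: I_def y_def intro: order_trans[OF abs_Re_le_cmod] order_trans[OF abs_Im_le_cmod])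
    show "256 / (t i)\<^sup>2 * ln (8 * real n * (real n + 1)) \<le> real (m i)" for i
    proof -
      have "(t i)\<^sup>2 = 1 / (4 * 4 ^ i)"
        by (simp add: t_def power_mult_distrib power_divide power2_eq_square
             flip: power_mult_distrib)
      then have "256 / (t i)\<^sup>2 * ln (8 * real n * (real n + 1)) = 1024 * 4 ^ i * \<eta>"
        by (simp add: \<eta>_def)
      then show ?thesis unfolding m_def by linarith
    qed
    show "1 / 2 \<le> real n * r i" for i
    proof -
      have "1 * (1 / 2) \<le> 4 ^ i * Q" using Q_ge by (intro mult_mono) auto
      then show ?thesis using nr[of i] pow_ge[of i] by linarith
    qed
    show "(\<Sum>i<L. (2 * real (card I) + 1) ^ m i * exp (- (real n * r i / 2))) < 1"
    proof -
      have "(2 * real (card I) + 1) ^ m i * exp (- (real n * r i / 2)) \<le> 1 / (2 * real L)" for i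
      proof -
        define N where "N = 4 * real (card J) + 1"
        have N: "2 * real (card I) + 1 = N" "0 < N" by (auto simp: I_def N_def card_cartesian_product)
        have "real (m i) \<le> 1024 * 4 ^ i * \<eta> + 1"
          unfolding m_def using \<eta> by (simp add: of_nat_ceiling)
        also have "\<dots> \<le> 4 ^ i * (1024 * \<eta> + 1)"
          by (simp add: algebra_simps)
        finally have "real (m i) * ln N \<le> 4 ^ i * (1024 * \<eta> + 1) * ln N"
          using lnJ unfolding N_def by (intro mult_right_mono)
        moreover have "1 * ln (2 * real L) \<le> 4 ^ i * ln (2 * real L)"
          using lnL ln2 by (intro mult_right_mono) auto
        ultimately have "real (m i) * ln N + ln (2 * real L) \<le> 4 ^ i * Q"
          unfolding Q_def N_def by (simp add: algebra_simps)
        also have "\<dots> \<le> real n * r i / 2" using nr[of i] pow_ge[of i] by linarith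
        finally have "real (m i) * ln N - real n * r i / 2 \<le> - ln (2 * real L)" by simp
        then have "exp (real (m i) * ln N - real n * r i / 2) \<le> exp (- ln (2 * real L))" by simp
        also have "exp (- ln (2 * real L)) = 1 / (2 * real L)" using L by (simp add: exp_minus field_simps)
        also have "exp (real (m i) * ln N - real n * r i / 2) = N ^ m i * exp (- (real n * r i / 2))"
          using N(2) by (simp only: exp_diff exp_minus exp_of_nat_mult exp_ln divide_inverse)
        finally show ?thesis unfolding N(1) .
      qed
      then have "(\<Sum>i<L. (2 * real (card I) + 1) ^ m i * exp (- (real n * r i / 2)))
        \<le> (\<Sum>i<L. 1 / (2 * real L))"
        by (intro sum_mono)
      also have "\<dots> = 1 / 2" using L by simp
      finally show ?thesis by simp
    qed
    show "t i \<le> 1" for i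
      unfolding t_def by (rule power_le_one) auto
  qed (use n in \<open>auto simp: t_def\<close>)
  then obtain x where "(\<forall>j<n. x j \<in> space M) \<and>
    (\<forall>i\<in>{..<L}. \<forall>a. (\<Sum>k\<in>I. \<bar>a k\<bar>) \<le> 1 \<longrightarrow>
       (\<forall>j<n. \<bar>\<Sum>k\<in>I. a k * y k (x j)\<bar> \<le> t i / 2) \<longrightarrow>
       prob {u\<in>space M. t i \<le> \<bar>\<Sum>k\<in>I. a k * y k u\<bar>} \<le> r i)" ..
  then have x: "\<And>j. j < n \<Longrightarrow> x j \<in> space M"
    and level: "\<And>i a. i < L \<Longrightarrow> (\<Sum>k\<in>I. \<bar>a k\<bar>) \<le> 1 \<Longrightarrow>
       \<forall>j<n. \<bar>\<Sum>k\<in>I. a k * y k (x j)\<bar> \<le> t i / 2 \<Longrightarrow>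
       prob {u\<in>space M. t i \<le> \<bar>\<Sum>k\<in>I. a k * y k u\<bar>} \<le> r i"
    by simp_all
  have "expectation (\<lambda>u. cmod (h u) powr p) \<le> \<epsilon> powr p"
    if h [measurable]: "h \<in> borel_measurable M" and c: "(\<Sum>k\<in>J. cmod (c k)) \<le> 2"
      and tail: "\<forall>u\<in>space M. cmod (h u - (\<Sum>k\<in>J. c k * e k u)) \<le> (1 / 2) ^ L"
      and zero: "\<forall>j<n. h (x j) = 0" for c h
  proof -
    define g where "g u = (\<Sum>k\<in>J. c k * e k u)" for u
    \<comment> \<open>Coefficients of the real and of the imaginary part of \<open>g / 4\<close>; the factor \<open>1 / 4\<close> makes their sums at most \<open>1\<close>.\<close>
    define a where "a = (\<lambda>(k, b). if b then Re (c k) / 4 else - Im (c k) / 4)"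
    define a' where "a' = (\<lambda>(k, b). if b then Im (c k) / 4 else Re (c k) / 4)"
    define G where "G u = (\<Sum>k\<in>I. a k * y k u)" for u
    define G' where "G' u = (\<Sum>k\<in>I. a' k * y k u)" for u
    have sum_I: "(\<Sum>k\<in>I. F k) = (\<Sum>k\<in>J. F (k, True) + F (k, False))" for F :: "'k \<times> bool \<Rightarrow> real"
    proof -
      have "(\<Sum>k\<in>I. F k) = (\<Sum>k\<in>J. \<Sum>b\<in>UNIV. F (k, b))"
        unfolding I_def by (simp add: sum.cartesian_product)
      then show ?thesis by (simp add: UNIV_bool add.commute)
    qed
    have G_Re: "G u = Re (g u) / 4" for u
      unfolding G_def g_def sum_I by (simp add: a_def y_def sum_divide_distrib diff_divide_distrib)
    have G_Im: "G' u = Im (g u) / 4" for u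
      unfolding G'_def g_def sum_I
      by (simp add: a'_def y_def sum_divide_distrib add_divide_distrib add.commute)
    have parts: "\<bar>Re (c k)\<bar> / 4 + \<bar>Im (c k)\<bar> / 4 \<le> cmod (c k) / 2" for k
      using abs_Re_le_cmod[of "c k"] abs_Im_le_cmod[of "c k"] by linarith
    have sum_a: "(\<Sum>k\<in>I. \<bar>a k\<bar>) \<le> 1" and sum_a': "(\<Sum>k\<in>I. \<bar>a' k\<bar>) \<le> 1"
    proof -
      have "(\<Sum>k\<in>I. \<bar>a k\<bar>) = (\<Sum>k\<in>J. \<bar>Re (c k)\<bar> / 4 + \<bar>Im (c k)\<bar> / 4)"
        unfolding sum_I by (simp add: a_def)
      moreover have "(\<Sum>k\<in>I. \<bar>a' k\<bar>) = (\<Sum>k\<in>J. \<bar>Re (c k)\<bar> / 4 + \<bar>Im (c k)\<bar> / 4)"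
        unfolding sum_I by (simp add: a'_def add.commute)
      moreover have "(\<Sum>k\<in>J. \<bar>Re (c k)\<bar> / 4 + \<bar>Im (c k)\<bar> / 4) \<le> (\<Sum>k\<in>J. cmod (c k) / 2)"
        by (intro sum_mono parts)
      moreover have "(\<Sum>k\<in>J. cmod (c k) / 2) \<le> 1"
        using c by (simp add: sum_divide_distrib[symmetric])
      ultimately show "(\<Sum>k\<in>I. \<bar>a k\<bar>) \<le> 1" "(\<Sum>k\<in>I. \<bar>a' k\<bar>) \<le> 1" by linarith+
    qed
    have g_at: "cmod (g (x j)) \<le> (1 / 2) ^ L" if "j < n" for j
      using tail x[OF that] zero that unfolding g_def by fastforce
    have at: "\<bar>Re (g (x j)) / 4\<bar> \<le> t i / 2" "\<bar>Im (g (x j)) / 4\<bar> \<le> t i / 2" if "j < n" "i < L" for i j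
    proof -
      have "(1 / 2 :: real) ^ L \<le> (1 / 2) ^ i"
        using that by (intro power_decreasing) auto
      moreover have "t i / 2 = (1 / 2) ^ i / 4"
        by (simp add: t_def)
      ultimately show "\<bar>Re (g (x j)) / 4\<bar> \<le> t i / 2" "\<bar>Im (g (x j)) / 4\<bar> \<le> t i / 2"
        using g_at[OF that(1)] abs_Re_le_cmod[of "g (x j)"] abs_Im_le_cmod[of "g (x j)"]
        unfolding abs_divide by linarith+
    qed
    define U where "U i = {u\<in>space M. t i \<le> \<bar>G u\<bar>}" for i
    define U' where "U' i = {u\<in>space M. t i \<le> \<bar>G' u\<bar>}" for i
    have prob_U: "prob (U i) \<le> r i" "prob (U' i) \<le> r i" if "i < L" for i
      unfolding U_def U'_def G_def G'_def
      using that at level[OF that sum_a] level[OF that sum_a']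
      unfolding G_def[symmetric] G'_def[symmetric] G_Re G_Im by auto
    have g_meas [measurable]: "g \<in> borel_measurable M"
      unfolding g_def using e(1) by measurable
    have [measurable]: "G \<in> borel_measurable M" "G' \<in> borel_measurable M"
      unfolding G_Re[abs_def] G_Im[abs_def] by measurable
    have U_ev [measurable]: "U i \<in> events" "U' i \<in> events" for i
      unfolding U_def U'_def by measurable
    define \<kappa> where "\<kappa> i = (9 * (1 / 2) ^ i) powr p" for i :: nat
    have \<kappa>: "0 \<le> \<kappa> i" for i by (simp add: \<kappa>_def)
    define B where "B u = \<kappa> L + (\<Sum>i<L. \<kappa> i * (indicator (U i) u + indicator (U' i) u))" for u
    have pointwise: "cmod (h u) powr p \<le> B u" if u: "u \<in> space M" for u
    proof -
      define W where "W = max \<bar>G u\<bar> \<bar>G' u\<bar>"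
      have "cmod (g u) \<le> \<bar>Re (g u)\<bar> + \<bar>Im (g u)\<bar>" by (rule cmod_le)
      then have "cmod (g u) \<le> 8 * W"
        unfolding W_def G_Re G_Im by simp
      moreover have "cmod (h u) \<le> cmod (g u) + cmod (h u - g u)"
        by (metis add.commute diff_add_cancel norm_triangle_ineq)
      moreover have "cmod (h u - g u) \<le> (1 / 2) ^ L" using tail u unfolding g_def by blast
      ultimately have hW: "cmod (h u) \<le> 8 * W + (1 / 2) ^ L" by linarith
      have B_ge: "\<kappa> i * (indicator (U i) u + indicator (U' i) u) \<le> B u" if "i < L" for i
      proof -
        have "\<kappa> i * (indicator (U i) u + indicator (U' i) u)
          \<le> (\<Sum>i<L. \<kappa> i * (indicator (U i) u + indicator (U' i) u))"
          using that \<kappa> by (intro member_le_sum) auto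
        then show ?thesis unfolding B_def using \<kappa>[of L] by linarith
      qed
      have B_ge_L: "\<kappa> L \<le> B u"
        unfolding B_def using \<kappa> by (simp add: sum_nonneg)
      show ?thesis
      proof (cases "W < (1 / 2) ^ L")
        case True
        then have "cmod (h u) \<le> 9 * (1 / 2) ^ L" using hW by linarith
        then have "cmod (h u) powr p \<le> \<kappa> L" unfolding \<kappa>_def using p by (intro powr_mono2) auto
        then show ?thesis using B_ge_L by linarith
      next
        case False
        have "cmod (g u) \<le> (\<Sum>k\<in>J. cmod (c k) * 1)"
          unfolding g_def using e(2) u
          by (intro order_trans[OF norm_sum] sum_mono) (auto simp: norm_mult intro: mult_left_le)
        then have "cmod (g u) \<le> 2" using c by simp
        then have "W \<le> 1"
          using abs_Re_le_cmod[of "g u"] abs_Im_le_cmod[of "g u"] unfolding W_def G_Re G_Im by simp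
        then obtain i where i: "i < L" "t i \<le> W" "W \<le> (1 / 2) ^ i"
          using dyadic_level_exists[of L W] False L unfolding t_def by auto
        have "(1 / 2 :: real) ^ L \<le> (1 / 2) ^ i"
          using i by (intro power_decreasing) auto
        then have "cmod (h u) \<le> 9 * (1 / 2) ^ i" using hW i by linarith
        then have "cmod (h u) powr p \<le> \<kappa> i * 1" unfolding \<kappa>_def using p by (simp add: powr_mono2)
        also have "\<dots> \<le> \<kappa> i * (indicator (U i) u + indicator (U' i) u)"
          using i(2) u \<kappa> unfolding W_def U_def U'_def
          by (intro mult_left_mono) (auto simp: indicator_def max_def split: if_splits)
        finally show ?thesis using B_ge[OF i(1)] by linarith
      qed
    qed
    have int_U: "integrable M (indicator (U i) :: 'a \<Rightarrow> real)" "integrable M (indicator (U' i) :: 'a \<Rightarrow> real)" for i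
      by (auto intro!: integrable_real_indicator simp: emeasure_eq_measure)
    have int_B: "integrable M B"
      unfolding B_def using int_U by auto
    have "expectation (\<lambda>u. cmod (h u) powr p) \<le> expectation B"
      using int_B pointwise order_trans[OF powr_ge_zero pointwise] by (intro integral_mono') auto
    also have "\<dots> = \<kappa> L + (\<Sum>i<L. \<kappa> i * (prob (U i) + prob (U' i)))"
      unfolding B_def using int_U U_ev sets.sets_into_space[OF U_ev(1)] sets.sets_into_space[OF U_ev(2)]
      by (simp add: prob_space Bochner_Integration.integral_sum Int_absorb2)
    also have "\<dots> \<le> \<kappa> L + (\<Sum>i<L. \<kappa> i * (r i + r i))"
      using prob_U \<kappa> by (intro add_mono sum_mono mult_left_mono) auto
    also have "(\<Sum>i<L. \<kappa> i * (r i + r i)) = (\<Sum>i<L. \<epsilon> powr p / (2 * real L))"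
    proof (intro sum.cong refl)
      fix i
      have "\<kappa> i = 9 powr p * (1 / \<beta> ^ i)"
        by (simp add: \<kappa>_def \<beta>_def powr_mult powr_divide powr_power powr_realpow[symmetric] power_one_over powr_powr mult.commute)
      then have "\<kappa> i * \<beta> ^ i = 9 powr p"
        using \<beta> by simp
      moreover have "\<kappa> i * (r i + r i) = (\<kappa> i * \<beta> ^ i) * (\<epsilon> powr p / (2 * 9 powr p * real L))"
        by (simp add: r_def field_simps)
      ultimately show "\<kappa> i * (r i + r i) = \<epsilon> powr p / (2 * real L)"
        by simp
    qed
    also have "\<dots> = \<epsilon> powr p / 2"
      using L by simp
    also have "\<kappa> L \<le> \<epsilon> powr p / 2"
    proof -
      have "\<kappa> L \<le> (\<epsilon> / 2) powr p"
        unfolding \<kappa>_def using L p by (intro powr_mono2) auto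
      also have "\<dots> = \<epsilon> powr p / \<beta>"
        using \<epsilon> by (simp add: powr_divide \<beta>_def)
      also have "\<dots> \<le> \<epsilon> powr p / 2"
        using \<beta> by (intro divide_left_mono) auto
      finally show ?thesis .
    qed
    finally show ?thesis by simp
  qed
  with x show ?thesis
    by (intro exI[of _ x] conjI allI ballI impI) simp_all
qed

end

section \<open>The unit cube and its characters\<close>

abbreviation unit_interval_measure :: "real measure" where
  "unit_interval_measure \<equiv> restrict_space lborel {0..1}"

lemma prob_space_unit_interval: "prob_space unit_interval_measure"
  by (intro prob_space_restrict_space) auto

lemma prob_space_cube_measure: "prob_space (cube_measure d)"
  unfolding cube_measure_def by (intro prob_space_PiM prob_space_unit_interval)

lemma space_cube_measure: "space (cube_measure d) = cube d"
  by (simp add: cube_measure_def cube_def space_PiM space_restrict_space)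

lemma product_sigma_finite_unit_interval: "product_sigma_finite (\<lambda>_. unit_interval_measure)"
  by (simp add: product_sigma_finite_def prob_space_imp_sigma_finite prob_space_unit_interval)

lemma coordinate_measurable_cube:
  "i < d \<Longrightarrow> (\<lambda>x. x i) \<in> borel_measurable (cube_measure d)"
proof -
  assume "i < d"
  then have "(\<lambda>x. x i) \<in> cube_measure d \<rightarrow>\<^sub>M unit_interval_measure"
    unfolding cube_measure_def by (intro measurable_component_singleton) simp
  then show ?thesis
    by (rule measurable_compose) (simp add: measurable_restrict_space1)
qed

text \<open>
  Measurability for the product of the coordinate measures comes from the Borel sets of the full
  function space: outside \<open>{..<d}\<close> all points of the cube have the same coordinates.
\<close>

lemma continuous_on_cube_measurable:
  fixes f :: "(nat \<Rightarrow> real) \<Rightarrow> complex"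
  assumes "continuous_on (cube d) f"
  shows "f \<in> borel_measurable (cube_measure d)"
proof -
  have "(\<lambda>x. x) \<in> borel_measurable (cube_measure d)"
  proof (rule measurable_coordinatewise_then_product)
    fix i
    show "(\<lambda>x. x i) \<in> borel_measurable (cube_measure d)"
    proof (cases "i < d")
      case False
      have "x i = undefined" if "x \<in> space (cube_measure d)" for x
        using that False by (auto simp: space_cube_measure cube_def PiE_def extensional_def)
      then show ?thesis
        by (subst measurable_cong[where g = "\<lambda>_. undefined"]) auto
    qed (rule coordinate_measurable_cube)
  qed
  then have "(\<lambda>x. x) \<in> cube_measure d \<rightarrow>\<^sub>M restrict_space borel (cube d)"
    by (intro measurable_restrict_space2) (auto simp: space_cube_measure)
  moreover have "f \<in> borel_measurable (restrict_space borel (cube d))"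
    using assms by (rule borel_measurable_continuous_on_restrict)
  ultimately show ?thesis
    by (rule measurable_compose[where g = f and f = "\<lambda>x. x", simplified])
qed

lemma compact_cube: "compact (cube d)"
proof -
  define S where "S i = (if i < d then {0..1::real} else {undefined})" for i
  have "cube d = PiE UNIV S"
    by (auto simp: cube_def S_def PiE_def extensional_def Pi_def split: if_splits)
  moreover have "compactin (product_topology (\<lambda>_. euclidean) UNIV) (PiE UNIV S)"
    unfolding compactin_PiE by (auto simp: S_def)
  ultimately show ?thesis
    unfolding euclidean_product_topology by simp
qed

lemma continuous_on_cube_bounded:
  fixes f :: "(nat \<Rightarrow> real) \<Rightarrow> complex"
  assumes "continuous_on (cube d) f"
  obtains B where "\<And>x. x \<in> cube d \<Longrightarrow> cmod (f x) \<le> B"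
proof -
  have "bounded (f ` cube d)"
    using assms compact_cube by (intro compact_imp_bounded compact_continuous_image)
  then show ?thesis
    using that by (auto simp: bounded_iff)
qed

lemma integrable_bounded_on_cube:
  fixes f :: "(nat \<Rightarrow> real) \<Rightarrow> 'b :: {banach, second_countable_topology}"
  assumes "f \<in> borel_measurable (cube_measure d)" "\<And>x. x \<in> cube d \<Longrightarrow> norm (f x) \<le> B"
  shows "integrable (cube_measure d) f"
proof -
  interpret prob_space "cube_measure d" by (rule prob_space_cube_measure)
  show ?thesis
    by (rule integrable_const_bound[where B = B]) (use assms in \<open>auto simp: space_cube_measure\<close>)
qed

lemma continuous_on_cube_nhd:
  fixes f :: "(nat \<Rightarrow> real) \<Rightarrow> complex"
  assumes "continuous_on (cube d) f" "a \<in> cube d" "0 < e"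
  obtains \<delta> where "0 < \<delta>"
    "\<And>x. x \<in> cube d \<Longrightarrow> (\<And>i. i < d \<Longrightarrow> \<bar>x i - a i\<bar> < \<delta>) \<Longrightarrow> cmod (f x - f a) < e"
proof -
  obtain A where A: "open A" "a \<in> A" "\<And>x. x \<in> cube d \<Longrightarrow> x \<in> A \<Longrightarrow> f x \<in> ball (f a) e"
    using assms unfolding continuous_on_topological by (metis centre_in_ball open_ball)
  have "openin (product_topology (\<lambda>_. euclidean) UNIV) A"
    using A(1) by (simp add: euclidean_product_topology)
  from product_topology_open_contains_basis[OF this A(2)]
  obtain X where X: "a \<in> (\<Pi>\<^sub>E i\<in>UNIV. X i)" "\<And>i. open (X i)" "(\<Pi>\<^sub>E i\<in>UNIV. X i) \<subseteq> A"
    by auto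
  have "\<exists>\<rho>>0. ball (a i) \<rho> \<subseteq> X i" for i
    using X(1,2) by (auto simp: open_contains_ball)
  then obtain \<rho> where \<rho>: "\<And>i. 0 < \<rho> i" "\<And>i. ball (a i) (\<rho> i) \<subseteq> X i" by metis
  \<comment> \<open>The added \<open>1\<close> makes the minimum meaningful for \<open>d = 0\<close>.\<close>
  define \<delta> where "\<delta> = Min (insert 1 (\<rho> ` {..<d}))"
  show ?thesis
  proof
    show "0 < \<delta>" unfolding \<delta>_def using \<rho> by auto
    fix x assume x: "x \<in> cube d" "\<And>i. i < d \<Longrightarrow> \<bar>x i - a i\<bar> < \<delta>"
    have "x i \<in> X i" for i
    proof (cases "i < d")
      case True
      have "\<delta> \<le> \<rho> i" unfolding \<delta>_def using True by (intro Min_le) auto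
      then have "x i \<in> ball (a i) (\<rho> i)" using x(2)[OF True] by (auto simp: dist_real_def abs_minus_commute)
      then show ?thesis using \<rho> by blast
    next
      case False
      then have "x i = a i" using x(1) assms(2) by (auto simp: cube_def PiE_def extensional_def)
      then show ?thesis using X(1) by auto
    qed
    then have "x \<in> A" using X(3) by auto
    then show "cmod (f x - f a) < e"
      using A(3)[OF x(1)] by (simp add: dist_norm norm_minus_commute)
  qed
qed

definition character :: "nat \<Rightarrow> (nat \<Rightarrow> int) \<Rightarrow> (nat \<Rightarrow> real) \<Rightarrow> complex" where
  "character d k x = cis (2 * pi * (\<Sum>i<d. real_of_int (k i) * x i))"

lemma norm_character [simp]: "cmod (character d k x) = 1"
  by (simp add: character_def)

lemma character_eq_prod:
  "character d k x = (\<Prod>i<d. cis (2 * pi * (real_of_int (k i) * x i)))"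
  unfolding character_def by (induction d) (simp_all add: distrib_left flip: cis_mult)

lemma character_mult:
  "character d k x * character d l x = character d (\<lambda>i. k i + l i) x"
  by (simp add: character_def cis_mult sum.distrib ring_distribs)

lemma cnj_character: "cnj (character d k x) = character d (\<lambda>i. - k i) x"
  by (simp add: character_def cis_cnj sum_negf)

lemma character_measurable: "character d k \<in> borel_measurable (cube_measure d)"
proof -
  have "(\<lambda>x. \<Sum>i<d. real_of_int (k i) * x i) \<in> borel_measurable (cube_measure d)"
    by (intro borel_measurable_sum borel_measurable_times coordinate_measurable_cube) auto
  then have "(\<lambda>x. cis (2 * pi * (\<Sum>i<d. real_of_int (k i) * x i))) \<in> borel_measurable (cube_measure d)"
    by (intro measurable_compose[OF _ borel_measurable_continuous_onI[of cis]] continuous_intros) auto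
  then show ?thesis unfolding character_def[abs_def] .
qed

lemma integral_cis_unit_interval:
  "(LINT t|unit_interval_measure. cis (2 * pi * (real_of_int k * t))) = (if k = 0 then 1 else 0)"
proof -
  have "(LINT t|unit_interval_measure. cis (2 * pi * (real_of_int k * t))) =
     (LBINT t. indicator {0..1} t *\<^sub>R cis (2 * pi * (real_of_int k * t)))"
    by (subst integral_restrict_space) auto
  also have "\<dots> = (if k = 0 then 1 else 0)"
  proof (cases "k = 0")
    case True
    then show ?thesis by simp
  next
    case False
    define c where "c = complex_of_real (2 * pi * real_of_int k) * \<i>"
    have c: "c \<noteq> 0" using False by (simp add: c_def)
    have cis_eq: "cis (2 * pi * (real_of_int k * t)) = exp (c * complex_of_real t)" for t
      by (simp add: cis_conv_exp c_def mult_ac)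
    have "(LBINT t. indicator {0..1} t *\<^sub>R cis (2 * pi * (real_of_int k * t))) =
      exp (c * complex_of_real 1) / c - exp (c * complex_of_real 0) / c"
    proof (rule integral_FTC_Icc)
      show "((\<lambda>t. exp (c * complex_of_real t) / c) has_vector_derivative
        cis (2 * pi * (real_of_int k * t))) (at t within {0..1})" for t
        unfolding cis_eq using c
        by (auto intro!: derivative_eq_intros has_vector_derivative_real_field simp: field_simps)
      show "continuous_on {0..1} (\<lambda>t. cis (2 * pi * (real_of_int k * t)))"
        by (intro continuous_intros)
    qed simp
    moreover have "exp (c * complex_of_real 1) = 1"
      using cis_eq[of 1, symmetric] by (simp add: cis_multiple_2pi)
    ultimately show ?thesis using False by simp
  qed
  finally show ?thesis .
qed

lemma integral_character:
  "(LINT x|cube_measure d. character d k x) = (if \<forall>i<d. k i = 0 then 1 else 0)"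
proof -
  interpret product_sigma_finite "\<lambda>_::nat. unit_interval_measure"
    by (rule product_sigma_finite_unit_interval)
  interpret U: prob_space unit_interval_measure by (rule prob_space_unit_interval)
  have "(LINT x|cube_measure d. character d k x) =
     (\<Prod>i<d. LINT t|unit_interval_measure. cis (2 * pi * (real_of_int (k i) * t)))"
    unfolding character_eq_prod cube_measure_def
  proof (rule product_integral_prod)
    fix i
    have "(\<lambda>t. cis (2 * pi * (real_of_int (k i) * t))) \<in> borel_measurable borel"
      by (intro borel_measurable_continuous_onI continuous_intros)
    then have "(\<lambda>t. cis (2 * pi * (real_of_int (k i) * t))) \<in> borel_measurable unit_interval_measure"
      by (intro measurable_restrict_space1) simp
    then show "integrable unit_interval_measure (\<lambda>t. cis (2 * pi * (real_of_int (k i) * t)))"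
      by (intro U.integrable_const_bound[where B = 1]) auto
  qed simp
  also have "\<dots> = (\<Prod>i<d. if k i = 0 then 1 else 0)"
    by (simp add: integral_cis_unit_interval)
  also have "\<dots> = (if \<forall>i<d. k i = 0 then 1 else 0)"
    by (auto intro!: prod_zero)
  finally show ?thesis .
qed

lemma fourier_coeff_eq:
  "fourier_coeff d f k = (LINT x|cube_measure d. f x * cnj (character d k x))"
proof -
  have "cnj (character d k x) =
    exp (- (2 * complex_of_real pi * \<i> * complex_of_real (\<Sum>i<d. real_of_int (k i) * x i)))" for x
    unfolding character_def cis_cnj unfolding cis_conv_exp by (simp add: mult_ac)
  then show ?thesis
    unfolding fourier_coeff_def by simp
qed

section \<open>Bounding a continuous function by its Fourier coefficients\<close>

text \<open>
  A nonnegative trigonometric polynomial with its peak at \<open>b\<close>.  By Euler's formula its Fourier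
  coefficients are, up to factors of modulus \<open>1\<close>, products of normalised binomial coefficients.
  This makes its integral, which is the largest of them in modulus, explicit.
\<close>

definition cosine_kernel :: "nat \<Rightarrow> nat \<Rightarrow> (nat \<Rightarrow> real) \<Rightarrow> (nat \<Rightarrow> real) \<Rightarrow> real" where
  "cosine_kernel d n b x = (\<Prod>i<d. ((1 + cos (2 * pi * (x i - b i))) / 2) ^ n)"

lemma cosine_power_expansion:
  "complex_of_real (((1 + cos (2 * pi * t)) / 2) ^ n) =
     (\<Sum>j\<le>2 * n. complex_of_real (real (2 * n choose j) / 4 ^ n) * cis (2 * pi * ((real n - real j) * t)))"
proof -
  define w where "w = cis (- (2 * pi * t))"
  have "complex_of_real ((1 + cos (2 * pi * t)) / 2) = (w + 1)\<^sup>2 * cis (2 * pi * t) / 4"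
  proof -
    have "(w + 1)\<^sup>2 * cis (2 * pi * t) = w * (w * cis (2 * pi * t)) + 2 * (w * cis (2 * pi * t)) + cis (2 * pi * t)"
      by (simp add: power2_eq_square algebra_simps)
    also have "w * cis (2 * pi * t) = 1" by (simp add: w_def cis_mult)
    also have "w * 1 + 2 * 1 + cis (2 * pi * t) = complex_of_real (2 + 2 * cos (2 * pi * t))"
      by (simp add: w_def complex_eq_iff)
    finally show ?thesis by (simp add: field_simps)
  qed
  then have "complex_of_real (((1 + cos (2 * pi * t)) / 2) ^ n) =
      ((w + 1)\<^sup>2 * cis (2 * pi * t) / 4) ^ n"
    by (simp only: of_real_power)
  also have "\<dots> = (w + 1) ^ (2 * n) * cis (2 * pi * t) ^ n / 4 ^ n"
    by (simp only: power_divide power_mult_distrib power_mult)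
  also have "(w + 1) ^ (2 * n) = (\<Sum>j\<le>2 * n. of_nat (2 * n choose j) * w ^ j)"
    by (subst binomial_ring) simp
  also have "\<dots> * cis (2 * pi * t) ^ n / 4 ^ n =
     (\<Sum>j\<le>2 * n. complex_of_real (real (2 * n choose j) / 4 ^ n) * (w ^ j * cis (2 * pi * t) ^ n))"
    unfolding sum_distrib_right sum_divide_distrib by (intro sum.cong) (simp_all add: mult_ac)
  also have "\<dots> = (\<Sum>j\<le>2 * n. complex_of_real (real (2 * n choose j) / 4 ^ n) * cis (2 * pi * ((real n - real j) * t)))"
  proof -
    have "w ^ j * cis (2 * pi * t) ^ n = cis (2 * pi * ((real n - real j) * t))" for j
    proof -
      have "real j * - (2 * pi * t) + real n * (2 * pi * t) = 2 * pi * ((real n - real j) * t)"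
        by (simp add: algebra_simps)
      then show ?thesis by (simp only: w_def Complex.DeMoivre cis_mult)
    qed
    then show ?thesis by simp
  qed
  finally show ?thesis .
qed

text \<open>
  The binomial expansion is indexed by natural numbers up to \<open>2n\<close>; the frequencies are these
  numbers shifted to \<open>-n, \<dots>, n\<close>.
\<close>

definition shifted_frequency :: "nat \<Rightarrow> nat \<Rightarrow> (nat \<Rightarrow> nat) \<Rightarrow> nat \<Rightarrow> int" where
  "shifted_frequency d n K = (\<lambda>i\<in>{..<d}. int (K i) - int n)"

lemma inj_shifted_frequency: "inj_on (shifted_frequency d n) ({..<d} \<rightarrow>\<^sub>E A)"
proof (rule inj_onI)
  fix K K' assume K: "K \<in> {..<d} \<rightarrow>\<^sub>E A" "K' \<in> {..<d} \<rightarrow>\<^sub>E A"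
    and eq: "shifted_frequency d n K = shifted_frequency d n K'"
  show "K = K'"
  proof (rule PiE_ext[OF K])
    fix i assume "i \<in> {..<d}"
    then show "K i = K' i"
      using fun_cong[OF eq, of i] by (simp add: shifted_frequency_def)
  qed
qed

lemma cosine_kernel_expansion:
  "complex_of_real (cosine_kernel d n b x) =
    (\<Sum>K\<in>{..<d} \<rightarrow>\<^sub>E {..2 * n}. complex_of_real (\<Prod>i<d. real (2 * n choose K i) / 4 ^ n) *
       (character d (shifted_frequency d n K) b * cnj (character d (shifted_frequency d n K) x)))"
proof -
  have "complex_of_real (cosine_kernel d n b x) =
    (\<Prod>i<d. \<Sum>j\<le>2 * n. complex_of_real (real (2 * n choose j) / 4 ^ n) * cis (2 * pi * ((real n - real j) * (x i - b i))))"
    unfolding cosine_kernel_def of_real_prod cosine_power_expansion ..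
  also have "\<dots> = (\<Sum>K\<in>{..<d} \<rightarrow>\<^sub>E {..2 * n}. \<Prod>i<d. complex_of_real (real (2 * n choose K i) / 4 ^ n) *
      cis (2 * pi * ((real n - real (K i)) * (x i - b i))))"
    by (intro prod_sum_PiE) auto
  also have "\<dots> = (\<Sum>K\<in>{..<d} \<rightarrow>\<^sub>E {..2 * n}. complex_of_real (\<Prod>i<d. real (2 * n choose K i) / 4 ^ n) *
       (character d (shifted_frequency d n K) b * cnj (character d (shifted_frequency d n K) x)))"
  proof (intro sum.cong refl)
    fix K
    have "character d (shifted_frequency d n K) b * cnj (character d (shifted_frequency d n K) x) =
      (\<Prod>i<d. cis (2 * pi * ((real n - real (K i)) * (x i - b i))))"
      unfolding character_eq_prod cnj_prod prod.distrib[symmetric]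
      by (intro prod.cong refl)
         (simp add: shifted_frequency_def cis_cnj cis_mult algebra_simps)
    then show "(\<Prod>i<d. complex_of_real (real (2 * n choose K i) / 4 ^ n) *
      cis (2 * pi * ((real n - real (K i)) * (x i - b i)))) =
      complex_of_real (\<Prod>i<d. real (2 * n choose K i) / 4 ^ n) *
       (character d (shifted_frequency d n K) b * cnj (character d (shifted_frequency d n K) x))"
      by (simp only: prod.distrib of_real_prod)
  qed
  finally show ?thesis .
qed

lemma character_extensional: "(\<And>i. i < d \<Longrightarrow> k i = l i) \<Longrightarrow> character d k x = character d l x"
  unfolding character_def by (auto intro!: arg_cong[where f = cis] sum.cong)

lemma integrable_times_cnj_character:
  assumes "u \<in> borel_measurable (cube_measure d)" "\<And>x. x \<in> cube d \<Longrightarrow> cmod (u x) \<le> B"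
  shows "integrable (cube_measure d) (\<lambda>x. u x * cnj (character d k x))"
proof (rule integrable_bounded_on_cube)
  show "(\<lambda>x. u x * cnj (character d k x)) \<in> borel_measurable (cube_measure d)"
    using assms(1) character_measurable[of d "\<lambda>i. - k i"] unfolding cnj_character by measurable
qed (use assms(2) in \<open>simp add: norm_mult\<close>)

lemma integral_times_cosine_kernel:
  assumes "u \<in> borel_measurable (cube_measure d)" "\<And>x. x \<in> cube d \<Longrightarrow> cmod (u x) \<le> B"
  shows "(LINT x|cube_measure d. u x * complex_of_real (cosine_kernel d n b x)) =
    (\<Sum>K\<in>{..<d} \<rightarrow>\<^sub>E {..2 * n}. complex_of_real (\<Prod>i<d. real (2 * n choose K i) / 4 ^ n) *
       character d (shifted_frequency d n K) b * fourier_coeff d u (shifted_frequency d n K))"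
proof -
  have "(LINT x|cube_measure d. u x * complex_of_real (cosine_kernel d n b x)) =
    (LINT x|cube_measure d. (\<Sum>K\<in>{..<d} \<rightarrow>\<^sub>E {..2 * n}. (complex_of_real (\<Prod>i<d. real (2 * n choose K i) / 4 ^ n) *
       character d (shifted_frequency d n K) b) * (u x * cnj (character d (shifted_frequency d n K) x))))"
    unfolding cosine_kernel_expansion sum_distrib_left
    by (intro Bochner_Integration.integral_cong sum.cong refl) (simp only: mult_ac)
  also have "\<dots> = (\<Sum>K\<in>{..<d} \<rightarrow>\<^sub>E {..2 * n}. (complex_of_real (\<Prod>i<d. real (2 * n choose K i) / 4 ^ n) *
       character d (shifted_frequency d n K) b) * fourier_coeff d u (shifted_frequency d n K))"
    unfolding fourier_coeff_eq using integrable_times_cnj_character[OF assms]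
    by (subst Bochner_Integration.integral_sum) auto
  finally show ?thesis .
qed

lemma fourier_coeff_one: "fourier_coeff d (\<lambda>_. 1) k = (if \<forall>i<d. k i = 0 then 1 else 0)"
  unfolding fourier_coeff_eq cnj_character by (simp add: integral_character)

lemma half_one_plus_cos_range:
  fixes y :: real
  shows "0 \<le> (1 + cos y) / 2" "(1 + cos y) / 2 \<le> 1"
proof -
  have "0 \<le> cos y + 1"
    using add_mono[OF cos_ge_minus_one[of y] order_refl[of 1]] by simp
  then show "0 \<le> (1 + cos y) / 2" by simp
  have "1 + cos y \<le> 1 + 1" by (intro add_left_mono cos_le_one)
  then show "(1 + cos y) / 2 \<le> 1" by simp
qed

lemma cosine_kernel_range:
  "0 \<le> cosine_kernel d n b x" "cosine_kernel d n b x \<le> 1"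
  unfolding cosine_kernel_def
  by (intro prod_nonneg prod_le_1 ballI conjI zero_le_power power_le_one half_one_plus_cos_range)+

lemma cosine_kernel_measurable: "cosine_kernel d n b \<in> borel_measurable (cube_measure d)"
  unfolding cosine_kernel_def[abs_def]
  by (intro borel_measurable_prod borel_measurable_power borel_measurable_divide borel_measurable_add
        borel_measurable_const measurable_compose[OF _ borel_measurable_continuous_onI[of cos]]
        borel_measurable_times borel_measurable_diff coordinate_measurable_cube continuous_intros) auto

lemma integral_cosine_kernel:
  "(LINT x|cube_measure d. cosine_kernel d n b x) = (real (2 * n choose n) / 4 ^ n) ^ d"
proof -
  define K0 where "K0 = (\<lambda>i\<in>{..<d}. n)"
  have K0: "K0 \<in> {..<d} \<rightarrow>\<^sub>E {..2 * n}" by (auto simp: K0_def)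
  have iff: "(\<forall>i<d. shifted_frequency d n K i = 0) \<longleftrightarrow> K = K0" if "K \<in> {..<d} \<rightarrow>\<^sub>E {..2 * n}" for K
  proof
    assume "\<forall>i<d. shifted_frequency d n K i = 0"
    then show "K = K0"
      using that by (intro PiE_ext[OF that K0]) (auto simp: shifted_frequency_def K0_def)
  qed (auto simp: shifted_frequency_def K0_def)
  have "complex_of_real (LINT x|cube_measure d. cosine_kernel d n b x) =
    (LINT x|cube_measure d. 1 * complex_of_real (cosine_kernel d n b x))"
    by simp
  also have "\<dots> = (\<Sum>K\<in>{..<d} \<rightarrow>\<^sub>E {..2 * n}. complex_of_real (\<Prod>i<d. real (2 * n choose K i) / 4 ^ n) *
       character d (shifted_frequency d n K) b * (if K = K0 then 1 else 0))"
    by (subst integral_times_cosine_kernel[where B = 1]) (auto simp: fourier_coeff_one iff intro!: sum.cong)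
  also have "\<dots> = complex_of_real (\<Prod>i<d. real (2 * n choose K0 i) / 4 ^ n) *
       character d (shifted_frequency d n K0) b"
    using K0 by (simp add: finite_PiE if_distrib[of "\<lambda>x. _ * x"] cong: if_cong)
  also have "(\<Prod>i<d. real (2 * n choose K0 i) / 4 ^ n) = (real (2 * n choose n) / 4 ^ n) ^ d"
    by (simp add: K0_def)
  also have "character d (shifted_frequency d n K0) b = character d (\<lambda>_. 0) b"
    by (rule character_extensional) (simp add: shifted_frequency_def K0_def)
  also have "\<dots> = 1" by (simp add: character_def)
  finally show ?thesis
    by (metis mult.right_neutral of_real_eq_iff)
qed

lemma cosine_kernel_small_off_diagonal:
  assumes "x \<in> cube d" "\<And>i. i < d \<Longrightarrow> \<delta> \<le> b i" "\<And>i. i < d \<Longrightarrow> b i \<le> 1 - \<delta>" "0 < \<delta>" "\<delta> \<le> 1 / 2"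
    and i: "i < d" "\<delta> \<le> \<bar>x i - b i\<bar>"
  shows "cosine_kernel d n b x \<le> ((1 + cos (2 * pi * \<delta>)) / 2) ^ n"
proof -
  define y where "y = \<bar>x i - b i\<bar>"
  have xi: "0 \<le> x i" "x i \<le> 1" using PiE_mem[OF assms(1)[unfolded cube_def], of i] i(1) by simp_all
  have y: "\<delta> \<le> y" "y \<le> 1 - \<delta>"
    unfolding y_def using i(2) xi assms(2,3)[OF i(1)] by linarith+
  have "cos (2 * pi * (x i - b i)) = cos (2 * pi * y)"
  proof (cases "b i \<le> x i")
    case False
    then have "2 * pi * y = - (2 * pi * (x i - b i))" by (simp add: y_def algebra_simps)
    then show ?thesis by (simp only: cos_minus)
  qed (simp add: y_def)
  also have "cos (2 * pi * y) \<le> cos (2 * pi * \<delta>)"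
  proof (cases "y \<le> 1 / 2")
    case True
    then show ?thesis using y assms(4) by (intro cos_monotone_0_pi_le) auto
  next
    case False
    have "cos (2 * pi * y) = cos (2 * pi * (1 - y))"
      by (simp add: right_diff_distrib cos_diff)
    also have "\<dots> \<le> cos (2 * pi * \<delta>)"
      using y assms(4) False by (intro cos_monotone_0_pi_le) auto
    finally show ?thesis .
  qed
  finally have c: "cos (2 * pi * (x i - b i)) \<le> cos (2 * pi * \<delta>)" .
  have "cosine_kernel d n b x = ((1 + cos (2 * pi * (x i - b i))) / 2) ^ n *
      (\<Prod>i\<in>{..<d} - {i}. ((1 + cos (2 * pi * (x i - b i))) / 2) ^ n)"
    unfolding cosine_kernel_def using i by (intro prod.remove) auto
  also have "\<dots> \<le> ((1 + cos (2 * pi * \<delta>)) / 2) ^ n * 1"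
    using c half_one_plus_cos_range
    by (intro mult_mono power_mono prod_le_1 prod_nonneg ballI conjI zero_le_power power_le_one) simp_all
  finally show ?thesis by simp
qed

lemma power_times_geometric_tendsto_0:
  fixes \<rho> :: real
  assumes "0 \<le> \<rho>" "\<rho> < 1" "0 < d"
  shows "(\<lambda>n. \<rho> ^ n * (2 * real n) ^ d) \<longlonglongrightarrow> 0"
proof -
  define q where "q = root d \<rho>"
  have q: "0 \<le> q" "q < 1" "q ^ d = \<rho>"
    using assms by (auto simp: q_def)
  have "(\<lambda>n. (2 * (real n * q ^ n)) ^ d) \<longlonglongrightarrow> (2 * 0) ^ d"
    using q by (intro tendsto_intros powser_times_n_limit_0) auto
  also have "(\<lambda>n. (2 * (real n * q ^ n)) ^ d) = (\<lambda>n. \<rho> ^ n * (2 * real n) ^ d)"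
    unfolding q(3)[symmetric] by (auto simp: power_mult_distrib power_mult[symmetric] mult_ac)
  finally show ?thesis using assms by (simp add: zero_power)
qed

text \<open>
  Suppose that \<open>|u a| > T\<close>.  Test \<open>u\<close> against the cosine kernel with its peak near \<open>a\<close>.  Expanding the
  kernel bounds the test integral by \<open>T\<close> times the largest coefficient of the kernel, hence by \<open>T\<close> times
  its integral.  On the other hand the integral nearly averages \<open>u\<close> over a neighbourhood of \<open>a\<close>:
  the kernel is exponentially small elsewhere, whereas its integral decays only polynomially in \<open>n\<close>.
\<close>

lemma continuous_le_wiener_norm:
  fixes u :: "(nat \<Rightarrow> real) \<Rightarrow> complex"
  assumes d: "0 < d" and cont: "continuous_on (cube d) u"
    and T: "\<And>S. finite S \<Longrightarrow> S \<subseteq> {..<d} \<rightarrow>\<^sub>E UNIV \<Longrightarrow> (\<Sum>k\<in>S. cmod (fourier_coeff d u k)) \<le> T"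
    and a: "a \<in> cube d"
  shows "cmod (u a) \<le> T"
proof (rule ccontr)
  assume large: "\<not> cmod (u a) \<le> T"
  define e where "e = (cmod (u a) - T) / 2"
  define T' where "T' = T + e"
  have e: "0 < e" using large by (simp add: e_def)
  have T0: "0 \<le> T" using T[of "{}"] by simp
  have ua: "cmod (u a) = T' + e" by (simp add: T'_def e_def)
  obtain \<delta>0 where \<delta>0: "0 < \<delta>0"
    and near_a: "\<And>x. x \<in> cube d \<Longrightarrow> (\<And>i. i < d \<Longrightarrow> \<bar>x i - a i\<bar> < \<delta>0) \<Longrightarrow> cmod (u x - u a) < e"
    using continuous_on_cube_nhd[OF cont a e] by blast
  \<comment> \<open>Move \<open>a\<close> into the interior, so that no periodic image of the peak enters the cube.\<close>
  define \<delta> where "\<delta> = min \<delta>0 (1 / 2) / 2"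
  define b where "b i = (if a i \<le> 1 / 2 then a i + \<delta> else a i - \<delta>)" for i
  have \<delta>: "0 < \<delta>" "\<delta> \<le> 1 / 4" "2 * \<delta> \<le> \<delta>0" using \<delta>0 by (auto simp: \<delta>_def)
  have b: "\<delta> \<le> b i" "b i \<le> 1 - \<delta>" if "i < d" for i
  proof -
    have "0 \<le> a i" "a i \<le> 1"
      using PiE_mem[OF a[unfolded cube_def], of i] that by simp_all
    then show "\<delta> \<le> b i" "b i \<le> 1 - \<delta>" using \<delta> by (auto simp: b_def)
  qed
  \<comment> \<open>Rotating by \<open>\<omega>\<close> makes the value at \<open>a\<close> real and nonnegative.\<close>
  define \<omega> where "\<omega> = cnj (sgn (u a))"
  have \<omega>1: "cmod \<omega> \<le> 1" by (simp add: \<omega>_def norm_sgn)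
  have \<omega>: "\<omega> * u a = complex_of_real (cmod (u a))"
  proof (cases "u a = 0")
    case False
    have "\<omega> * u a = (u a * cnj (u a)) / complex_of_real (cmod (u a))"
      by (simp add: \<omega>_def sgn_eq mult.commute)
    also have "\<dots> = complex_of_real (cmod (u a))"
      using False unfolding complex_norm_square[symmetric] by (simp add: power2_eq_square)
    finally show ?thesis .
  qed (simp add: \<omega>_def)
  have near_b: "T' \<le> Re (\<omega> * u x)" if x: "x \<in> cube d" "\<And>i. i < d \<Longrightarrow> \<bar>x i - b i\<bar> < \<delta>" for x
  proof -
    have "\<bar>x i - a i\<bar> < \<delta>0" if "i < d" for i
    proof -
      have "\<bar>b i - a i\<bar> \<le> \<delta>" using \<delta> by (simp add: b_def)
      then show ?thesis using x(2)[OF that] \<delta> by linarith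
    qed
    then have "cmod (u x - u a) < e" using x(1) by (intro near_a)
    moreover have "cmod (\<omega> * (u x - u a)) \<le> 1 * cmod (u x - u a)"
      unfolding norm_mult using \<omega>1 by (intro mult_right_mono) auto
    moreover have "Re (\<omega> * u x) = cmod (u a) + Re (\<omega> * (u x - u a))"
      using \<omega> by (simp add: right_diff_distrib)
    ultimately show ?thesis
      using abs_Re_le_cmod[of "\<omega> * (u x - u a)"] ua by linarith
  qed
  obtain B where B: "\<And>x. x \<in> cube d \<Longrightarrow> cmod (u x) \<le> B"
    using continuous_on_cube_bounded[OF cont] by blast
  have B0: "0 \<le> B" using B[OF a] norm_ge_zero order_trans by blast
  note u_meas = continuous_on_cube_measurable[OF cont]
  define \<rho> where "\<rho> = (1 + cos (2 * pi * \<delta>)) / 2"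
  have \<rho>: "0 \<le> \<rho>" "\<rho> < 1"
  proof -
    have "cos (2 * pi * \<delta>) < cos 0"
      using \<delta> by (intro cos_monotone_0_pi) auto
    then show "\<rho> < 1" by (simp add: \<rho>_def)
    show "0 \<le> \<rho>" unfolding \<rho>_def by (rule half_one_plus_cos_range)
  qed
  interpret prob_space "cube_measure d" by (rule prob_space_cube_measure)
  have bound: "e \<le> (T' + B) * (\<rho> ^ n * (2 * real n) ^ d)" if n: "0 < n" for n
  proof -
    define P where "P = cosine_kernel d n b"
    define \<beta> where "\<beta> = real (2 * n choose n) / 4 ^ n"
    have P01: "0 \<le> P x" "P x \<le> 1" for x
      unfolding P_def by (rule cosine_kernel_range)+
    have P_meas [measurable]: "P \<in> borel_measurable (cube_measure d)"
      unfolding P_def by (rule cosine_kernel_measurable)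
    have P_int: "integrable (cube_measure d) P"
      using P01 by (intro integrable_bounded_on_cube[where B = 1]) auto
    have uP_int: "integrable (cube_measure d) (\<lambda>x. u x * complex_of_real (P x))"
    proof (rule integrable_bounded_on_cube)
      show "(\<lambda>x. u x * complex_of_real (P x)) \<in> borel_measurable (cube_measure d)"
        using u_meas by measurable
      show "cmod (u x * complex_of_real (P x)) \<le> B * 1" if "x \<in> cube d" for x
        unfolding norm_mult using B[OF that] P01[of x] B0 by (intro mult_mono) auto
    qed
    have pointwise: "T' * P x - (T' + B) * \<rho> ^ n \<le> Re (\<omega> * (u x * complex_of_real (P x)))"
      if x: "x \<in> cube d" for x
    proof -
      have Re_eq: "Re (\<omega> * (u x * complex_of_real (P x))) = Re (\<omega> * u x) * P x"
      proof -
        have "Re (z * complex_of_real y) = Re z * y" for z y by simp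
        then show ?thesis by (simp only: mult.assoc[symmetric])
      qed
      show ?thesis
      proof (cases "\<forall>i<d. \<bar>x i - b i\<bar> < \<delta>")
        case True
        then have "T' * P x \<le> Re (\<omega> * u x) * P x"
          using near_b[OF x] P01 by (intro mult_right_mono) auto
        moreover have "0 \<le> (T' + B) * \<rho> ^ n"
          using T0 e B0 \<rho> by (simp add: T'_def)
        ultimately show ?thesis unfolding Re_eq by linarith
      next
        case False
        then have P_le: "P x \<le> \<rho> ^ n"
          unfolding P_def \<rho>_def using x b \<delta> by (auto intro: cosine_kernel_small_off_diagonal)
        have "\<bar>Re (\<omega> * u x)\<bar> \<le> cmod \<omega> * cmod (u x)"
          using abs_Re_le_cmod[of "\<omega> * u x"] by (simp only: norm_mult)
        also have "\<dots> \<le> 1 * B" using \<omega>1 B[OF x] by (intro mult_mono) auto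
        finally have "- B \<le> Re (\<omega> * u x)" by simp
        then have "- B * P x \<le> Re (\<omega> * u x) * P x"
          using P01 by (intro mult_right_mono) auto
        moreover have "(T' + B) * P x \<le> (T' + B) * \<rho> ^ n"
          using P_le T0 e B0 by (intro mult_left_mono) (auto simp: T'_def)
        ultimately show ?thesis unfolding Re_eq by (simp add: algebra_simps)
      qed
    qed
    have "T' * \<beta> ^ d - (T' + B) * \<rho> ^ n = expectation (\<lambda>x. T' * P x - (T' + B) * \<rho> ^ n)"
      using P_int integral_cosine_kernel[of d n b] by (simp add: prob_space P_def \<beta>_def)
    also have "\<dots> \<le> expectation (\<lambda>x. Re (\<omega> * (u x * complex_of_real (P x))))"
      using pointwise P_int uP_int by (intro integral_mono) (auto simp: space_cube_measure simp del: times_complex.sel)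
    also have "\<dots> = Re (\<omega> * expectation (\<lambda>x. u x * complex_of_real (P x)))"
      using uP_int by (simp del: times_complex.sel)
    also have "\<dots> \<le> cmod (\<omega> * expectation (\<lambda>x. u x * complex_of_real (P x)))"
      by (rule complex_Re_le_cmod)
    also have "\<dots> \<le> 1 * cmod (expectation (\<lambda>x. u x * complex_of_real (P x)))"
      unfolding norm_mult using \<omega>1 by (intro mult_right_mono) auto
    also have "\<dots> \<le> T * \<beta> ^ d"
    proof -
      let ?S = "{..<d} \<rightarrow>\<^sub>E {..2 * n}"
      have "expectation (\<lambda>x. u x * complex_of_real (P x)) =
        (\<Sum>K\<in>?S. complex_of_real (\<Prod>i<d. real (2 * n choose K i) / 4 ^ n) *
          character d (shifted_frequency d n K) b * fourier_coeff d u (shifted_frequency d n K))"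
        unfolding P_def by (rule integral_times_cosine_kernel[OF u_meas B])
      then have "cmod (expectation (\<lambda>x. u x * complex_of_real (P x))) \<le>
        (\<Sum>K\<in>?S. \<bar>\<Prod>i<d. real (2 * n choose K i) / 4 ^ n\<bar> * cmod (fourier_coeff d u (shifted_frequency d n K)))"
        by (auto simp only: norm_mult norm_of_real norm_character mult_1_right intro!: order_trans[OF norm_sum])
      also have "\<dots> \<le> (\<Sum>K\<in>?S. \<beta> ^ d * cmod (fourier_coeff d u (shifted_frequency d n K)))"
      proof (intro sum_mono mult_right_mono)
        fix K
        have "(\<Prod>i<d. real (2 * n choose K i) / 4 ^ n) \<le> (\<Prod>i<d. \<beta>)"
          unfolding \<beta>_def using binomial_maximum'
          by (intro prod_mono) (auto intro!: divide_right_mono)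
        moreover have "0 \<le> (\<Prod>i<d. real (2 * n choose K i) / 4 ^ n)"
          by (intro prod_nonneg) auto
        ultimately show "\<bar>\<Prod>i<d. real (2 * n choose K i) / 4 ^ n\<bar> \<le> \<beta> ^ d" by simp
      qed auto
      also have "\<dots> = \<beta> ^ d * (\<Sum>k\<in>shifted_frequency d n ` ?S. cmod (fourier_coeff d u k))"
        by (simp add: sum_distrib_left sum.reindex[OF inj_shifted_frequency])
      also have "\<dots> \<le> \<beta> ^ d * T"
        by (intro mult_left_mono T) (auto simp: \<beta>_def shifted_frequency_def finite_PiE)
      finally show ?thesis by (simp add: mult.commute)
    qed
    finally have "e * \<beta> ^ d \<le> (T' + B) * \<rho> ^ n"
      unfolding T'_def by (simp add: algebra_simps)
    moreover have "1 / (2 * real n) ^ d \<le> \<beta> ^ d"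
    proof -
      have "1 / (2 * real n) \<le> \<beta>"
        unfolding \<beta>_def using central_binomial_lower_bound[OF n] n by (simp add: field_simps)
      then have "(1 / (2 * real n)) ^ d \<le> \<beta> ^ d" by (intro power_mono) auto
      then show ?thesis by (simp add: power_one_over)
    qed
    ultimately have "e * (1 / (2 * real n) ^ d) \<le> (T' + B) * \<rho> ^ n"
      using e by (meson less_imp_le mult_left_mono order_trans)
    then show ?thesis using n by (simp add: field_simps)
  qed
  have "(\<lambda>n. (T' + B) * (\<rho> ^ n * (2 * real n) ^ d)) \<longlonglongrightarrow> (T' + B) * 0"
    by (intro tendsto_mult_left power_times_geometric_tendsto_0 \<rho> d)
  then have "e \<le> (T' + B) * 0"
    by (rule tendsto_lowerbound) (use bound in \<open>auto intro!: eventually_sequentiallyI[of 1]\<close>)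
  then show False using e by simp
qed

section \<open>Fourier tails under mixed smoothness\<close>

lemma continuous_on_character: "continuous_on A (character d k)"
  unfolding character_def[abs_def]
  by (intro continuous_intros continuous_on_subset[OF continuous_on_product_coordinates]) auto

lemma fourier_coeff_character:
  assumes "k \<in> {..<d} \<rightarrow>\<^sub>E UNIV" "l \<in> {..<d} \<rightarrow>\<^sub>E UNIV"
  shows "fourier_coeff d (character d k) l = (if k = l then 1 else 0)"
proof -
  have "(\<forall>i<d. k i + - l i = 0) \<longleftrightarrow> k = l"
    using PiE_ext[OF assms] by auto
  then show ?thesis
    unfolding fourier_coeff_eq cnj_character character_mult integral_character by simp
qed

lemma fourier_coeff_minus_partial_sum:
  assumes f: "continuous_on (cube d) f" and J: "finite J" "J \<subseteq> {..<d} \<rightarrow>\<^sub>E UNIV"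
    and l: "l \<in> {..<d} \<rightarrow>\<^sub>E UNIV"
  shows "fourier_coeff d (\<lambda>x. f x - (\<Sum>k\<in>J. c k * character d k x)) l =
    fourier_coeff d f l - (if l \<in> J then c l else 0)"
proof -
  obtain B where B: "\<And>x. x \<in> cube d \<Longrightarrow> cmod (f x) \<le> B"
    using continuous_on_cube_bounded[OF f] by blast
  have int_f: "integrable (cube_measure d) (\<lambda>x. f x * cnj (character d l x))"
    by (rule integrable_times_cnj_character[OF continuous_on_cube_measurable[OF f] B])
  have int_e: "integrable (cube_measure d) (\<lambda>x. character d k x * cnj (character d l x))" for k
    by (rule integrable_times_cnj_character[OF character_measurable, where B = 1]) simp
  have "fourier_coeff d (\<lambda>x. f x - (\<Sum>k\<in>J. c k * character d k x)) l =
    (LINT x|cube_measure d. f x * cnj (character d l x) -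
      (\<Sum>k\<in>J. c k * (character d k x * cnj (character d l x))))"
    unfolding fourier_coeff_eq by (simp add: left_diff_distrib sum_distrib_right mult.assoc)
  also have "\<dots> = fourier_coeff d f l - (\<Sum>k\<in>J. c k * fourier_coeff d (character d k) l)"
    unfolding fourier_coeff_eq using int_f int_e by (simp add: Bochner_Integration.integral_sum)
  also have "(\<Sum>k\<in>J. c k * fourier_coeff d (character d k) l) = (\<Sum>k\<in>J. if k = l then c k else 0)"
    using J l by (intro sum.cong) (auto simp: fourier_coeff_character)
  also have "\<dots> = (if l \<in> J then c l else 0)"
    using J by simp
  finally show ?thesis .
qed

lemma norm_minus_fourier_partial_sum_le:
  assumes d: "0 < d" and f: "continuous_on (cube d) f"
    and J: "finite J" "J \<subseteq> {..<d} \<rightarrow>\<^sub>E UNIV"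
    and T: "\<And>S. finite S \<Longrightarrow> S \<subseteq> ({..<d} \<rightarrow>\<^sub>E UNIV) - J \<Longrightarrow> (\<Sum>k\<in>S. cmod (fourier_coeff d f k)) \<le> T"
    and a: "a \<in> cube d"
  shows "cmod (f a - (\<Sum>k\<in>J. fourier_coeff d f k * character d k a)) \<le> T"
proof -
  define u where "u x = f x - (\<Sum>k\<in>J. fourier_coeff d f k * character d k x)" for x
  have "cmod (u a) \<le> T"
  proof (rule continuous_le_wiener_norm[OF d _ _ a])
    show "continuous_on (cube d) u"
      unfolding u_def by (intro continuous_intros f continuous_on_character)
    fix S :: "(nat \<Rightarrow> int) set" assume S: "finite S" "S \<subseteq> {..<d} \<rightarrow>\<^sub>E UNIV"
    have coeff: "fourier_coeff d u k = (if k \<in> J then 0 else fourier_coeff d f k)" if "k \<in> S" for k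
      using fourier_coeff_minus_partial_sum[OF f J, of k] that S unfolding u_def by auto
    have "(\<Sum>k\<in>S. cmod (fourier_coeff d u k)) = (\<Sum>k\<in>S - J. cmod (fourier_coeff d f k))"
      using S(1) by (intro sum.mono_neutral_cong_right) (auto simp: coeff)
    also have "\<dots> \<le> T"
      using S by (intro T) auto
    finally show "(\<Sum>k\<in>S. cmod (fourier_coeff d u k)) \<le> T" .
  qed
  then show ?thesis unfolding u_def .
qed

definition frequency_box :: "nat \<Rightarrow> nat \<Rightarrow> (nat \<Rightarrow> int) set" where
  "frequency_box d M = {..<d} \<rightarrow>\<^sub>E {- int M..int M}"

lemma finite_frequency_box: "finite (frequency_box d M)"
  by (simp add: frequency_box_def finite_PiE)

lemma card_frequency_box: "card (frequency_box d M) = (2 * M + 1) ^ d"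
proof -
  have "nat (1 + 2 * int M) = 2 * M + 1" by simp
  then show ?thesis by (simp add: frequency_box_def card_PiE nat_add_distrib)
qed

lemma sum_symmetric_powers_bounded:
  fixes q :: real
  assumes "1 < q"
  obtains Z where "1 \<le> Z" "\<And>R. (\<Sum>j\<in>{- int R..int R}. max 1 (real_of_int \<bar>j\<bar>) powr (- q)) \<le> Z"
proof -
  define g where "g j = max 1 (real_of_int \<bar>j\<bar>) powr (- q)" for j :: int
  have summ: "summable (\<lambda>j. real (Suc j) powr (- q))"
    using assms by (subst summable_Suc_iff[of "\<lambda>j. real j powr (- q)"]) (simp add: summable_real_powr_iff)
  have eq: "(\<Sum>j\<in>{- int R..int R}. g j) = 1 + 2 * (\<Sum>j<R. real (Suc j) powr (- q))" for R
  proof (induction R)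
    case 0
    show ?case by (simp add: g_def)
  next
    case (Suc R)
    have "{- int (Suc R)..int (Suc R)} = insert (int (Suc R)) (insert (- int (Suc R)) {- int R..int R})"
      by auto
    then have "(\<Sum>j\<in>{- int (Suc R)..int (Suc R)}. g j) =
      g (int (Suc R)) + (g (- int (Suc R)) + (\<Sum>j\<in>{- int R..int R}. g j))"
      by simp
    moreover have "g (int (Suc R)) = real (Suc R) powr (- q)" "g (- int (Suc R)) = real (Suc R) powr (- q)"
      by (simp_all add: g_def max_def add.commute)
    ultimately show ?case using Suc.IH by simp
  qed
  define Z where "Z = 1 + 2 * (\<Sum>j. real (Suc j) powr (- q))"
  show ?thesis
  proof
    show "1 \<le> Z" unfolding Z_def using summ by (simp add: suminf_nonneg)
    show "(\<Sum>j\<in>{- int R..int R}. max 1 (real_of_int \<bar>j\<bar>) powr (- q)) \<le> Z" for R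
      using eq[of R] sum_le_suminf[OF summ, of "{..<R}"] unfolding g_def Z_def by simp
  qed
qed

lemma sum_product_weights_le:
  fixes q :: real
  assumes Z: "\<And>R. (\<Sum>j\<in>{- int R..int R}. max 1 (real_of_int \<bar>j\<bar>) powr (- q)) \<le> Z"
    and S: "finite S" "S \<subseteq> {..<d} \<rightarrow>\<^sub>E UNIV"
  shows "(\<Sum>k\<in>S. \<Prod>i<d. max 1 (real_of_int \<bar>k i\<bar>) powr (- q)) \<le> Z ^ d"
proof -
  define R where "R = Max (insert 0 ((\<lambda>(k, i). nat \<bar>k i\<bar>) ` (S \<times> {..<d})))"
  have "S \<subseteq> frequency_box d R"
  proof
    fix k assume k: "k \<in> S"
    have "k i \<in> {- int R..int R}" if "i < d" for i
    proof -
      have "nat \<bar>k i\<bar> \<le> R"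
        unfolding R_def using S(1) k that by (intro Max_ge) force+
      then show ?thesis by auto
    qed
    then show "k \<in> frequency_box d R"
      using S(2) k by (auto simp: frequency_box_def PiE_def)
  qed
  then have "(\<Sum>k\<in>S. \<Prod>i<d. max 1 (real_of_int \<bar>k i\<bar>) powr (- q))
    \<le> (\<Sum>k\<in>frequency_box d R. \<Prod>i<d. max 1 (real_of_int \<bar>k i\<bar>) powr (- q))"
    by (intro sum_mono2 finite_frequency_box) (auto intro!: prod_nonneg)
  also have "\<dots> = (\<Prod>i<d. \<Sum>j\<in>{- int R..int R}. max 1 (real_of_int \<bar>j\<bar>) powr (- q))"
    unfolding frequency_box_def by (rule prod_sum_PiE[symmetric]) auto
  also have "\<dots> \<le> (\<Prod>i<d. Z)"
    using Z by (intro prod_mono) (auto intro!: sum_nonneg)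
  finally show ?thesis by simp
qed

lemma max_powr: "0 \<le> a \<Longrightarrow> 0 \<le> q \<Longrightarrow> max 1 (a powr q) = max 1 a powr (q::real)"
  by (cases "a \<ge> 1") (auto simp: max_def ge_one_powr_ge_zero powr_le1 intro: antisym)

text \<open>
  A frequency outside the box has a coordinate of modulus greater than \<open>M\<close>.  Half of the surplus of the
  exponent \<open>2s\<close> over \<open>1\<close> yields the factor \<open>M powr - (s - 1/2)\<close>; the remaining exponent \<open>s + 1/2 > 1\<close>
  keeps the sum over all frequencies finite.
\<close>

lemma H_mix_tail_le:
  assumes s: "1 / 2 < s" and f: "f \<in> H_mix s d" and M: "1 \<le> M"
    and Z: "\<And>R. (\<Sum>j\<in>{- int R..int R}. max 1 (real_of_int \<bar>j\<bar>) powr (- (s + 1 / 2))) \<le> Z"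
    and S: "finite S" "S \<subseteq> ({..<d} \<rightarrow>\<^sub>E UNIV) - frequency_box d M"
  shows "(\<Sum>k\<in>S. cmod (fourier_coeff d f k)) \<le> sqrt (Z ^ d * real M powr (- (s - 1 / 2)))"
proof -
  define \<mu> where "\<mu> k = (\<Prod>i<d. max 1 (real_of_int \<bar>k i\<bar> powr (2 * s)))" for k :: "nat \<Rightarrow> int"
  define c where "c k = cmod (fourier_coeff d f k)" for k
  have \<mu>_pos: "0 < \<mu> k" for k unfolding \<mu>_def by (intro prod_pos) auto
  have \<mu>_nonneg: "0 \<le> \<mu> k" for k using \<mu>_pos[of k] by simp
  have f': "(\<lambda>k. (c k)\<^sup>2 * \<mu> k) summable_on ({..<d} \<rightarrow>\<^sub>E UNIV)"
    "infsum (\<lambda>k. (c k)\<^sup>2 * \<mu> k) ({..<d} \<rightarrow>\<^sub>E UNIV) \<le> 1"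
    using f unfolding H_mix_def Let_def c_def \<mu>_def by auto
  have "(\<Sum>k\<in>S. (c k)\<^sup>2 * \<mu> k) \<le> infsum (\<lambda>k. (c k)\<^sup>2 * \<mu> k) ({..<d} \<rightarrow>\<^sub>E UNIV)"
    using S f'(1) \<mu>_nonneg by (intro finite_sum_le_infsum) auto
  then have sum1: "(\<Sum>k\<in>S. (c k)\<^sup>2 * \<mu> k) \<le> 1" using f'(2) by linarith
  have inv_\<mu>: "1 / \<mu> k \<le> (\<Prod>i<d. max 1 (real_of_int \<bar>k i\<bar>) powr (- (s + 1 / 2))) * real M powr (- (s - 1 / 2))"
    if k: "k \<in> S" for k
  proof -
    define m where "m i = max 1 (real_of_int \<bar>k i\<bar>)" for i
    have m1: "1 \<le> m i" for i by (simp add: m_def)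
    obtain i0 where i0: "i0 < d" "k i0 \<notin> {- int M..int M}"
    proof -
      have "k \<in> {..<d} \<rightarrow>\<^sub>E UNIV" "k \<notin> frequency_box d M" using k S(2) by auto
      then have "\<exists>i0<d. k i0 \<notin> {- int M..int M}"
        unfolding frequency_box_def PiE_def Pi_def by blast
      then show ?thesis using that by blast
    qed
    have "real M \<le> m i0" using i0(2) by (auto simp: m_def)
    have "1 / \<mu> k = (\<Prod>i<d. 1 / max 1 (real_of_int \<bar>k i\<bar> powr (2 * s)))"
      by (simp add: \<mu>_def prod_dividef)
    also have "\<dots> = (\<Prod>i<d. m i powr (- (2 * s)))"
      unfolding m_def using s by (intro prod.cong refl) (simp add: max_powr powr_minus_divide)
    also have "\<dots> = (\<Prod>i<d. m i powr (- (s + 1 / 2))) * (\<Prod>i<d. m i powr (- (s - 1 / 2)))"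
      by (simp add: prod.distrib[symmetric] powr_add[symmetric])
    also have "(\<Prod>i<d. m i powr (- (s - 1 / 2))) \<le> real M powr (- (s - 1 / 2))"
    proof -
      have "(\<Prod>i<d. m i powr (- (s - 1 / 2))) =
        m i0 powr (- (s - 1 / 2)) * (\<Prod>i\<in>{..<d} - {i0}. m i powr (- (s - 1 / 2)))"
        using i0 by (intro prod.remove) auto
      also have "\<dots> \<le> real M powr (- (s - 1 / 2)) * 1"
      proof (intro mult_mono prod_le_1 conjI)
        show "m i0 powr (- (s - 1 / 2)) \<le> real M powr (- (s - 1 / 2))"
          using \<open>real M \<le> m i0\<close> s M by (intro powr_mono2') auto
        show "m i powr (- (s - 1 / 2)) \<le> 1" for i
          using powr_mono2'[of "- (s - 1 / 2)" 1 "m i"] m1 s by auto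
      qed (auto intro: prod_nonneg)
      finally show ?thesis by simp
    qed
    finally show ?thesis unfolding m_def by (simp add: mult_left_mono prod_nonneg)
  qed
  have "(\<Sum>k\<in>S. 1 / \<mu> k) \<le>
    (\<Sum>k\<in>S. (\<Prod>i<d. max 1 (real_of_int \<bar>k i\<bar>) powr (- (s + 1 / 2))) * real M powr (- (s - 1 / 2)))"
    by (intro sum_mono inv_\<mu>)
  also have "\<dots> = (\<Sum>k\<in>S. \<Prod>i<d. max 1 (real_of_int \<bar>k i\<bar>) powr (- (s + 1 / 2))) * real M powr (- (s - 1 / 2))"
    by (simp add: sum_distrib_right)
  also have "\<dots> \<le> Z ^ d * real M powr (- (s - 1 / 2))"
    using S by (intro mult_right_mono sum_product_weights_le Z) auto
  finally have sum2: "(\<Sum>k\<in>S. 1 / \<mu> k) \<le> Z ^ d * real M powr (- (s - 1 / 2))" .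
  have "(\<Sum>k\<in>S. c k)\<^sup>2 = (\<Sum>k\<in>S. (c k * sqrt (\<mu> k)) * (1 / sqrt (\<mu> k)))\<^sup>2"
    using less_imp_neq[OF \<mu>_pos] by simp
  also have "\<dots> \<le> (\<Sum>k\<in>S. (c k * sqrt (\<mu> k))\<^sup>2) * (\<Sum>k\<in>S. (1 / sqrt (\<mu> k))\<^sup>2)"
    by (rule Cauchy_Schwarz_ineq_sum)
  also have "\<dots> = (\<Sum>k\<in>S. (c k)\<^sup>2 * \<mu> k) * (\<Sum>k\<in>S. 1 / \<mu> k)"
    using \<mu>_nonneg by (simp add: power_mult_distrib power_divide)
  also have "\<dots> \<le> 1 * (\<Sum>k\<in>S. 1 / \<mu> k)"
    using sum1 \<mu>_nonneg by (intro mult_right_mono sum_nonneg) auto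
  finally have "(\<Sum>k\<in>S. c k)\<^sup>2 \<le> Z ^ d * real M powr (- (s - 1 / 2))" using sum2 by linarith
  then show ?thesis unfolding c_def by (rule real_le_rsqrt)
qed

lemma F_mix_D:
  assumes "f \<in> F_mix s d"
  shows "continuous_on (cube d) f" "f \<in> H_mix s d"
    "\<And>S. finite S \<Longrightarrow> S \<subseteq> {..<d} \<rightarrow>\<^sub>E UNIV \<Longrightarrow> (\<Sum>k\<in>S. cmod (fourier_coeff d f k)) \<le> 1"
proof -
  have summ: "(\<lambda>k. cmod (fourier_coeff d f k)) summable_on ({..<d} \<rightarrow>\<^sub>E UNIV)"
    and le: "infsum (\<lambda>k. cmod (fourier_coeff d f k)) ({..<d} \<rightarrow>\<^sub>E UNIV) \<le> 1"
    using assms by (auto simp: F_mix_def Let_def)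
  show H: "f \<in> H_mix s d" using assms by (simp add: F_mix_def)
  then show "continuous_on (cube d) f" by (simp add: H_mix_def)
  fix S :: "(nat \<Rightarrow> int) set" assume S: "finite S" "S \<subseteq> {..<d} \<rightarrow>\<^sub>E UNIV"
  have "(\<Sum>k\<in>S. cmod (fourier_coeff d f k)) \<le> infsum (\<lambda>k. cmod (fourier_coeff d f k)) ({..<d} \<rightarrow>\<^sub>E UNIV)"
    by (rule finite_sum_le_infsum[OF summ S]) auto
  then show "(\<Sum>k\<in>S. cmod (fourier_coeff d f k)) \<le> 1" using le by linarith
qed

lemma F_mix_bounded:
  assumes "0 < d" "f \<in> F_mix s d" "a \<in> cube d"
  shows "cmod (f a) \<le> 1"
  using assms F_mix_D[OF assms(2)] by (intro continuous_le_wiener_norm[where d = d]) auto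

section \<open>From sampling points to recovery\<close>

lemma F_mix_difference_measurable:
  assumes "f \<in> F_mix s d" "g \<in> F_mix s d"
  shows "(\<lambda>t. f t - g t) \<in> borel_measurable (cube_measure d)"
  using assms[THEN F_mix_D(1), THEN continuous_on_cube_measurable] by measurable

text \<open>
  The difference of two members of the class is within twice the Fourier tail of a trigonometric
  polynomial with coefficient sum at most \<open>2\<close>, so \<open>exists_points_Lp_small\<close> applies to it.
\<close>

lemma exists_sampling_points:
  fixes s P \<epsilon> Z :: real and d n L M :: nat
  assumes s: "1 / 2 < s" and d: "0 < d" and P: "2 \<le> P" and \<epsilon>: "0 < \<epsilon>"
    and L: "1 \<le> L" "18 * (1 / 2) ^ L \<le> \<epsilon>" and n: "1 \<le> n" and M: "1 \<le> M"
    and Z: "\<And>R. (\<Sum>j\<in>{- int R..int R}. max 1 (real_of_int \<bar>j\<bar>) powr (- (s + 1 / 2))) \<le> Z"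
    and tail: "2 * sqrt (Z ^ d * real M powr (- (s - 1 / 2))) \<le> (1 / 2) ^ L"
    and large: "(1024 * ln (8 * real n * (real n + 1)) + 1) * ln (4 * (2 * real M + 1) ^ d + 1) + ln (2 * real L)
      \<le> real n * \<epsilon> powr P / (8 * 9 powr P * real L)"
  shows "\<exists>x. (\<forall>j<n. x j \<in> cube d) \<and> (\<forall>f\<in>F_mix s d. \<forall>g\<in>F_mix s d. (\<forall>j<n. f (x j) = g (x j)) \<longrightarrow>
     (LINT t|cube_measure d. cmod (f t - g t) powr P) \<le> \<epsilon> powr P)"
proof -
  interpret prob_space "cube_measure d" by (rule prob_space_cube_measure)
  define J where "J = frequency_box d M"
  have J: "finite J" "J \<subseteq> {..<d} \<rightarrow>\<^sub>E UNIV" "real (card J) = (2 * real M + 1) ^ d"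
    by (auto simp: J_def finite_frequency_box card_frequency_box add.commute)
       (auto simp: frequency_box_def)
  have "\<exists>x. (\<forall>j<n. x j \<in> space (cube_measure d)) \<and>
    (\<forall>c h. h \<in> borel_measurable (cube_measure d) \<longrightarrow> (\<Sum>k\<in>J. cmod (c k)) \<le> 2 \<longrightarrow>
       (\<forall>u\<in>space (cube_measure d). cmod (h u - (\<Sum>k\<in>J. c k * character d k u)) \<le> (1 / 2) ^ L) \<longrightarrow>
       (\<forall>j<n. h (x j) = 0) \<longrightarrow>
       expectation (\<lambda>u. cmod (h u) powr P) \<le> \<epsilon> powr P)"
    using large unfolding J(3)[symmetric]
    by (intro exists_points_Lp_small J(1) character_measurable P \<epsilon> L n) auto
  then obtain x where "(\<forall>j<n. x j \<in> space (cube_measure d)) \<and>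
    (\<forall>c h. h \<in> borel_measurable (cube_measure d) \<longrightarrow> (\<Sum>k\<in>J. cmod (c k)) \<le> 2 \<longrightarrow>
       (\<forall>u\<in>space (cube_measure d). cmod (h u - (\<Sum>k\<in>J. c k * character d k u)) \<le> (1 / 2) ^ L) \<longrightarrow>
       (\<forall>j<n. h (x j) = 0) \<longrightarrow>
       expectation (\<lambda>u. cmod (h u) powr P) \<le> \<epsilon> powr P)" ..
  then have x: "\<forall>j<n. x j \<in> cube d"
    and small: "\<And>c h. h \<in> borel_measurable (cube_measure d) \<Longrightarrow> (\<Sum>k\<in>J. cmod (c k)) \<le> 2 \<Longrightarrow>
       \<forall>u\<in>cube d. cmod (h u - (\<Sum>k\<in>J. c k * character d k u)) \<le> (1 / 2) ^ L \<Longrightarrow>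
       \<forall>j<n. h (x j) = 0 \<Longrightarrow> expectation (\<lambda>u. cmod (h u) powr P) \<le> \<epsilon> powr P"
    by (simp_all add: space_cube_measure)
  have "(LINT t|cube_measure d. cmod (f t - g t) powr P) \<le> \<epsilon> powr P"
    if f: "f \<in> F_mix s d" and g: "g \<in> F_mix s d" and eq: "\<forall>j<n. f (x j) = g (x j)" for f g
  proof (rule small)
    define c where "c k = fourier_coeff d f k - fourier_coeff d g k" for k
    have "(\<Sum>k\<in>J. cmod (c k)) \<le> (\<Sum>k\<in>J. cmod (fourier_coeff d f k)) + (\<Sum>k\<in>J. cmod (fourier_coeff d g k))"
      unfolding c_def sum.distrib[symmetric] by (intro sum_mono norm_triangle_ineq4)
    also have "\<dots> \<le> 1 + 1"
      using F_mix_D(3)[OF f J(1,2)] F_mix_D(3)[OF g J(1,2)] by linarith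
    finally show "(\<Sum>k\<in>J. cmod (c k)) \<le> 2" by simp
    show "\<forall>u\<in>cube d. cmod (f u - g u - (\<Sum>k\<in>J. c k * character d k u)) \<le> (1 / 2) ^ L"
    proof
      fix u assume u: "u \<in> cube d"
      define T where "T = sqrt (Z ^ d * real M powr (- (s - 1 / 2)))"
      have approx: "cmod (h u - (\<Sum>k\<in>J. fourier_coeff d h k * character d k u)) \<le> T" if h: "h \<in> F_mix s d" for h
        unfolding T_def J_def
        using H_mix_tail_le[OF s F_mix_D(2)[OF h] M Z] u J(1,2)
        by (intro norm_minus_fourier_partial_sum_le d F_mix_D(1)[OF h]) (auto simp: J_def)
      have "f u - g u - (\<Sum>k\<in>J. c k * character d k u) =
        (f u - (\<Sum>k\<in>J. fourier_coeff d f k * character d k u)) -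
        (g u - (\<Sum>k\<in>J. fourier_coeff d g k * character d k u))" (is "_ = ?A - ?B")
        by (simp add: c_def left_diff_distrib sum_subtractf)
      then have "cmod (f u - g u - (\<Sum>k\<in>J. c k * character d k u)) = cmod (?A - ?B)"
        by (rule arg_cong)
      also have "\<dots> \<le> cmod ?A + cmod ?B" by (rule norm_triangle_ineq4)
      also have "\<dots> \<le> T + T" by (intro add_mono approx f g)
      finally have "cmod (f u - g u - (\<Sum>k\<in>J. c k * character d k u)) \<le> T + T" .
      then show "cmod (f u - g u - (\<Sum>k\<in>J. c k * character d k u)) \<le> (1 / 2) ^ L"
        using tail unfolding T_def by linarith
    qed
  qed (use F_mix_difference_measurable[OF f g] eq in auto)
  with x show ?thesis
    by (intro exI[of _ x] conjI ballI impI) simp_all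
qed

lemma F_mix_subset_Lp_space:
  assumes d: "0 < d" and p: "0 \<le> p" and f: "f \<in> F_mix s d"
  shows "f \<in> Lp_space p d"
proof -
  have [measurable]: "f \<in> borel_measurable (cube_measure d)"
    by (rule continuous_on_cube_measurable[OF F_mix_D(1)[OF f]])
  have "integrable (cube_measure d) (\<lambda>x. cmod (f x) powr p)"
    using F_mix_bounded[OF d f] p
    by (intro integrable_bounded_on_cube[where B = "1 powr p"]) (auto intro!: powr_mono2 simp del: powr_one_eq_one)
  then show ?thesis unfolding Lp_space_def by simp
qed

lemma integrable_F_mix_difference_powr:
  assumes d: "0 < d" and p: "0 \<le> p" and f: "f \<in> F_mix s d" "g \<in> F_mix s d"
  shows "integrable (cube_measure d) (\<lambda>x. cmod (f x - g x) powr p)"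
proof (rule integrable_bounded_on_cube[where B = "2 powr p"])
  show "(\<lambda>x. cmod (f x - g x) powr p) \<in> borel_measurable (cube_measure d)"
    using F_mix_difference_measurable[OF f] by measurable
  show "norm (cmod (f x - g x) powr p) \<le> 2 powr p" if "x \<in> cube d" for x
    using F_mix_bounded[OF d f(1) that] F_mix_bounded[OF d f(2) that]
      norm_triangle_ineq4[of "f x" "g x"] p by (auto intro!: powr_mono2)
qed

lemma Lp_norm_leI:
  assumes "0 < p" "0 \<le> \<delta>" "h \<in> borel_measurable (cube_measure d)"
    and "integrable (cube_measure d) (\<lambda>x. cmod (h x) powr p)"
    and "(LINT x|cube_measure d. cmod (h x) powr p) \<le> \<delta> powr p"
  shows "Lp_norm p d h \<le> ereal \<delta>"
proof -
  have "(LINT x|cube_measure d. cmod (h x) powr p) powr (1 / p) \<le> (\<delta> powr p) powr (1 / p)"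
    using assms by (intro powr_mono2) (auto intro: Bochner_Integration.integral_nonneg)
  also have "\<dots> = \<delta>" using assms by (simp add: powr_powr)
  finally show ?thesis using assms by (simp add: Lp_norm_def Lp_space_def)
qed

text \<open>
  The member \<open>\<phi> (info f)\<close> that is returned has the same data as \<open>f\<close>, so the assumption on pairs of
  members applies to it and \<open>f\<close>.
\<close>

lemma recoverable_F_mixI:
  assumes d: "0 < d" and p: "0 < p" and \<delta>: "0 \<le> \<delta>" and x: "\<forall>j<n. x j \<in> cube d"
    and close: "\<And>f g. f \<in> F_mix s d \<Longrightarrow> g \<in> F_mix s d \<Longrightarrow> \<forall>j<n. f (x j) = g (x j) \<Longrightarrow>
      (LINT t|cube_measure d. cmod (f t - g t) powr p) \<le> \<delta> powr p"
  shows "recoverable n \<delta> d (F_mix s d) p"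
proof -
  define info where "info f = (\<lambda>j\<in>{..<n}. f (x j))" for f :: "(nat \<Rightarrow> real) \<Rightarrow> complex"
  define \<phi> where "\<phi> y = (if \<exists>f\<in>F_mix s d. info f = y then SOME f. f \<in> F_mix s d \<and> info f = y else (\<lambda>_. 0))" for y
  have \<phi>: "\<phi> (info f) \<in> F_mix s d \<and> info (\<phi> (info f)) = info f" if "f \<in> F_mix s d" for f
  proof -
    have "\<phi> (info f) = (SOME g. g \<in> F_mix s d \<and> info g = info f)"
      unfolding \<phi>_def using that by auto
    then show ?thesis
      using someI[of "\<lambda>g. g \<in> F_mix s d \<and> info g = info f" f] that by simp
  qed
  have zero: "(\<lambda>_. 0) \<in> Lp_space p d" by (simp add: Lp_space_def)
  have "\<phi> y \<in> Lp_space p d" for y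
  proof (cases "\<exists>f\<in>F_mix s d. info f = y")
    case True
    then obtain f where "f \<in> F_mix s d" "y = info f" by blast
    then show ?thesis using \<phi>[of f] p by (auto intro: F_mix_subset_Lp_space[OF d])
  qed (simp add: \<phi>_def zero)
  moreover have "Lp_norm p d (\<lambda>t. f t - \<phi> (info f) t) \<le> ereal \<delta>" if f: "f \<in> F_mix s d" for f
  proof (rule Lp_norm_leI[OF p \<delta>])
    have g: "\<phi> (info f) \<in> F_mix s d" using \<phi>[OF f] by simp
    have "info (\<phi> (info f)) = info f" using \<phi>[OF f] by simp
    then have "\<forall>j<n. f (x j) = \<phi> (info f) (x j)"
      by (metis info_def lessThan_iff restrict_apply')
    then show "(LINT t|cube_measure d. cmod (f t - \<phi> (info f) t) powr p) \<le> \<delta> powr p"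
      by (rule close[OF f g])
    show "(\<lambda>t. f t - \<phi> (info f) t) \<in> borel_measurable (cube_measure d)"
      by (rule F_mix_difference_measurable[OF f g])
    show "integrable (cube_measure d) (\<lambda>t. cmod (f t - \<phi> (info f) t) powr p)"
      using p by (intro integrable_F_mix_difference_powr[OF d _ f g]) simp
  qed
  ultimately show ?thesis
    unfolding recoverable_def using x unfolding info_def
    by (intro bexI[of _ x] bexI[of _ \<phi>] SUP_least) auto
qed

text \<open>
  Where the difference is below \<open>\<epsilon>\<close>, its power is at most \<open>\<epsilon> powr p\<close>; elsewhere the power with the higher
  exponent \<open>P\<close> dominates after scaling.
\<close>

lemma F_mix_difference_lower_exponent:
  assumes d: "0 < d" and p: "1 \<le> p" "p \<le> P" and \<epsilon>: "0 < \<epsilon>" and f: "f \<in> F_mix s d" "g \<in> F_mix s d"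
    and le: "(LINT t|cube_measure d. cmod (f t - g t) powr P) \<le> \<epsilon> powr P"
  shows "(LINT t|cube_measure d. cmod (f t - g t) powr p) \<le> (2 * \<epsilon>) powr p"
proof -
  interpret prob_space "cube_measure d" by (rule prob_space_cube_measure)
  have int: "integrable (cube_measure d) (\<lambda>t. cmod (f t - g t) powr q)" if "0 \<le> q" for q
    by (rule integrable_F_mix_difference_powr[OF d that f])
  have "(LINT t|cube_measure d. cmod (f t - g t) powr p) \<le>
    (LINT t|cube_measure d. \<epsilon> powr p + \<epsilon> powr (p - P) * cmod (f t - g t) powr P)"
  proof (intro integral_mono)
    fix t
    show "cmod (f t - g t) powr p \<le> \<epsilon> powr p + \<epsilon> powr (p - P) * cmod (f t - g t) powr P"
    proof (cases "cmod (f t - g t) \<le> \<epsilon>")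
      case True
      then have "cmod (f t - g t) powr p \<le> \<epsilon> powr p" using p by (intro powr_mono2) auto
      then show ?thesis by (simp add: add_increasing2)
    next
      case False
      then have pos: "0 < cmod (f t - g t)" using \<epsilon> by linarith
      have "cmod (f t - g t) powr p = cmod (f t - g t) powr (p - P) * cmod (f t - g t) powr P"
        by (simp add: powr_add[symmetric])
      also have "\<dots> \<le> \<epsilon> powr (p - P) * cmod (f t - g t) powr P"
        using False \<epsilon> p by (intro mult_right_mono powr_mono2') auto
      finally show ?thesis by (simp add: add_increasing)
    qed
  qed (use int p in auto)
  also have "\<dots> = \<epsilon> powr p + \<epsilon> powr (p - P) * (LINT t|cube_measure d. cmod (f t - g t) powr P)"
    using int[of P] p by (simp add: prob_space)
  also have "\<dots> \<le> \<epsilon> powr p + \<epsilon> powr (p - P) * \<epsilon> powr P"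
    using le by (intro add_left_mono mult_left_mono) auto
  also have "\<dots> = 2 * \<epsilon> powr p" by (simp add: powr_add[symmetric])
  also have "\<dots> \<le> 2 powr p * \<epsilon> powr p"
    using p powr_mono[of 1 p 2] by (intro mult_right_mono) auto
  also have "\<dots> = (2 * \<epsilon>) powr p" using \<epsilon> by (simp add: powr_mult)
  finally show ?thesis .
qed

lemma complexity_le:
  assumes "recoverable n \<epsilon> d F p" "real n \<le> B"
  shows "ereal_of_enat (complexity \<epsilon> d F p) \<le> ereal B"
proof -
  have "complexity \<epsilon> d F p \<le> enat n"
    unfolding complexity_def using assms(1) by (intro INF_lower) simp
  then have "ereal_of_enat (complexity \<epsilon> d F p) \<le> ereal_of_enat (enat n)"
    by (simp only: ereal_of_enat_le_iff)
  also have "\<dots> \<le> ereal B" using assms(2) by simp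
  finally show ?thesis .
qed

section \<open>Choice of the numerical parameters\<close>

text \<open>
  The number of points occurs on both sides of its defining inequality, on one of them
  logarithmically.  This fact allows the final constant to absorb its own logarithm.
\<close>

lemma exists_dominating_affine_ln:
  fixes a b :: real
  assumes "0 \<le> a" "0 \<le> b"
  shows "\<exists>C\<ge>2. a + b * ln C \<le> C"
proof -
  define x where "x = 2 * b + a + 2"
  have x: "2 \<le> x" using assms by (simp add: x_def)
  have "ln (x\<^sup>2) \<le> 2 * x" using x ln_bound[of x] by (simp add: ln_realpow)
  then have "a + b * ln (x\<^sup>2) \<le> a + b * (2 * x)" using assms by (intro add_left_mono mult_left_mono)
  also have "\<dots> \<le> a * x + b * (2 * x)"
    using assms x by (intro add_right_mono) (simp add: mult_le_cancel_left1)
  also have "\<dots> \<le> x * x"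
    using x by (simp add: x_def algebra_simps)
  finally have "a + b * ln (x\<^sup>2) \<le> x\<^sup>2" by (simp add: power2_eq_square)
  moreover have "2 \<le> x\<^sup>2"
  proof -
    have "2 * 1 \<le> x * x" using x by (intro mult_mono) auto
    then show ?thesis by (simp add: power2_eq_square)
  qed
  ultimately show ?thesis by blast
qed

lemma ln_4_ge_1: "1 \<le> ln (4::real)"
proof -
  have "ln (4::real) = 2 * ln 2" using ln_realpow[of 2 2] by simp
  then show ?thesis using ln2_ge_two_thirds by linarith
qed

lemma ln_numeral_bounds: "ln (5::real) \<le> 2" "ln (16::real) \<le> 3"
proof -
  have e: "(1 + 1 + 1\<^sup>2 / 2 :: real) \<le> exp 1" by (rule exp_lower_Taylor_quadratic) simp
  have "(5/2 :: real)\<^sup>2 \<le> exp 1 ^ 2" using e by (intro power_mono) auto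
  then have "(5::real) \<le> exp 2" by (simp add: power2_eq_square exp_add[symmetric])
  then have "ln 5 \<le> ln (exp (2::real))" by (subst ln_le_cancel_iff) auto
  then show "ln (5::real) \<le> 2" by simp
  have "ln (16::real) = 4 * ln 2" using ln_realpow[of 2 4] by simp
  moreover have "ln (2::real) \<le> 3 / 4"
  proof -
    have "1 + 3/4 + (3/4)\<^sup>2 / 2 \<le> exp (3/4 :: real)" by (rule exp_lower_Taylor_quadratic) simp
    then have "(2::real) \<le> exp (3/4)" by (simp add: power2_eq_square)
    then have "ln 2 \<le> ln (exp (3/4::real))" by (subst ln_le_cancel_iff) auto
    then show ?thesis by simp
  qed
  ultimately show "ln (16::real) \<le> 3" by linarith
qed

lemma dyadic_accuracy_level:
  fixes \<epsilon> :: real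
  assumes "0 < \<epsilon>" "\<epsilon> < 1"
  obtains L :: nat where "1 \<le> L" "18 * (1 / 2) ^ L \<le> \<epsilon>" "real L \<le> 5 * ln (4 / \<epsilon>)"
proof
  define y where "y = ln (18 / \<epsilon>) / ln 2"
  define L where "L = nat \<lceil>y\<rceil>"
  have "1 < 18 / \<epsilon>" using assms by simp
  then have "0 < ln (18 / \<epsilon>)" by (rule ln_gt_zero)
  then have y: "0 < y" unfolding y_def by (rule divide_pos_pos) simp
  then show "1 \<le> L" unfolding L_def by linarith
  have L1: "y \<le> real L" unfolding L_def by linarith
  have L2: "real L \<le> y + 1" unfolding L_def using y by linarith
  have "ln (18 / \<epsilon>) \<le> real L * ln 2"
    using L1 unfolding y_def by (simp add: field_simps)
  also have "\<dots> = ln (2 ^ L)" by (simp add: ln_realpow)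
  finally have "18 / \<epsilon> \<le> 2 ^ L" using assms by (subst (asm) ln_le_cancel_iff) auto
  then show "18 * (1 / 2) ^ L \<le> \<epsilon>" using assms by (simp add: field_simps)
  have "36 / \<epsilon> \<le> (4 / \<epsilon>) ^ 3"
  proof -
    have "\<epsilon> * \<epsilon> \<le> 1 * 1" using assms by (intro mult_mono) auto
    then have "36 * (\<epsilon> * \<epsilon>) \<le> 64" by simp
    then have "36 * (\<epsilon> * \<epsilon>) / \<epsilon> ^ 3 \<le> 64 / \<epsilon> ^ 3"
      using assms by (intro divide_right_mono) auto
    then show ?thesis using assms by (simp add: power3_eq_cube field_simps)
  qed
  then have "ln (36 / \<epsilon>) \<le> ln ((4 / \<epsilon>) ^ 3)" using assms by (subst ln_le_cancel_iff) auto
  then have "ln (36 / \<epsilon>) \<le> 3 * ln (4 / \<epsilon>)" using assms by (simp add: ln_realpow)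
  moreover have "ln (36 / \<epsilon>) = ln (18 / \<epsilon>) + ln 2"
  proof -
    have "36 / \<epsilon> = 18 / \<epsilon> * 2" by simp
    then show ?thesis using assms by (simp only:) (subst ln_mult, auto)
  qed
  moreover have "(y + 1) * ln 2 = ln (18 / \<epsilon>) + ln 2"
    unfolding y_def by (simp add: distrib_right)
  ultimately have "(y + 1) * ln 2 \<le> 3 * ln (4 / \<epsilon>)"
    by linarith
  moreover have "(y + 1) * (2 / 3) \<le> (y + 1) * ln 2"
    using y ln2_ge_two_thirds by (intro mult_left_mono) auto
  moreover define l where "l = ln (4 / \<epsilon>)"
  moreover have "0 \<le> l" unfolding l_def using assms by simp
  ultimately have "(y + 1) * (2 / 3) \<le> 3 * l" by simp
  then have "2 * y + 2 \<le> 9 * l" by simp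
  then show "real L \<le> 5 * ln (4 / \<epsilon>)"
    using L2 \<open>0 \<le> l\<close> unfolding l_def[symmetric] by linarith
qed

text \<open>
  The cutoff \<open>M\<close> is the integer above the solution \<open>X\<close> of \<open>Z\<^sup>d X powr (- \<sigma>) = 4\<^bsup>-L\<^esup> / 4\<close>.
\<close>

lemma frequency_cutoff:
  fixes Z \<sigma> :: real and L d :: nat
  assumes "1 \<le> Z" "0 < \<sigma>"
  obtains M :: nat where "1 \<le> M" "2 * sqrt (Z ^ d * real M powr (- \<sigma>)) \<le> (1 / 2) ^ L"
    "ln (2 * real M + 1) \<le> 2 + (2 + 2 * real L + real d * ln Z) / \<sigma>"
proof
  define Y where "Y = 4 * 4 ^ L * Z ^ d"
  define X where "X = Y powr (1 / \<sigma>)"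
  define M where "M = nat \<lceil>X\<rceil>"
  have Zd: "1 \<le> Z ^ d" using assms by simp
  have "1 * 1 \<le> 4 * (4::real) ^ L" by (intro mult_mono) auto
  then have "1 * 1 \<le> Y" unfolding Y_def using Zd by (intro mult_mono) auto
  then have Y: "1 \<le> Y" by simp
  have X: "1 \<le> X" unfolding X_def using Y assms by (intro ge_one_powr_ge_zero) auto
  have M: "X \<le> real M" "real M \<le> X + 1" unfolding M_def using X by linarith+
  show "1 \<le> M" using M X by linarith
  have "Y = X powr \<sigma>" unfolding X_def using Y assms by (simp add: powr_powr)
  also have "\<dots> \<le> real M powr \<sigma>" using M X assms by (intro powr_mono2) auto
  finally have "Y \<le> real M powr \<sigma>" .
  then have "Z ^ d * real M powr (- \<sigma>) \<le> Z ^ d * (1 / Y)"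
    using Y assms by (intro mult_left_mono) (auto simp: powr_minus_divide frac_le)
  also have "\<dots> = ((1 / 2) ^ L / 2)\<^sup>2"
    using assms unfolding Y_def
    by (simp add: power_divide power2_eq_square power_mult_distrib[symmetric] field_simps)
  finally have "sqrt (Z ^ d * real M powr (- \<sigma>)) \<le> (1 / 2) ^ L / 2"
    by (intro real_le_lsqrt) auto
  then show "2 * sqrt (Z ^ d * real M powr (- \<sigma>)) \<le> (1 / 2) ^ L" by simp
  have "2 * real M + 1 \<le> 5 * X" using M X by linarith
  then have "ln (2 * real M + 1) \<le> ln (5 * X)" by (subst ln_le_cancel_iff) (use X in auto)
  also have "\<dots> = ln 5 + ln Y / \<sigma>"
    unfolding X_def using Y by (subst ln_mult) (auto simp: ln_powr)
  also have "ln Y = ln 4 + real L * ln 4 + real d * ln Z"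
    unfolding Y_def using assms by (simp add: ln_mult ln_realpow)
  also have "ln 5 + (ln 4 + real L * ln 4 + real d * ln Z) / \<sigma> \<le>
    2 + (2 + 2 * real L + real d * ln Z) / \<sigma>"
  proof -
    have "ln (4::real) \<le> ln 5" by (subst ln_le_cancel_iff) auto
    then have ln4: "ln (4::real) \<le> 2" using ln_numeral_bounds by linarith
    then have "real L * ln 4 \<le> real L * 2" by (intro mult_left_mono) auto
    then show ?thesis using ln4 ln_numeral_bounds(1) assms
      by (intro add_mono divide_right_mono) auto
  qed
  finally show "ln (2 * real M + 1) \<le> 2 + (2 + 2 * real L + real d * ln Z) / \<sigma>" .
qed

text \<open>
  With \<open>\<Lambda> = ln (4/\<epsilon>)\<close> and \<open>D = ln (d + 1)\<close> one has \<open>L = O(\<Lambda>)\<close>, a dictionary with logarithmic size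
  \<open>O(d\<^sup>2 \<Lambda>)\<close>, and \<open>ln n = O((1 + ln C) D \<Lambda>)\<close>.  The required number of points is therefore of the order of
  \<open>(1 + ln C) d\<^sup>2 D \<epsilon> powr (- P) \<Lambda>\<^sup>3\<close>, which is below \<open>n\<close> for large \<open>C\<close>.  Using \<open>4/\<epsilon>\<close> and \<open>d + 1\<close> keeps both
  logarithms away from zero for all \<open>d \<ge> 1\<close> and \<open>\<epsilon> < 1\<close>.
\<close>

lemma sample_size_estimate:
  fixes Z \<sigma> P :: real
  assumes Z: "1 \<le> Z" and \<sigma>: "0 < \<sigma>" and P: "0 \<le> P"
  shows "\<exists>C>0. \<forall>d::nat. \<forall>\<epsilon>::real. 0 < d \<longrightarrow> 0 < \<epsilon> \<longrightarrow> \<epsilon> < 1 \<longrightarrow>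
    (\<exists>n L M. 1 \<le> n \<and> 1 \<le> L \<and> 1 \<le> M \<and> 18 * (1 / 2) ^ L \<le> \<epsilon> \<and>
       2 * sqrt (Z ^ d * real M powr (- \<sigma>)) \<le> (1 / 2) ^ L \<and>
       (1024 * ln (8 * real n * (real n + 1)) + 1) * ln (4 * (2 * real M + 1) ^ d + 1) + ln (2 * real L)
         \<le> real n * \<epsilon> powr P / (8 * 9 powr P * real L) \<and>
       real n \<le> C * (real d)\<^sup>2 * ln (real d + 1) * \<epsilon> powr (- P) * ln (4 / \<epsilon>) ^ 4)"
proof -
  define a where "a = 2 + (12 + ln Z) / \<sigma>"
  have lnZ: "0 \<le> ln Z" using Z by simp
  have a: "2 \<le> a" using lnZ \<sigma> by (simp add: a_def)
  define \<alpha> where "\<alpha> = 80 * 9 powr P * (1024 * (4 * P + 30) * (a + 2) + 20)"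
  define \<beta> where "\<beta> = 80 * 9 powr P * (1024 * 4 * (a + 2))"
  have "0 \<le> \<alpha>" "0 \<le> \<beta>" using a P by (auto simp: \<alpha>_def \<beta>_def)
  then obtain C where C: "2 \<le> C" "\<alpha> + \<beta> * ln C \<le> C"
    using exists_dominating_affine_ln by blast
  have lnC: "0 \<le> ln C" using C by simp
  have C_ge: "80 * 9 powr P * (1024 * (4 * ln C + 4 * P + 30) * (a + 2) + 20) \<le> C"
    using C(2) unfolding \<alpha>_def \<beta>_def by (simp add: algebra_simps)
  show ?thesis
  proof (intro exI[of _ C] conjI allI impI)
    show "0 < C" using C by simp
    fix d :: nat and \<epsilon> :: real
    assume d: "0 < d" and \<epsilon>: "0 < \<epsilon>" "\<epsilon> < 1"
    define \<Lambda> where "\<Lambda> = ln (4 / \<epsilon>)"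
    define D where "D = ln (real d + 1)"
    have \<Lambda>: "1 \<le> \<Lambda>"
    proof -
      have "ln 4 \<le> ln (4 / \<epsilon>)" using \<epsilon> by (subst ln_le_cancel_iff) (auto simp: field_simps)
      then show ?thesis using ln_4_ge_1 unfolding \<Lambda>_def by linarith
    qed
    have D: "1 \<le> 2 * D"
    proof -
      have "ln 2 \<le> D" unfolding D_def using d by (subst ln_le_cancel_iff) auto
      then show ?thesis using ln2_ge_two_thirds by linarith
    qed
    have d1: "1 \<le> real d" using d by simp
    have D\<Lambda>: "1 \<le> 2 * (D * \<Lambda>)"
      using mult_mono[of 1 "2 * D" 1 \<Lambda>] D \<Lambda> by (simp add: mult.assoc)
    obtain L where L: "1 \<le> L" "18 * (1 / 2) ^ L \<le> \<epsilon>" "real L \<le> 5 * \<Lambda>"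
      using dyadic_accuracy_level[OF \<epsilon>] unfolding \<Lambda>_def by blast
    obtain M where M: "1 \<le> M" "2 * sqrt (Z ^ d * real M powr (- \<sigma>)) \<le> (1 / 2) ^ L"
      "ln (2 * real M + 1) \<le> 2 + (2 + 2 * real L + real d * ln Z) / \<sigma>"
      using frequency_cutoff[OF Z \<sigma>, of d L] by blast
    have d\<Lambda>: "1 \<le> real d * \<Lambda>" using mult_mono[of 1 "real d" 1 \<Lambda>] d1 \<Lambda> by simp
    have lnM: "ln (2 * real M + 1) \<le> a * (real d * \<Lambda>)"
    proof -
      have "\<Lambda> \<le> real d * \<Lambda>" using d1 \<Lambda> by (simp add: mult_le_cancel_right1)
      moreover have "real d * ln Z \<le> real d * \<Lambda> * ln Z"
        using d1 \<Lambda> lnZ by (intro mult_right_mono) (auto simp: mult_le_cancel_left1)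
      ultimately have "2 + 2 * real L + real d * ln Z \<le> (12 + ln Z) * (real d * \<Lambda>)"
        using L(3) d\<Lambda> by (simp add: algebra_simps)
      then have "(2 + 2 * real L + real d * ln Z) / \<sigma> \<le> (12 + ln Z) * (real d * \<Lambda>) / \<sigma>"
        using \<sigma> by (intro divide_right_mono) auto
      moreover have "2 \<le> 2 * (real d * \<Lambda>)" using d\<Lambda> by simp
      ultimately have "ln (2 * real M + 1) \<le> 2 * (real d * \<Lambda>) + (12 + ln Z) * (real d * \<Lambda>) / \<sigma>"
        using M(3) by linarith
      also have "\<dots> = a * (real d * \<Lambda>)" by (simp add: a_def distrib_right)
      finally show ?thesis .
    qed
    define W where "W = (2 * real M + 1) ^ d"
    have W: "1 \<le> W" unfolding W_def by (rule one_le_power) simp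
    have lnW: "ln (4 * W + 1) \<le> (a + 2) * ((real d)\<^sup>2 * \<Lambda>)"
    proof -
      have "ln (4 * W + 1) \<le> ln (5 * W)" using W by (subst ln_le_cancel_iff) auto
      also have "\<dots> = ln 5 + real d * ln (2 * real M + 1)"
        using W unfolding W_def by (subst ln_mult) (auto simp: ln_realpow)
      also have "\<dots> \<le> 2 + real d * (a * (real d * \<Lambda>))"
        using lnM ln_numeral_bounds by (intro add_mono mult_left_mono) auto
      also have "\<dots> \<le> 2 * ((real d)\<^sup>2 * \<Lambda>) + real d * (a * (real d * \<Lambda>))"
        using mult_mono[of 1 "(real d)\<^sup>2" 1 \<Lambda>] d1 \<Lambda> by simp
      also have "\<dots> = (a + 2) * ((real d)\<^sup>2 * \<Lambda>)" by (simp add: power2_eq_square algebra_simps)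
      finally show ?thesis .
    qed
    define B where "B = C * (real d)\<^sup>2 * D * \<epsilon> powr (- P) * \<Lambda> ^ 4"
    define n where "n = nat \<lfloor>B\<rfloor>"
    have eP: "1 \<le> \<epsilon> powr (- P)"
    proof -
      have "1 powr P \<le> (1 / \<epsilon>) powr P" using \<epsilon> P by (intro powr_mono2) auto
      then show ?thesis using \<epsilon> by (simp add: powr_divide powr_minus_divide)
    qed
    have B1: "1 \<le> B"
    proof -
      have "1 * 1 \<le> (2 * D) * (real d)\<^sup>2" using D d1 by (intro mult_mono) auto
      also have "\<dots> \<le> (C * D) * (real d)\<^sup>2" using C D by (intro mult_right_mono) auto
      finally have 1: "1 \<le> C * (real d)\<^sup>2 * D" by (simp add: mult_ac)
      then have "1 * 1 \<le> (C * (real d)\<^sup>2 * D) * \<epsilon> powr (- P)" using eP by (intro mult_mono) auto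
      then have 2: "1 \<le> C * (real d)\<^sup>2 * D * \<epsilon> powr (- P)" by simp
      have "1 * 1 \<le> (C * (real d)\<^sup>2 * D * \<epsilon> powr (- P)) * \<Lambda> ^ 4"
        using \<Lambda> 2 by (intro mult_mono[OF 2]) auto
      then show ?thesis by (simp add: B_def)
    qed
    have floor: "1 \<le> \<lfloor>B\<rfloor>" using B1 by (simp add: le_floor_iff)
    then have n_eq: "real n = real_of_int \<lfloor>B\<rfloor>" by (simp add: n_def)
    have n: "real n \<le> B" "B / 2 \<le> real n" "1 \<le> n"
      using floor n_eq by linarith+
    have lnB: "ln B \<le> (2 * ln C + 2 * P + 11) * (D * \<Lambda>)"
    proof -
      have "ln B = ln C + 2 * ln (real d) + ln D + P * ln (1 / \<epsilon>) + 4 * ln \<Lambda>"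
        unfolding B_def using C d1 D \<epsilon> \<Lambda>
        by (simp add: ln_mult ln_realpow ln_powr ln_div)
      moreover have "ln (real d) \<le> D" unfolding D_def using d1 by (subst ln_le_cancel_iff) auto
      moreover have "ln D \<le> D" using D by (intro ln_bound) auto
      moreover have "P * ln (1 / \<epsilon>) \<le> P * \<Lambda>"
        unfolding \<Lambda>_def using \<epsilon> P by (intro mult_left_mono) (auto simp: divide_right_mono)
      moreover have "ln \<Lambda> \<le> \<Lambda>" using \<Lambda> by (intro ln_bound) auto
      ultimately have 1: "ln B \<le> ln C + 3 * D + (P + 4) * \<Lambda>"
        by (simp add: distrib_right)
      have "ln C * 1 \<le> ln C * (2 * (D * \<Lambda>))" using D\<Lambda> lnC by (intro mult_left_mono)
      moreover have "3 * D * 1 \<le> 3 * D * \<Lambda>" using D \<Lambda> by (intro mult_left_mono) auto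
      moreover have "(P + 4) * \<Lambda> * 1 \<le> (P + 4) * \<Lambda> * (2 * D)" using D \<Lambda> P by (intro mult_left_mono) auto
      ultimately show ?thesis using 1 by (simp add: algebra_simps)
    qed
    have lnn: "1024 * ln (8 * real n * (real n + 1)) + 1 \<le> 1024 * (4 * ln C + 4 * P + 30) * (D * \<Lambda>)"
    proof -
      have "8 * real n * (real n + 1) \<le> 8 * B * (B + B)"
        using n B1 by (intro mult_mono) auto
      also have "\<dots> = 16 * B\<^sup>2" by (simp add: power2_eq_square)
      finally have "ln (8 * real n * (real n + 1)) \<le> ln (16 * B\<^sup>2)"
        using n B1 by (subst ln_le_cancel_iff) auto
      also have "\<dots> = ln 16 + 2 * ln B" using B1 by (simp add: ln_mult ln_realpow)
      also have "\<dots> \<le> 3 + 2 * ((2 * ln C + 2 * P + 11) * (D * \<Lambda>))"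
        using lnB ln_numeral_bounds by linarith
      finally have "1024 * ln (8 * real n * (real n + 1)) + 1 \<le>
        1024 * (3 + 2 * ((2 * ln C + 2 * P + 11) * (D * \<Lambda>))) + 1" by simp
      also have "\<dots> \<le> 1024 * (4 * ln C + 4 * P + 30) * (D * \<Lambda>)"
        using D\<Lambda> by (simp add: algebra_simps)
      finally show ?thesis .
    qed
    define V where "V = (real d)\<^sup>2 * D * \<Lambda>\<^sup>2"
    have V: "1 \<le> 2 * V"
    proof -
      have "1 * 1 \<le> (2 * D) * (real d)\<^sup>2" using D d1 by (intro mult_mono) auto
      then have 2: "1 \<le> (2 * D) * (real d)\<^sup>2" by simp
      have "1 * 1 \<le> ((2 * D) * (real d)\<^sup>2) * \<Lambda>\<^sup>2" using \<Lambda> 2 by (intro mult_mono[OF 2]) auto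
      then show ?thesis by (simp add: V_def mult_ac)
    qed
    have lnL: "ln (2 * real L) \<le> 20 * V"
    proof -
      have "ln (2 * real L) \<le> 2 * real L" using L by (intro ln_bound) auto
      also have "\<dots> \<le> 10 * \<Lambda>" using L by simp
      also have "\<dots> \<le> 20 * V"
      proof -
        have "1 * \<Lambda> \<le> (2 * (real d)\<^sup>2 * D * \<Lambda>) * \<Lambda>"
        proof (rule mult_right_mono)
          have "1 * 1 \<le> (2 * (D * \<Lambda>)) * (real d)\<^sup>2" using D\<Lambda> d1 by (intro mult_mono) auto
          then show "1 \<le> 2 * (real d)\<^sup>2 * D * \<Lambda>" by (simp add: mult_ac)
        qed (use \<Lambda> in auto)
        then show ?thesis by (simp add: V_def power2_eq_square mult_ac)
      qed
      finally show ?thesis .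
    qed
    have "(1024 * ln (8 * real n * (real n + 1)) + 1) * ln (4 * W + 1) + ln (2 * real L)
      \<le> (1024 * (4 * ln C + 4 * P + 30) * (D * \<Lambda>)) * ((a + 2) * ((real d)\<^sup>2 * \<Lambda>)) + 20 * V"
    proof (intro add_mono mult_mono lnn lnW lnL)
      show "0 \<le> 1024 * (4 * ln C + 4 * P + 30) * (D * \<Lambda>)" using lnC P D \<Lambda> by (intro mult_nonneg_nonneg) auto
      show "0 \<le> ln (4 * W + 1)" using W by simp
    qed
    also have "\<dots> = (1024 * (4 * ln C + 4 * P + 30) * (a + 2) + 20) * V"
      by (simp add: V_def power2_eq_square algebra_simps)
    also have "\<dots> \<le> (C / (80 * 9 powr P)) * V"
      using C_ge V by (intro mult_right_mono) (auto simp: field_simps)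
    also have "\<dots> \<le> (C / (80 * 9 powr P)) * (V * \<Lambda>)"
      using \<Lambda> V C by (intro mult_left_mono) (auto simp: mult_le_cancel_left1)
    also have "\<dots> = (B / 2) * \<epsilon> powr P / (8 * 9 powr P * (5 * \<Lambda>))"
      using \<epsilon> \<Lambda> by (simp add: V_def B_def powr_minus field_simps power2_eq_square power4_eq_xxxx)
    also have "\<dots> \<le> real n * \<epsilon> powr P / (8 * 9 powr P * real L)"
      using n B1 L \<Lambda> by (intro frac_le mult_right_mono mult_left_mono mult_nonneg_nonneg mult_pos_pos) auto
    finally show "\<exists>n L M. 1 \<le> n \<and> 1 \<le> L \<and> 1 \<le> M \<and> 18 * (1 / 2) ^ L \<le> \<epsilon> \<and>
       2 * sqrt (Z ^ d * real M powr (- \<sigma>)) \<le> (1 / 2) ^ L \<and>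
       (1024 * ln (8 * real n * (real n + 1)) + 1) * ln (4 * (2 * real M + 1) ^ d + 1) + ln (2 * real L)
         \<le> real n * \<epsilon> powr P / (8 * 9 powr P * real L) \<and>
       real n \<le> C * (real d)\<^sup>2 * ln (real d + 1) * \<epsilon> powr (- P) * ln (4 / \<epsilon>) ^ 4"
      using n L M unfolding W_def B_def D_def \<Lambda>_def by blast
  qed
qed

section \<open>Polynomial tractability\<close>

lemma exists_sampling_points_bound:
  fixes s P :: real
  assumes s: "1 / 2 < s" and P: "2 \<le> P"
  shows "\<exists>C>0. \<forall>d::nat. \<forall>\<epsilon>::real. 0 < d \<longrightarrow> 0 < \<epsilon> \<longrightarrow> \<epsilon> < 1 \<longrightarrow>
    (\<exists>n x. real n \<le> C * (real d)\<^sup>2 * ln (real d + 1) * \<epsilon> powr (- P) * ln (4 / \<epsilon>) ^ 4 \<and>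
       (\<forall>j<n. x j \<in> cube d) \<and> (\<forall>f\<in>F_mix s d. \<forall>g\<in>F_mix s d. (\<forall>j<n. f (x j) = g (x j)) \<longrightarrow>
         (LINT t|cube_measure d. cmod (f t - g t) powr P) \<le> \<epsilon> powr P))"
proof -
  obtain Z where Z: "1 \<le> Z"
    "\<And>R. (\<Sum>j\<in>{- int R..int R}. max 1 (real_of_int \<bar>j\<bar>) powr (- (s + 1 / 2))) \<le> Z"
    using sum_symmetric_powers_bounded[of "s + 1 / 2"] s by auto
  have \<sigma>: "0 < s - 1 / 2" and P0: "0 \<le> P" using s P by auto
  obtain C where C: "0 < C" and size: "\<forall>d::nat. \<forall>\<epsilon>::real. 0 < d \<longrightarrow> 0 < \<epsilon> \<longrightarrow> \<epsilon> < 1 \<longrightarrow>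
    (\<exists>n L M. 1 \<le> n \<and> 1 \<le> L \<and> 1 \<le> M \<and> 18 * (1 / 2) ^ L \<le> \<epsilon> \<and>
       2 * sqrt (Z ^ d * real M powr (- (s - 1 / 2))) \<le> (1 / 2) ^ L \<and>
       (1024 * ln (8 * real n * (real n + 1)) + 1) * ln (4 * (2 * real M + 1) ^ d + 1) + ln (2 * real L)
         \<le> real n * \<epsilon> powr P / (8 * 9 powr P * real L) \<and>
       real n \<le> C * (real d)\<^sup>2 * ln (real d + 1) * \<epsilon> powr (- P) * ln (4 / \<epsilon>) ^ 4)"
    using sample_size_estimate[OF Z(1) \<sigma> P0] by (elim exE conjE)
  show ?thesis
  proof (intro exI[of _ C] conjI allI impI)
    fix d :: nat and \<epsilon> :: real
    assume d: "0 < d" and \<epsilon>: "0 < \<epsilon>" "\<epsilon> < 1"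
    obtain n L M where nLM: "1 \<le> n" "1 \<le> L" "1 \<le> M" "18 * (1 / 2) ^ L \<le> \<epsilon>"
       "2 * sqrt (Z ^ d * real M powr (- (s - 1 / 2))) \<le> (1 / 2) ^ L"
       "(1024 * ln (8 * real n * (real n + 1)) + 1) * ln (4 * (2 * real M + 1) ^ d + 1) + ln (2 * real L)
         \<le> real n * \<epsilon> powr P / (8 * 9 powr P * real L)"
       "real n \<le> C * (real d)\<^sup>2 * ln (real d + 1) * \<epsilon> powr (- P) * ln (4 / \<epsilon>) ^ 4"
      using size[rule_format, OF d \<epsilon>] by (elim exE conjE)
    have "\<exists>x. (\<forall>j<n. x j \<in> cube d) \<and> (\<forall>f\<in>F_mix s d. \<forall>g\<in>F_mix s d. (\<forall>j<n. f (x j) = g (x j)) \<longrightarrow>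
         (LINT t|cube_measure d. cmod (f t - g t) powr P) \<le> \<epsilon> powr P)"
      by (rule exists_sampling_points[OF s d P \<epsilon>(1) nLM(2,4,1,3) Z(2) nLM(5,6)])
    with nLM(7) show "\<exists>n x. real n \<le> C * (real d)\<^sup>2 * ln (real d + 1) * \<epsilon> powr (- P) * ln (4 / \<epsilon>) ^ 4 \<and>
       (\<forall>j<n. x j \<in> cube d) \<and> (\<forall>f\<in>F_mix s d. \<forall>g\<in>F_mix s d. (\<forall>j<n. f (x j) = g (x j)) \<longrightarrow>
         (LINT t|cube_measure d. cmod (f t - g t) powr P) \<le> \<epsilon> powr P)"
      by (intro exI[of _ n]) simp
  qed (rule C)
qed

lemma recoverable_0_F_mix:
  assumes d: "0 < d" and p: "0 < p" and \<epsilon>: "1 \<le> \<epsilon>"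
  shows "recoverable 0 \<epsilon> d (F_mix s d) p"
proof -
  interpret prob_space "cube_measure d" by (rule prob_space_cube_measure)
  have "Lp_norm p d (\<lambda>t. f t - 0) \<le> ereal \<epsilon>" if f: "f \<in> F_mix s d" for f
  proof (rule Lp_norm_leI[OF p])
    have L: "f \<in> Lp_space p d" using p by (intro F_mix_subset_Lp_space[OF d _ f]) simp
    then show "(\<lambda>t. f t - 0) \<in> borel_measurable (cube_measure d)"
      and int: "integrable (cube_measure d) (\<lambda>x. cmod (f x - 0) powr p)"
      by (simp_all add: Lp_space_def)
    have "(LINT x|cube_measure d. cmod (f x - 0) powr p) \<le> (LINT x|cube_measure d. \<epsilon> powr p)"
      using int F_mix_bounded[OF d f] \<epsilon> p
      by (intro integral_mono powr_mono2) (auto simp: space_cube_measure intro: order_trans)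
    then show "(LINT x|cube_measure d. cmod (f x - 0) powr p) \<le> \<epsilon> powr p"
      by (simp add: prob_space)
  qed (use \<epsilon> in simp)
  moreover have "(\<lambda>_. 0) \<in> Lp_space p d" by (simp add: Lp_space_def)
  ultimately show ?thesis
    unfolding recoverable_def
    by (intro bexI[of _ "\<lambda>_ _. 0"] bexI[of _ "\<lambda>_ _. 0"] SUP_least) auto
qed

theorem corollary15:
  fixes s p :: real
  assumes "s > 1 / 2" and "p \<ge> 1"
  shows "polynomially_tractable (F_mix s) p \<and>
    (p \<ge> 2 \<longrightarrow>
      (\<exists>C>0. \<forall>d\<ge>2. \<forall>\<epsilon>\<in>{0<..<1/2}.
         ereal_of_enat (complexity \<epsilon> d (F_mix s d) p)
           \<le> ereal (C * (real d)\<^sup>2 * ln (real d) * \<epsilon> powr (- p) * ln (1 / \<epsilon>) ^ 4)))"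
proof (intro conjI impI)
  define P where "P = max 2 p"
  have P: "2 \<le> P" "p \<le> P" by (auto simp: P_def)
  obtain C where C: "0 < C" and points: "\<forall>d::nat. \<forall>\<epsilon>::real. 0 < d \<longrightarrow> 0 < \<epsilon> \<longrightarrow> \<epsilon> < 1 \<longrightarrow>
    (\<exists>n x. real n \<le> C * (real d)\<^sup>2 * ln (real d + 1) * \<epsilon> powr (- P) * ln (4 / \<epsilon>) ^ 4 \<and>
       (\<forall>j<n. x j \<in> cube d) \<and> (\<forall>f\<in>F_mix s d. \<forall>g\<in>F_mix s d. (\<forall>j<n. f (x j) = g (x j)) \<longrightarrow>
         (LINT t|cube_measure d. cmod (f t - g t) powr P) \<le> \<epsilon> powr P))"
    using exists_sampling_points_bound[OF assms(1) P(1)] by (elim exE conjE)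
  define C' where "C' = C * 2 powr P * 8 ^ 4"
  have C': "0 < C'" using C by (simp add: C'_def)
  have "ereal_of_enat (complexity \<epsilon> d (F_mix s d) p) \<le> ereal (C' * real d powr 3 * \<epsilon> powr (- (P + 4)))"
    if d: "1 \<le> d" and \<epsilon>: "0 < \<epsilon>" for d \<epsilon>
  proof (cases "1 \<le> \<epsilon>")
    case True
    then have "recoverable 0 \<epsilon> d (F_mix s d) p"
      using d assms(2) by (intro recoverable_0_F_mix) auto
    then show ?thesis
      using C' by (intro complexity_le) auto
  next
    case False
    \<comment> \<open>Lowering the exponent from \<open>P\<close> to \<open>p\<close> doubles the error.\<close>
    define \<eta> where "\<eta> = \<epsilon> / 2"
    have \<eta>: "0 < \<eta>" "\<eta> < 1" using \<epsilon> False by (auto simp: \<eta>_def)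
    have d0: "0 < d" using d by simp
    obtain n x where n: "real n \<le> C * (real d)\<^sup>2 * ln (real d + 1) * \<eta> powr (- P) * ln (4 / \<eta>) ^ 4"
      and x: "\<forall>j<n. x j \<in> cube d"
      and close: "\<forall>f\<in>F_mix s d. \<forall>g\<in>F_mix s d. (\<forall>j<n. f (x j) = g (x j)) \<longrightarrow>
         (LINT t|cube_measure d. cmod (f t - g t) powr P) \<le> \<eta> powr P"
      using points[rule_format, OF d0 \<eta>] by (elim exE conjE)
    have "recoverable n \<epsilon> d (F_mix s d) p"
    proof (rule recoverable_F_mixI[OF d0 _ _ x])
      fix f g assume fg: "f \<in> F_mix s d" "g \<in> F_mix s d" "\<forall>j<n. f (x j) = g (x j)"
      then have "(LINT t|cube_measure d. cmod (f t - g t) powr p) \<le> (2 * \<eta>) powr p"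
        using close by (intro F_mix_difference_lower_exponent[OF d0 assms(2) P(2) \<eta>(1)]) auto
      then show "(LINT t|cube_measure d. cmod (f t - g t) powr p) \<le> \<epsilon> powr p"
        by (simp add: \<eta>_def)
    qed (use assms \<epsilon> in auto)
    moreover have "real n \<le> C' * real d powr 3 * \<epsilon> powr (- (P + 4))"
    proof -
      have "ln (real d + 1) \<le> real d" using ln_add_one_self_le_self[of "real d"] by (simp add: add.commute)
      moreover have "ln (4 / \<eta>) \<le> 4 / \<eta>" using \<eta> by (intro ln_bound) simp
      moreover have "0 \<le> ln (4 / \<eta>)" using \<eta> by simp
      ultimately have "C * (real d)\<^sup>2 * ln (real d + 1) * \<eta> powr (- P) * ln (4 / \<eta>) ^ 4
        \<le> C * (real d)\<^sup>2 * real d * \<eta> powr (- P) * (4 / \<eta>) ^ 4"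
        using C \<eta> by (intro mult_mono power_mono mult_nonneg_nonneg) auto
      with n have "real n \<le> C * (real d)\<^sup>2 * real d * \<eta> powr (- P) * (4 / \<eta>) ^ 4"
        by (rule order_trans)
      also have "\<eta> powr (- P) = 2 powr P * \<epsilon> powr (- P)"
        using \<epsilon> by (simp add: \<eta>_def powr_divide powr_minus field_simps)
      also have "(4 / \<eta>) ^ 4 = 8 ^ 4 * \<epsilon> powr (- 4)"
      proof -
        have "4 / \<eta> = 8 / \<epsilon>" by (simp add: \<eta>_def)
        moreover have "\<epsilon> powr (- 4) = 1 / \<epsilon> ^ 4"
          using \<epsilon> powr_minus_divide[of \<epsilon> 4] by simp
        ultimately show ?thesis by (simp only: power_divide) simp
      qed
      also have "C * (real d)\<^sup>2 * real d * (2 powr P * \<epsilon> powr (- P)) * (8 ^ 4 * \<epsilon> powr (- 4)) =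
        C' * real d powr 3 * \<epsilon> powr (- (P + 4))"
      proof -
        have "\<epsilon> powr (- (P + 4)) = \<epsilon> powr (- P) * \<epsilon> powr (- 4)"
          by (simp add: powr_add[symmetric])
        moreover have "real d powr 3 = (real d)\<^sup>2 * real d"
          using d by (simp add: powr_numeral power3_eq_cube power2_eq_square)
        ultimately show ?thesis by (simp only: C'_def mult_ac)
      qed
      finally show ?thesis .
    qed
    ultimately show ?thesis by (rule complexity_le)
  qed
  then show "polynomially_tractable (F_mix s) p"
    unfolding polynomially_tractable_def using C' P
    by (intro exI[of _ C'] exI[of _ 3] exI[of _ "P + 4"]) auto
next
  assume p: "2 \<le> p"
  obtain C where C: "0 < C" and points: "\<forall>d::nat. \<forall>\<epsilon>::real. 0 < d \<longrightarrow> 0 < \<epsilon> \<longrightarrow> \<epsilon> < 1 \<longrightarrow>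
    (\<exists>n x. real n \<le> C * (real d)\<^sup>2 * ln (real d + 1) * \<epsilon> powr (- p) * ln (4 / \<epsilon>) ^ 4 \<and>
       (\<forall>j<n. x j \<in> cube d) \<and> (\<forall>f\<in>F_mix s d. \<forall>g\<in>F_mix s d. (\<forall>j<n. f (x j) = g (x j)) \<longrightarrow>
         (LINT t|cube_measure d. cmod (f t - g t) powr p) \<le> \<epsilon> powr p))"
    using exists_sampling_points_bound[OF assms(1) p] by (elim exE conjE)
  show "\<exists>C>0. \<forall>d\<ge>2. \<forall>\<epsilon>\<in>{0<..<1/2}. ereal_of_enat (complexity \<epsilon> d (F_mix s d) p)
           \<le> ereal (C * (real d)\<^sup>2 * ln (real d) * \<epsilon> powr (- p) * ln (1 / \<epsilon>) ^ 4)"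
  proof (intro exI[of _ "C * 2 * 3 ^ 4"] conjI allI impI ballI)
    show "0 < C * 2 * 3 ^ 4" using C by simp
    fix d :: nat and \<epsilon> :: real
    assume d: "2 \<le> d" and "\<epsilon> \<in> {0<..<1 / 2}"
    then have \<epsilon>: "0 < \<epsilon>" "\<epsilon> < 1 / 2" and d0: "0 < d" and \<epsilon>1: "\<epsilon> < 1" by auto
    obtain n x where n: "real n \<le> C * (real d)\<^sup>2 * ln (real d + 1) * \<epsilon> powr (- p) * ln (4 / \<epsilon>) ^ 4"
      and x: "\<forall>j<n. x j \<in> cube d"
      and close: "\<forall>f\<in>F_mix s d. \<forall>g\<in>F_mix s d. (\<forall>j<n. f (x j) = g (x j)) \<longrightarrow>
         (LINT t|cube_measure d. cmod (f t - g t) powr p) \<le> \<epsilon> powr p"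
      using points[rule_format, OF d0 \<epsilon>(1) \<epsilon>1] by (elim exE conjE)
    have "recoverable n \<epsilon> d (F_mix s d) p"
      using close p \<epsilon> by (intro recoverable_F_mixI[OF d0 _ _ x]) auto
    moreover have "real n \<le> C * 2 * 3 ^ 4 * (real d)\<^sup>2 * ln (real d) * \<epsilon> powr (- p) * ln (1 / \<epsilon>) ^ 4"
    proof -
      have "ln (real d + 1) \<le> 2 * ln (real d)"
      proof -
        have "real d + 1 \<le> 2 * real d" using d by simp
        also have "\<dots> \<le> real d * real d" using d by (intro mult_right_mono) auto
        finally have "real d + 1 \<le> real d ^ 2" by (simp only: power2_eq_square)
        then have "ln (real d + 1) \<le> ln (real d ^ 2)" using d by (subst ln_le_cancel_iff) auto
        then show ?thesis using d by (simp add: ln_realpow)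
      qed
      moreover have "ln (4 / \<epsilon>) \<le> 3 * ln (1 / \<epsilon>)"
      proof -
        have "\<epsilon> * \<epsilon> \<le> 1 / 2 * (1 / 2)" using \<epsilon> by (intro mult_mono) auto
        then have "4 * (\<epsilon> * \<epsilon>) / \<epsilon> ^ 3 \<le> 1 / \<epsilon> ^ 3" using \<epsilon> by (intro divide_right_mono) auto
        then have "4 / \<epsilon> \<le> (1 / \<epsilon>) ^ 3" using \<epsilon> by (simp add: power3_eq_cube field_simps)
        then have "ln (4 / \<epsilon>) \<le> ln ((1 / \<epsilon>) ^ 3)" using \<epsilon> by (subst ln_le_cancel_iff) auto
        then show ?thesis using \<epsilon> by (simp add: ln_realpow)
      qed
      moreover have "0 \<le> ln (4 / \<epsilon>)" using \<epsilon> by simp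
      ultimately have "C * (real d)\<^sup>2 * ln (real d + 1) * \<epsilon> powr (- p) * ln (4 / \<epsilon>) ^ 4
        \<le> C * (real d)\<^sup>2 * (2 * ln (real d)) * \<epsilon> powr (- p) * (3 * ln (1 / \<epsilon>)) ^ 4"
        using C d by (intro mult_mono power_mono mult_nonneg_nonneg) auto
      also have "\<dots> = C * 2 * 3 ^ 4 * (real d)\<^sup>2 * ln (real d) * \<epsilon> powr (- p) * ln (1 / \<epsilon>) ^ 4"
        by (simp only: power_mult_distrib mult_ac)
      finally show ?thesis using n by linarith
    qed
    ultimately show "ereal_of_enat (complexity \<epsilon> d (F_mix s d) p)
      \<le> ereal (C * 2 * 3 ^ 4 * (real d)\<^sup>2 * ln (real d) * \<epsilon> powr (- p) * ln (1 / \<epsilon>) ^ 4)"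
      by (rule complexity_le)
  qed
qed

end
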